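(* Let $\sigma>1$, $s=\sigma-1$, and let $m\in C^\infty(\mathbb{R}^3)$, $m\ge0$, be a weight satisfying $$\partial_\xi m(x,\xi,\eta)-x\,\partial_\eta m(x,\xi,\eta)=\left(x\,a(\xi,\eta)+b(\xi,\eta)\right)m(x,\xi,\eta)$$ for some $a,b\in G^\sigma(\mathbb{R}^2)$. Let $0<\alpha\le1$, $C_0>0$, $0<\varepsilon<1$, and let $\gamma>0$ be small enough, with $\gamma\ge\varepsilon^2/4$ and $x_{\varepsilon,\gamma}\le1$. Then there are constants $M>0$ depending on $C_0$ and $C>0$ depending on $C_0$ and $s$ such that for every $f:\mathbb{R}^2\to\mathbb{C}$ with $\|f\|_{C^{0,\alpha}(\mathbb{R}^2)}\le C_0$ and $\operatorname{supp}f\subset\{(x,y):y\ge x^2\}$, $$\|\mathcal{M}_{\varepsilon,\gamma}[fm_\gamma]\|_2\le4M\left(\frac{\log(C/\varepsilon)\,\log\log\left(M/\|R_m[f]\|_{\varepsilon,\gamma}\right)}{\log\left(M/\|R_m[f]\|_{\varepsilon,\gamma}\right)}\right)^\alpha$$ for small $\|R_m[f]\|_{\varepsilon,\gamma}$. (The right-hand side is read as $0$ when $\|R_m[f]\|_{\varepsilon,\gamma}=0$.)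
   Context: Gevrey classes: for open $\Omega\subset\mathbb{R}^n$ and $\sigma\ge1$, $G^\sigma(\Omega)$ is the set of $g\in C^\infty(\Omega)$ such that for every compact $K\subset\Omega$ there is $C>0$ with $|\partial^\beta g|\le C^{|\beta|+1}(\beta!)^\sigma$ on $K$ for all multi-indices $\beta$; for $\sigma>1$, $G_0^\sigma(\Omega)$ is the set of compactly supported elements. Hölder seminorm: $\|f\|_{C^{0,\alpha}(\mathbb{R}^2)}=\sup_{p\ne q}|f(p)-f(q)|/\|p-q\|^\alpha$. Weighted Radon transform: $R_m[f](\xi,\eta)=\int_{\mathbb{R}}f(x,\xi x+\eta)m(x,\xi,\eta)\,dx$. Modified weight: $m_\gamma(x,y)=m\left(x,\frac{y-\gamma}{x},\gamma\right)$ for $x\ne0$. Means: fix a nonnegative even $\phi\in G_0^\sigma(\mathbb{R})$ supported in $[-1,1]$ with $\int\phi=1$, and set $\phi_{\varepsilon|x|}(t)=\frac1{\varepsilon|x|}\phi\left(\frac{t}{\varepsilon|x|}\right)$. Then $\mathcal{M}_{\varepsilon,\gamma}[fm_\gamma](x)=\int f(x,y)m_\gamma(x,y)\phi_{\varepsilon|x|}(\gamma-y)\,dy$ for $x\ne0$ and $\mathcal{M}_{\varepsilon,\gamma}[fm_\gamma](0)=f(0,\gamma)m(0,0,\gamma)$. $x_{\varepsilon,\gamma}$ is the positive solution of $x^2=\varepsilon x+\gamma$; $x_{\varepsilon,\gamma}\le1$ guarantees that the mean is supported in $[-1,1]$. $\|\cdot\|_2$ is the norm of $L^2([-1,1])$.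 Data norm: $R_{\varepsilon,\gamma}=\{(\xi,\eta):|\xi|\le\varepsilon,|\eta|<\gamma\}$, and $\|\cdot\|_{\varepsilon,\gamma}$ is a fixed family of norms, increasing in $\varepsilon$ and $\gamma$, such that for some absolute constant $c>0$, $\|g\|_{\varepsilon,\gamma}\ge c\max\{\|g\|_{L^1(R_{\varepsilon,\gamma})},\|g(\cdot,\gamma)\|_{L^1[-\varepsilon,\varepsilon]}\}$; for example $\|g\|_{\varepsilon,\gamma}=\sup_{|\eta|\le\gamma}\|g(\cdot,\eta)\|_{L^1[-\varepsilon,\varepsilon]}$. The weight $m$ and $\phi$ are fixed, and constants may depend on them. "Small" means below a positive threshold not depending on $f$. *)

theory Defs
  imports "HOL-Analysis.Analysis"
begin

definition partial_deriv ::
    "'a::euclidean_space \<Rightarrow> ('a \<Rightarrow> 'b::real_normed_vector) \<Rightarrow> 'a \<Rightarrow> 'b" where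
  "partial_deriv i g x = vector_derivative (\<lambda>t::real. g (x + t *\<^sub>R i)) (at 0)"

text \<open>
  A list of basis vectors encodes an iterated partial derivative. The corresponding multi-index
  \<open>\<beta>\<close> counts the occurrences of each basis vector, so \<open>|\<beta>|\<close> is the length of the list and
  \<open>\<beta>!\<close> is given by \<open>multi_fact\<close>.
\<close>

primrec iter_partial ::
    "'a::euclidean_space list \<Rightarrow> ('a \<Rightarrow> 'b::real_normed_vector) \<Rightarrow> 'a \<Rightarrow> 'b" where
  "iter_partial [] g = g"
| "iter_partial (i # is) g = partial_deriv i (iter_partial is g)"

definition multi_fact :: "'a::euclidean_space list \<Rightarrow> real" where
  "multi_fact is = (\<Prod>i\<in>Basis. fact (count_list is i))"

text \<open>Both notions below are meant for open \<open>\<Omega>\<close>.\<close>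

definition smooth_on ::
    "'a::euclidean_space set \<Rightarrow> ('a \<Rightarrow> 'b::real_normed_vector) \<Rightarrow> bool" where
  "smooth_on \<Omega> g \<longleftrightarrow> (\<forall>is\<in>lists Basis. iter_partial is g differentiable_on \<Omega>)"

definition gevrey ::
    "real \<Rightarrow> 'a::euclidean_space set \<Rightarrow> ('a \<Rightarrow> 'b::real_normed_vector) \<Rightarrow> bool" where
  "gevrey \<sigma> \<Omega> g \<longleftrightarrow> smooth_on \<Omega> g \<and>
     (\<forall>K. compact K \<and> K \<subseteq> \<Omega> \<longrightarrow>
        (\<exists>C>0. \<forall>is\<in>lists Basis. \<forall>x\<in>K.
           norm (iter_partial is g x) \<le> C ^ (length is + 1) * multi_fact is powr \<sigma>))"

definition supp_on :: "'a::topological_space set \<Rightarrow> ('a \<Rightarrow> 'b::zero) \<Rightarrow> 'a set" where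
  "supp_on \<Omega> g = closure {x \<in> \<Omega>. g x \<noteq> 0}"

definition gevrey0 ::
    "real \<Rightarrow> 'a::euclidean_space set \<Rightarrow> ('a \<Rightarrow> 'b::real_normed_vector) \<Rightarrow> bool" where
  "gevrey0 \<sigma> \<Omega> g \<longleftrightarrow> gevrey \<sigma> \<Omega> g \<and> compact (supp_on \<Omega> g) \<and> supp_on \<Omega> g \<subseteq> \<Omega>"

definition holder_seminorm ::
    "real \<Rightarrow> ('a::metric_space \<Rightarrow> 'b::real_normed_vector) \<Rightarrow> ennreal" where
  "holder_seminorm \<alpha> f =
     (SUP (p, q) \<in> {(p, q). p \<noteq> q}. ennreal (norm (f p - f q) / dist p q powr \<alpha>))"

definition weighted_radon ::
    "(real \<times> real \<times> real \<Rightarrow> real) \<Rightarrow> (real \<times> real \<Rightarrow> complex) \<Rightarrow> real \<times> real \<Rightarrow> complex" where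
  "weighted_radon m f = (\<lambda>(\<xi>, \<eta>). LINT x|lborel. f (x, \<xi> * x + \<eta>) * of_real (m (x, \<xi>, \<eta>)))"

definition modified_weight ::
    "(real \<times> real \<times> real \<Rightarrow> real) \<Rightarrow> real \<Rightarrow> real \<times> real \<Rightarrow> real" where
  "modified_weight m \<gamma> = (\<lambda>(x, y). m (x, (y - \<gamma>) / x, \<gamma>))"

definition rescaled :: "(real \<Rightarrow> real) \<Rightarrow> real \<Rightarrow> real \<Rightarrow> real" where
  "rescaled \<phi> r t = \<phi> (t / r) / r"

definition mean ::
    "(real \<Rightarrow> real) \<Rightarrow> (real \<times> real \<times> real \<Rightarrow> real) \<Rightarrow> real \<Rightarrow> real
      \<Rightarrow> (real \<times> real \<Rightarrow> complex) \<Rightarrow> real \<Rightarrow> complex" where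
  "mean \<phi> m \<epsilon> \<gamma> f x =
     (if x = 0 then f (0, \<gamma>) * of_real (m (0, 0, \<gamma>))
      else LINT y|lborel. f (x, y) * of_real (modified_weight m \<gamma> (x, y))
             * of_real (rescaled \<phi> (\<epsilon> * \<bar>x\<bar>) (\<gamma> - y)))"

definition x_pos :: "real \<Rightarrow> real \<Rightarrow> real" where
  "x_pos \<epsilon> \<gamma> = (THE x. x > 0 \<and> x\<^sup>2 = \<epsilon> * x + \<gamma>)"

text \<open>Norms take values in \<^typ>\<open>ennreal\<close>; the value \<open>\<infinity>\<close> means that the function is not in the space.\<close>

definition L1_norm_on :: "'a::euclidean_space set \<Rightarrow> ('a \<Rightarrow> 'b::real_normed_vector) \<Rightarrow> ennreal" where
  "L1_norm_on S g = (\<integral>\<^sup>+ p\<in>S. ennreal (norm (g p)) \<partial>lborel)"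

definition L2_norm_on :: "'a::euclidean_space set \<Rightarrow> ('a \<Rightarrow> 'b::real_normed_vector) \<Rightarrow> ennreal" where
  "L2_norm_on S h =
     (let I = (\<integral>\<^sup>+ p\<in>S. ennreal ((norm (h p))\<^sup>2) \<partial>lborel)
      in if I = \<infinity> then \<infinity> else ennreal (sqrt (enn2real I)))"

definition data_region :: "real \<Rightarrow> real \<Rightarrow> (real \<times> real) set" where
  "data_region \<epsilon> \<gamma> = {(\<xi>, \<eta>). \<bar>\<xi>\<bar> \<le> \<epsilon> \<and> \<bar>\<eta>\<bar> < \<gamma>}"

text \<open>
  A norm on a space of functions is encoded as an \<^typ>\<open>ennreal\<close>-valued function that is \<open>\<infinity>\<close> off
  that space. Definiteness (up to null sets) is part of the lower bound in the last clause.
  The parameters are restricted to \<open>0 < \<epsilon> < 1\<close> and \<open>0 < \<gamma> < 1\<close>, where \<open>\<gamma> < 1\<close> follows from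
  \<open>x_pos \<epsilon> \<gamma> \<le> 1\<close>: for unbounded \<open>\<gamma>\<close> the norm \<open>sup_L1_norm\<close> below would satisfy the lower bound
  for no absolute \<open>c\<close>.
\<close>

definition data_norm_family ::
    "(real \<Rightarrow> real \<Rightarrow> (real \<times> real \<Rightarrow> complex) \<Rightarrow> ennreal) \<Rightarrow> bool" where
  "data_norm_family N \<longleftrightarrow>
     (\<forall>\<epsilon>\<in>{0<..<1}. \<forall>\<gamma>\<in>{0<..<1}. \<forall>g\<in>borel_measurable borel. \<forall>h\<in>borel_measurable borel.
        N \<epsilon> \<gamma> (\<lambda>p. g p + h p) \<le> N \<epsilon> \<gamma> g + N \<epsilon> \<gamma> h) \<and>
     (\<forall>\<epsilon>\<in>{0<..<1}. \<forall>\<gamma>\<in>{0<..<1}. \<forall>g\<in>borel_measurable borel. \<forall>z.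
        N \<epsilon> \<gamma> (\<lambda>p. z * g p) = ennreal (norm z) * N \<epsilon> \<gamma> g) \<and>
     (\<forall>\<epsilon>\<in>{0<..<1}. \<forall>\<gamma>\<in>{0<..<1}. \<forall>\<epsilon>'\<in>{\<epsilon>..<1}. \<forall>\<gamma>'\<in>{\<gamma>..<1}. \<forall>g\<in>borel_measurable borel.
        N \<epsilon> \<gamma> g \<le> N \<epsilon>' \<gamma>' g) \<and>
     (\<exists>c>0. \<forall>\<epsilon>\<in>{0<..<1}. \<forall>\<gamma>\<in>{0<..<1}. \<forall>g\<in>borel_measurable borel.
        ennreal c * max (L1_norm_on (data_region \<epsilon> \<gamma>) g)
                        (L1_norm_on {-\<epsilon>..\<epsilon>} (\<lambda>\<xi>. g (\<xi>, \<gamma>))) \<le> N \<epsilon> \<gamma> g)"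

definition sup_L1_norm :: "real \<Rightarrow> real \<Rightarrow> (real \<times> real \<Rightarrow> complex) \<Rightarrow> ennreal" where
  "sup_L1_norm \<epsilon> \<gamma> g = (SUP \<eta>\<in>{-\<gamma>..\<gamma>}. L1_norm_on {-\<epsilon>..\<epsilon>} (\<lambda>\<xi>. g (\<xi>, \<eta>)))"

lemma data_norm_family_sup_L1_norm: "data_norm_family sup_L1_norm"
proof -
  have slice [measurable]: "(\<lambda>\<xi>. g (\<xi>, \<eta>)) \<in> borel_measurable borel"
    if "g \<in> borel_measurable borel" for g :: "real \<times> real \<Rightarrow> complex" and \<eta>
  proof -
    have [measurable]: "g \<in> borel_measurable (borel \<Otimes>\<^sub>M borel)"
      using that by (simp add: borel_prod)
    show ?thesis by measurable
  qed
  have tri: "sup_L1_norm \<epsilon> \<gamma> (\<lambda>p. g p + h p) \<le> sup_L1_norm \<epsilon> \<gamma> g + sup_L1_norm \<epsilon> \<gamma> h"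
    if [measurable]: "g \<in> borel_measurable borel" "h \<in> borel_measurable borel" for \<epsilon> \<gamma> g h
    unfolding sup_L1_norm_def
  proof (rule SUP_least)
    fix \<eta> assume \<eta>: "\<eta> \<in> {-\<gamma>..\<gamma>}"
    have "L1_norm_on {-\<epsilon>..\<epsilon>} (\<lambda>\<xi>. g (\<xi>, \<eta>) + h (\<xi>, \<eta>))
        \<le> (\<integral>\<^sup>+\<xi>. ennreal (norm (g (\<xi>, \<eta>))) * indicator {-\<epsilon>..\<epsilon>} \<xi>
             + ennreal (norm (h (\<xi>, \<eta>))) * indicator {-\<epsilon>..\<epsilon>} \<xi> \<partial>lborel)"
      unfolding L1_norm_on_def
      by (intro nn_integral_mono)
         (auto simp: indicator_def norm_triangle_ineq simp flip: ennreal_plus intro!: ennreal_leI)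
    also have "\<dots> = L1_norm_on {-\<epsilon>..\<epsilon>} (\<lambda>\<xi>. g (\<xi>, \<eta>)) + L1_norm_on {-\<epsilon>..\<epsilon>} (\<lambda>\<xi>. h (\<xi>, \<eta>))"
      unfolding L1_norm_on_def by (intro nn_integral_add) measurable
    also have "\<dots> \<le> (SUP \<eta>\<in>{-\<gamma>..\<gamma>}. L1_norm_on {-\<epsilon>..\<epsilon>} (\<lambda>\<xi>. g (\<xi>, \<eta>)))
        + (SUP \<eta>\<in>{-\<gamma>..\<gamma>}. L1_norm_on {-\<epsilon>..\<epsilon>} (\<lambda>\<xi>. h (\<xi>, \<eta>)))"
      using \<eta> by (intro add_mono SUP_upper)
    finally show "L1_norm_on {-\<epsilon>..\<epsilon>} (\<lambda>\<xi>. g (\<xi>, \<eta>) + h (\<xi>, \<eta>)) \<le> \<dots>" .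
  qed
  have hom: "sup_L1_norm \<epsilon> \<gamma> (\<lambda>p. z * g p) = ennreal (norm z) * sup_L1_norm \<epsilon> \<gamma> g"
    if [measurable]: "g \<in> borel_measurable borel" for \<epsilon> \<gamma> g z
  proof -
    have "L1_norm_on {-\<epsilon>..\<epsilon>} (\<lambda>\<xi>. z * g (\<xi>, \<eta>))
        = ennreal (norm z) * L1_norm_on {-\<epsilon>..\<epsilon>} (\<lambda>\<xi>. g (\<xi>, \<eta>))" for \<eta>
      unfolding L1_norm_on_def
      by (subst nn_integral_cmult [symmetric]) (auto simp: norm_mult ennreal_mult mult.assoc)
    then show ?thesis
      unfolding sup_L1_norm_def by (simp add: SUP_mult_left_ennreal)
  qed
  have mono: "sup_L1_norm \<epsilon> \<gamma> g \<le> sup_L1_norm \<epsilon>' \<gamma>' g"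
    if "\<epsilon> \<le> \<epsilon>'" "\<gamma> \<le> \<gamma>'" for \<epsilon> \<gamma> \<epsilon>' \<gamma>' g
    unfolding sup_L1_norm_def
  proof (rule SUP_mono)
    fix \<eta> assume "\<eta> \<in> {-\<gamma>..\<gamma>}"
    moreover have "L1_norm_on {-\<epsilon>..\<epsilon>} (\<lambda>\<xi>. g (\<xi>, \<eta>)) \<le> L1_norm_on {-\<epsilon>'..\<epsilon>'} (\<lambda>\<xi>. g (\<xi>, \<eta>))"
      unfolding L1_norm_on_def using that by (intro nn_integral_mono) (auto simp: indicator_def)
    ultimately show "\<exists>\<eta>'\<in>{-\<gamma>'..\<gamma>'}. L1_norm_on {-\<epsilon>..\<epsilon>} (\<lambda>\<xi>. g (\<xi>, \<eta>))
        \<le> L1_norm_on {-\<epsilon>'..\<epsilon>'} (\<lambda>\<xi>. g (\<xi>, \<eta>'))"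
      using that by (intro bexI [of _ \<eta>]) auto
  qed
  have low: "ennreal (1/2) * max (L1_norm_on (data_region \<epsilon> \<gamma>) g)
                        (L1_norm_on {-\<epsilon>..\<epsilon>} (\<lambda>\<xi>. g (\<xi>, \<gamma>))) \<le> sup_L1_norm \<epsilon> \<gamma> g"
    if g: "g \<in> borel_measurable borel" and \<gamma>: "0 < \<gamma>" "\<gamma> < 1" for \<epsilon> \<gamma> g
  proof -
    have [measurable]: "g \<in> borel_measurable (borel \<Otimes>\<^sub>M borel)"
      using g by (simp add: borel_prod)
    have "L1_norm_on (data_region \<epsilon> \<gamma>) g = (\<integral>\<^sup>+p. (case p of (\<xi>, \<eta>) \<Rightarrow>
            ennreal (norm (g (\<xi>, \<eta>))) * indicator {-\<epsilon>..\<epsilon>} \<xi> * indicator {-\<gamma><..<\<gamma>} \<eta>)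
            \<partial>(lborel \<Otimes>\<^sub>M lborel))"
      unfolding L1_norm_on_def lborel_prod data_region_def
      by (intro nn_integral_cong) (auto simp: indicator_def)
    also have "\<dots> = (\<integral>\<^sup>+\<eta>. (\<integral>\<^sup>+\<xi>. ennreal (norm (g (\<xi>, \<eta>))) * indicator {-\<epsilon>..\<epsilon>} \<xi>
            * indicator {-\<gamma><..<\<gamma>} \<eta> \<partial>lborel) \<partial>lborel)"
      by (subst lborel_pair.nn_integral_snd [symmetric]) auto
    also have "\<dots> \<le> (\<integral>\<^sup>+\<eta>. sup_L1_norm \<epsilon> \<gamma> g * indicator {-\<gamma><..<\<gamma>} \<eta> \<partial>lborel)"
    proof (rule nn_integral_mono)
      fix \<eta> :: real
      have "(\<integral>\<^sup>+\<xi>. ennreal (norm (g (\<xi>, \<eta>))) * indicator {-\<epsilon>..\<epsilon>} \<xi>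
            * indicator {-\<gamma><..<\<gamma>} \<eta> \<partial>lborel)
          = L1_norm_on {-\<epsilon>..\<epsilon>} (\<lambda>\<xi>. g (\<xi>, \<eta>)) * indicator {-\<gamma><..<\<gamma>} \<eta>"
        unfolding L1_norm_on_def by (rule nn_integral_multc) (use slice [OF g] in measurable)
      also have "\<dots> \<le> sup_L1_norm \<epsilon> \<gamma> g * indicator {-\<gamma><..<\<gamma>} \<eta>"
        unfolding sup_L1_norm_def by (auto simp: indicator_def intro!: SUP_upper)
      finally show "(\<integral>\<^sup>+\<xi>. ennreal (norm (g (\<xi>, \<eta>))) * indicator {-\<epsilon>..\<epsilon>} \<xi>
            * indicator {-\<gamma><..<\<gamma>} \<eta> \<partial>lborel) \<le> \<dots>" .
    qed
    also have "\<dots> = sup_L1_norm \<epsilon> \<gamma> g * ennreal (2 * \<gamma>)"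
      using \<gamma> by (simp add: nn_integral_cmult_indicator)
    also have "\<dots> \<le> sup_L1_norm \<epsilon> \<gamma> g * ennreal 2"
      using \<gamma> by (intro mult_left_mono ennreal_leI) auto
    finally have 1: "L1_norm_on (data_region \<epsilon> \<gamma>) g \<le> sup_L1_norm \<epsilon> \<gamma> g * ennreal 2" .
    have "L1_norm_on {-\<epsilon>..\<epsilon>} (\<lambda>\<xi>. g (\<xi>, \<gamma>)) \<le> sup_L1_norm \<epsilon> \<gamma> g * ennreal 1"
      unfolding sup_L1_norm_def using \<gamma> by (auto intro!: SUP_upper)
    also have "\<dots> \<le> sup_L1_norm \<epsilon> \<gamma> g * ennreal 2"
      by (intro mult_left_mono ennreal_leI) auto
    finally have "ennreal (1/2) * max (L1_norm_on (data_region \<epsilon> \<gamma>) g)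
        (L1_norm_on {-\<epsilon>..\<epsilon>} (\<lambda>\<xi>. g (\<xi>, \<gamma>))) \<le> ennreal (1/2) * (sup_L1_norm \<epsilon> \<gamma> g * ennreal 2)"
      using 1 by (intro mult_left_mono max.boundedI) auto
    also have "\<dots> = (ennreal (1/2) * ennreal 2) * sup_L1_norm \<epsilon> \<gamma> g"
      by (simp only: ac_simps)
    also have "\<dots> = sup_L1_norm \<epsilon> \<gamma> g"
      by (subst ennreal_mult' [symmetric]) simp_all
    finally show ?thesis .
  qed
  show ?thesis
    unfolding data_norm_family_def
    by (intro conjI ballI allI exI [of _ "1/2"]) (use tri hom mono low in auto)
qed

end

theory Submission
  imports Defs "HOL-Computational_Algebra.Polynomial" "HOL-Real_Asymp.Real_Asymp"
begin

text \<open>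
Substituting \<open>y = \<xi> x + \<gamma>\<close> turns the mean into
\<open>h(x) = \<integral> f(x, \<xi> x + \<gamma>) m(x, \<xi>, \<gamma>) \<phi>(\<xi>/\<epsilon>)/\<epsilon> d\<xi>\<close>, a function of \<open>x\<close> that inherits the Hoelder
exponent of \<open>f\<close> with a constant independent of \<open>\<epsilon>\<close>, \<open>\<gamma>\<close> and \<open>\<alpha>\<close>, and that vanishes outside \<open>[-1,1]\<close>.
Two facts about \<open>h\<close> give the estimate.

First, every moment \<open>\<integral> x\<^sup>k h(x) dx\<close> is at most \<open>\<nu> A (4K)\<^sup>k k!\<^sup>\<sigma>\<close>, where \<open>\<nu>\<close> is the data norm. The equation for
\<open>m\<close> says that \<open>m\<close> changes at the logarithmic rate \<open>x a + b\<close> when a line is rotated about one of its points.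
Consequently \<open>(\<partial>\<^sub>\<eta> + a) R[x f] = (\<partial>\<^sub>\<xi> - b) R[f]\<close> in the weak sense. Since the lines with \<open>\<eta> < -\<gamma>\<close> miss the
region above the parabola, this is an initial value problem in \<open>\<eta>\<close>: a gauge factor removes \<open>a\<close>, and
one integration in \<open>\<eta>\<close> solves it. Moving everything onto the test function, a factor \<open>x\<close> in the moment
is traded for one application of \<open>\<partial>\<^sub>\<xi> + \<beta>\<close> and one integration (\<open>pairing_test_jet\<close>). After \<open>k\<close> rounds the
\<open>\<xi>\<close>-derivatives have hit the bump and the Gevrey function \<open>\<beta>\<close>, which costs \<open>k!\<^sup>\<sigma>\<close> (\<open>gevrey_jet_bound_test_jet\<close>),
and \<open>R[f]\<close> itself appears only undifferentiated, in \<open>L\<^sup>1\<close> (\<open>moment_bound\<close>).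

Second, a Hoelder function with small moments up to degree \<open>4n\<close> is of size \<open>n\<^sup>-\<^sup>\<alpha>\<close> in \<open>L\<^sup>2\<close>
(\<open>jackson_L2\<close>). It is within \<open>O(n\<^sup>-\<^sup>\<alpha>)\<close> of its convolution with a normalised polynomial kernel of Jackson
type, and the scalar product of \<open>h\<close> with that convolution is a quadratic form in the moments, whose
coefficients are at most \<open>n\<close> to the power \<open>O(n)\<close>.

The two facts combine to \<open>\<parallel>h\<parallel>\<^sub>2 \<le> M n\<^sup>-\<^sup>\<alpha>\<close> as soon as \<open>(P \<nu>)\<^sup>2 (256 K n)\<close> to the power \<open>t n\<close> is at most 1,
with \<open>t = 8\<sigma> + 12\<close> (\<open>L2_from_moments\<close>). With \<open>\<Lambda> = ln (M/\<nu>)\<close> this permits \<open>n \<approx> \<Lambda> / (t ln \<Lambda>)\<close>. The constants \<open>P\<close>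
and \<open>K\<close> depend on \<open>\<epsilon>\<close> and \<open>\<gamma>\<close>, but they influence only how small \<open>\<nu>\<close> has to be; what survives in the
final bound is the factor \<open>2t\<close>, and \<open>ln (C/\<epsilon>) \<ge> 2t\<close> for \<open>C = exp (2t)\<close>.
\<close>

section \<open>Polynomial approximation by a Jackson kernel\<close>

lemma power_self_le_exp_fact: "real n ^ n \<le> exp (real n) * fact n"
proof -
  have s: "summable (\<lambda>k. inverse (fact k) * real n ^ k)"
    by (rule summable_exp)
  have "(\<Sum>k\<in>{n}. inverse (fact k) * real n ^ k) \<le> (\<Sum>k. inverse (fact k) * real n ^ k)"
    by (rule sum_le_suminf[OF s]) auto
  also have "\<dots> = exp (real n)" by (simp add: exp_def scaleR_conv_of_real field_simps)
  finally show ?thesis by (simp add: field_simps)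
qed

text \<open>
The Taylor polynomial of \<open>sin v / v\<close> with \<open>n\<close> terms, at \<open>v = T u\<close>, as a polynomial in \<open>u\<close>.
\<close>

definition sinc_poly :: "nat \<Rightarrow> real \<Rightarrow> real poly" where
  "sinc_poly n T = (\<Sum>m<n. monom (sin_coeff (Suc m) * T ^ m) m)"

lemma poly_sinc_poly: "poly (sinc_poly n T) u = (\<Sum>m<n. sin_coeff (Suc m) * (T * u) ^ m)"
  by (simp add: sinc_poly_def poly_sum poly_monom power_mult_distrib mult_ac)

lemma sinc_poly_approx:
  fixes T u :: real
  defines "v \<equiv> T * u"
  shows "\<bar>v * poly (sinc_poly n T) u - sin v\<bar> \<le> \<bar>v\<bar> ^ Suc n / fact (Suc n)"
proof -
  have "v * poly (sinc_poly n T) u = (\<Sum>m<Suc n. sin_coeff m * v ^ m)"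
    unfolding poly_sinc_poly v_def sum.lessThan_Suc_shift
    by (simp add: sum_distrib_left mult_ac)
  then have "\<bar>v * poly (sinc_poly n T) u - sin v\<bar> = \<bar>sin v - (\<Sum>m<Suc n. sin_coeff m * v ^ m)\<bar>"
    by simp
  also have "\<dots> \<le> inverse (fact (Suc n)) * \<bar>v\<bar> ^ Suc n"
    by (rule Maclaurin_sin_bound)
  finally show ?thesis by (simp add: field_simps)
qed

lemma sinc_poly_0: "n \<ge> 1 \<Longrightarrow> T * u = 0 \<Longrightarrow> poly (sinc_poly n T) u = 1"
proof -
  assume n: "n \<ge> 1" and 0: "T * u = 0"
  obtain k where "n = Suc k" using n by (cases n) auto
  then show ?thesis
    unfolding poly_sinc_poly 0 by (simp add: sum.lessThan_Suc_shift sin_coeff_def del: sum.lessThan_Suc)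
qed

text \<open>
With \<open>T = n/8\<close> the argument \<open>v\<close> stays below \<open>n/4\<close> on \<open>[-2,2]\<close>, and \<open>(n/4)\<^sup>n \<le> n!\<close> because \<open>e < 4\<close>. The Taylor
remainder is then at most 1, and for \<open>|v| \<le> 1\<close> at most \<open>|v|/6\<close>, so the polynomial keeps the features of
\<open>sin v / v\<close> that a kernel needs: it is bounded, decays like \<open>1/v\<close>, and is bounded below near 0.
\<close>

lemma sinc_poly_bounds:
  fixes u :: real
  assumes n: "n \<ge> 2" and u: "\<bar>u\<bar> \<le> 2"
  defines "v \<equiv> real n / 8 * u" and "q \<equiv> poly (sinc_poly n (real n / 8)) u"
  shows "\<bar>q\<bar> \<le> 2" "\<bar>v * q\<bar> \<le> 2" "\<bar>v\<bar> \<le> 1 \<Longrightarrow> q \<ge> 1/2"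
proof -
  have v: "\<bar>v\<bar> \<le> real n / 4" unfolding v_def using mult_left_mono[OF u, of "real n"] by (simp add: abs_mult mult.commute)
  have err: "\<bar>v * q - sin v\<bar> \<le> \<bar>v\<bar> ^ Suc n / fact (Suc n)"
    unfolding v_def q_def by (rule sinc_poly_approx)
  have e4: "exp (real k) \<le> 4 ^ k" for k
  proof -
    have "exp (real k) = exp 1 ^ k" by (simp add: exp_of_nat_mult[symmetric])
    also have "\<dots> \<le> 4 ^ k" using exp_le by (intro power_mono) auto
    finally show ?thesis .
  qed
  have pf: "(real k / 4) ^ k \<le> fact k" for k
    using order_trans[OF power_self_le_exp_fact[of k] mult_right_mono[OF e4[of k], of "fact k"]]
    by (simp add: power_divide field_simps)
  have t1: "\<bar>v\<bar> ^ n / fact (Suc n) \<le> 1"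
  proof -
    have "\<bar>v\<bar> ^ n \<le> (real n / 4) ^ n" using v by (intro power_mono) auto
    also have "\<dots> \<le> fact n" by (rule pf)
    also have "(fact n::real) \<le> fact (Suc n)" by (rule fact_mono) auto
    finally show ?thesis by simp
  qed
  have t2: "\<bar>v\<bar> ^ Suc n / fact (Suc n) \<le> 1"
  proof -
    have "\<bar>v\<bar> ^ Suc n \<le> (real (Suc n) / 4) ^ Suc n" using v by (intro power_mono) auto
    also have "\<dots> \<le> fact (Suc n)" by (rule pf)
    finally show ?thesis by simp
  qed
  show "\<bar>v * q\<bar> \<le> 2" using err t2 abs_sin_le_one[of v] by linarith
  have q0: "q = 1" if "v = 0" using that n sinc_poly_0 unfolding v_def q_def by simp
  show "\<bar>q\<bar> \<le> 2"
  proof (cases "v = 0")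
    case False
    have "\<bar>v\<bar> * \<bar>q\<bar> = \<bar>v * q\<bar>" by (simp add: abs_mult)
    also have "\<dots> \<le> \<bar>v\<bar> + \<bar>v\<bar> * (\<bar>v\<bar> ^ n / fact (Suc n))"
      using err abs_sin_x_le_abs_x[of v] by (simp add: mult.commute)
    also have "\<dots> \<le> \<bar>v\<bar> + \<bar>v\<bar> * 1" using t1 by (intro add_left_mono mult_left_mono) auto
    finally have "\<bar>v\<bar> * \<bar>q\<bar> \<le> \<bar>v\<bar> * 2" by simp
    then show ?thesis using False by simp
  qed (use q0 in simp)
  show "q \<ge> 1/2" if v1: "\<bar>v\<bar> \<le> 1"
  proof (cases "v = 0")
    case False
    have p1: "\<bar>v\<bar> ^ k \<le> 1" for k using v1 by (simp add: power_le_one)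
    have f6: "fact (Suc n) \<ge> (6::real)"
      using fact_mono[of 3 "Suc n", where ?'a = real] n by (simp add: fact_numeral)
    have "\<bar>sin v - (\<Sum>m<3. sin_coeff m * v ^ m)\<bar> \<le> inverse (fact 3) * \<bar>v\<bar> ^ 3"
      by (rule Maclaurin_sin_bound)
    then have s: "\<bar>sin v - v\<bar> \<le> \<bar>v\<bar> * (\<bar>v\<bar> ^ 2 / 6)"
      by (simp add: sin_coeff_def fact_numeral numeral_3_eq_3 field_simps power2_eq_square)
    have s': "\<bar>v\<bar> * (\<bar>v\<bar> ^ 2 / 6) \<le> \<bar>v\<bar> * (1/6)" using p1[of 2] by (intro mult_left_mono) auto
    have e': "\<bar>v\<bar> ^ Suc n / fact (Suc n) \<le> \<bar>v\<bar> * (1/6)"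
    proof -
      have "\<bar>v\<bar> ^ n / fact (Suc n) \<le> 1 / 6"
        using p1[of n] f6 by (intro frac_le) auto
      then have "\<bar>v\<bar> * (\<bar>v\<bar> ^ n / fact (Suc n)) \<le> \<bar>v\<bar> * (1/6)" by (intro mult_left_mono) auto
      then show ?thesis by simp
    qed
    have "\<bar>v * q - v\<bar> \<le> \<bar>v\<bar> * (1/3)" using err s s' e' by linarith
    then have "\<bar>v\<bar> * \<bar>q - 1\<bar> \<le> \<bar>v\<bar> * (1/3)"
      by (simp add: abs_mult[symmetric] right_diff_distrib)
    then have "\<bar>q - 1\<bar> \<le> 1/3" using False by simp
    then show ?thesis by linarith
  qed (use q0 in simp)
qed

lemma coeff_mult_bound:
  fixes p q :: "real poly"
  assumes "\<And>j. \<bar>coeff p j\<bar> \<le> a" "\<And>j. \<bar>coeff q j\<bar> \<le> b" "degree p \<le> d" "a \<ge> 0" "b \<ge> 0"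
  shows "\<bar>coeff (p * q) j\<bar> \<le> real (Suc d) * (a * b)"
proof -
  have "\<bar>coeff (p * q) j\<bar> \<le> (\<Sum>i\<le>j. \<bar>coeff p i\<bar> * \<bar>coeff q (j - i)\<bar>)"
    unfolding coeff_mult by (rule order_trans[OF sum_abs]) (simp add: abs_mult)
  also have "\<dots> = (\<Sum>i\<in>{..j} \<inter> {..d}. \<bar>coeff p i\<bar> * \<bar>coeff q (j - i)\<bar>)"
    using assms(3) by (intro sum.mono_neutral_right) (auto simp: coeff_eq_0)
  also have "\<dots> \<le> (\<Sum>i\<in>{..j} \<inter> {..d}. a * b)"
    by (intro sum_mono mult_mono assms) auto
  also have "\<dots> \<le> (\<Sum>i\<in>{..d}. a * b)"
    using assms by (intro sum_mono2) auto
  finally show ?thesis by simp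
qed

text \<open>
The fourth power makes the kernel nonnegative and its decay \<open>1/v\<^sup>4\<close>, which is enough for a first
absolute moment of order \<open>1/n\<^sup>2\<close>. The square, that is the Fejer kernel, would lose a logarithm for \<open>\<alpha> = 1\<close>.
\<close>

definition jackson_poly :: "nat \<Rightarrow> real poly" where
  "jackson_poly n = sinc_poly n (real n / 8) ^ 4"

lemma degree_sinc_poly: "degree (sinc_poly n T) \<le> n"
  unfolding sinc_poly_def
  by (rule degree_sum_le) (auto intro: order_trans[OF degree_monom_le])

lemma degree_jackson_poly: "degree (jackson_poly n) \<le> 4 * n"
proof -
  have "degree (jackson_poly n) \<le> degree (sinc_poly n (real n / 8)) * 4"
    unfolding jackson_poly_def by (rule degree_power_le)
  then show ?thesis using degree_sinc_poly[of n "real n / 8"] by linarith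
qed

lemma coeff_sinc_poly_le:
  assumes "n \<ge> 1" shows "\<bar>coeff (sinc_poly n (real n / 8)) j\<bar> \<le> real n ^ n"
proof (cases "j < n")
  case True
  have "coeff (sinc_poly n (real n / 8)) j = (\<Sum>m<n. if m = j then sin_coeff (Suc m) * (real n / 8) ^ m else 0)"
    unfolding sinc_poly_def coeff_sum by (intro sum.cong) auto
  also have "\<dots> = sin_coeff (Suc j) * (real n / 8) ^ j" using True by simp
  finally have "\<bar>coeff (sinc_poly n (real n / 8)) j\<bar> = \<bar>sin_coeff (Suc j)\<bar> * (real n / 8) ^ j"
    by (simp add: abs_mult power_abs)
  also have "\<dots> \<le> 1 * real n ^ j"
  proof (intro mult_mono)
    have "\<bar>sin_coeff (Suc j)\<bar> \<le> 1 / fact (Suc j)"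
      by (simp add: sin_coeff_def abs_mult power_abs)
    also have "\<dots> \<le> 1" using fact_ge_1[of "Suc j", where ?'a=real] by (simp add: divide_le_eq_1)
    finally show "\<bar>sin_coeff (Suc j)\<bar> \<le> 1" .
    show "(real n / 8) ^ j \<le> real n ^ j" by (rule power_mono) auto
  qed auto
  also have "\<dots> \<le> real n ^ n" using assms True by (simp add: power_increasing)
  finally show ?thesis .
next
  case False
  then have "coeff (sinc_poly n (real n / 8)) j = 0"
    unfolding sinc_poly_def coeff_sum by (intro sum.neutral) auto
  then show ?thesis by simp
qed

lemma coeff_jackson_poly_le:
  assumes "n \<ge> 1"
  shows "\<bar>coeff (jackson_poly n) j\<bar> \<le> real (2*n+1) * real (n+1) ^ 2 * real n ^ (4*n)"
proof -
  let ?p = "sinc_poly n (real n / 8)"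
  have 2: "\<bar>coeff (?p * ?p) i\<bar> \<le> real (Suc n) * (real n ^ n * real n ^ n)" for i
    by (rule coeff_mult_bound) (use coeff_sinc_poly_le assms degree_sinc_poly in auto)
  have "degree (?p * ?p) \<le> 2 * n"
    using degree_mult_le[of ?p ?p] degree_sinc_poly[of n "real n / 8"] by linarith
  then have "\<bar>coeff ((?p * ?p) * (?p * ?p)) j\<bar> \<le> real (Suc (2 * n)) *
     ((real (Suc n) * (real n ^ n * real n ^ n)) * (real (Suc n) * (real n ^ n * real n ^ n)))"
    by (intro coeff_mult_bound 2) auto
  also have "(?p * ?p) * (?p * ?p) = jackson_poly n"
    unfolding jackson_poly_def by (simp add: power4_eq_xxxx mult_ac)
  also have "real (Suc (2 * n)) *
     ((real (Suc n) * (real n ^ n * real n ^ n)) * (real (Suc n) * (real n ^ n * real n ^ n)))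
     = real (2*n+1) * real (n+1) ^ 2 * real n ^ (4*n)"
    unfolding power_mult[of _ 4 n, symmetric] mult.commute[of 4 n] power_mult[of _ n 4] power4_eq_xxxx
    by (simp add: power2_eq_square mult_ac)
  finally show ?thesis .
qed


text \<open>
A majorant with an elementary primitive for the kernel and its first absolute moment at once.
\<close>

lemma kernel_decay:
  fixes v q :: real
  assumes "\<bar>q\<bar> \<le> 2" "\<bar>v * q\<bar> \<le> 2"
  shows "(1 + \<bar>v\<bar>) * q ^ 4 \<le> 128 / (1 + v\<^sup>2)"
proof -
  have a: "q ^ 2 \<le> 4" using power_mono[OF assms(1), of 2] by simp
  have b: "v ^ 2 * q ^ 2 \<le> 4" using power_mono[OF assms(2), of 2] by (simp add: power_mult_distrib)
  have c: "(1 + v ^ 2) * q ^ 2 \<le> 8" using a b by (simp add: distrib_right)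
  have "((1 + v ^ 2) * q ^ 2) ^ 2 \<le> 8 ^ 2" using c by (intro power_mono) auto
  then have d: "(1 + v ^ 2) ^ 2 * q ^ 4 \<le> 64"
    by (simp add: power_mult_distrib flip: power_mult)
  have e: "1 + \<bar>v\<bar> \<le> 2 * (1 + v ^ 2)"
    using zero_le_power2[of "\<bar>v\<bar> - 1"] unfolding power2_diff power2_abs by (simp, smt (verit) zero_le_power2)
  have "((1 + \<bar>v\<bar>) * q ^ 4) * (1 + v ^ 2) \<le> (2 * (1 + v ^ 2) * q ^ 4) * (1 + v ^ 2)"
    using e by (intro mult_right_mono) auto
  also have "\<dots> = 2 * ((1 + v ^ 2) ^ 2 * q ^ 4)" by (simp add: power2_eq_square mult_ac)
  also have "\<dots> \<le> 128" using d by linarith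
  finally show ?thesis by (simp add: pos_le_divide_eq add_pos_nonneg)
qed

lemma continuous_on_poly_compose [continuous_intros]:
  "continuous_on S g \<Longrightarrow> continuous_on S (\<lambda>x. poly p (g x :: real))"
  by (rule continuous_on_compose2[of UNIV "poly p"]) (auto intro: continuous_on_poly continuous_on_id)

lemma jackson_mass:
  assumes n: "n \<ge> 2"
  shows "integral {-2..2} (poly (jackson_poly n)) \<ge> 1 / (2 * real n)"
proof -
  let ?w = "poly (jackson_poly n)"
  define r where "r = 8 / real n"
  \<comment> \<open>the kernel is at least \<open>1/16\<close> for \<open>|u| \<le> 8/n\<close>, which must be cut off at 2 when \<open>n < 4\<close>\<close>
  define r' where "r' = min r 2"
  have r: "r > 0" "r \<le> 4" using n by (auto simp: r_def field_simps)
  have r': "r' > 0" "r' \<le> 2" "r' \<le> r" "r' \<ge> r / 2" using r unfolding r'_def by auto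
  have w: "?w u = poly (sinc_poly n (real n / 8)) u ^ 4" for u
    by (simp add: jackson_poly_def)
  have int: "?w integrable_on {a..b}" for a b
    by (rule integrable_continuous_real) (auto intro!: continuous_intros)
  have "1 / (2 * real n) \<le> 2 * r' * (1/16)" using r' n by (simp add: r_def field_simps)
  also have "\<dots> = integral {-r'..r'} (\<lambda>u. 1/16::real)" using r' by simp
  also have "\<dots> \<le> integral {-r'..r'} ?w"
  proof (rule integral_le)
    fix u assume u: "u \<in> {-r'..r'}"
    have "\<bar>real n / 8 * u\<bar> \<le> real n / 8 * r"
      unfolding abs_mult using u r' by (intro mult_mono) auto
    also have "\<dots> = 1" using n by (simp add: r_def)
    finally have "poly (sinc_poly n (real n / 8)) u \<ge> 1/2"
      using sinc_poly_bounds(3)[OF n, of u] u r' by auto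
    then have "(1/2) ^ 4 \<le> poly (sinc_poly n (real n / 8)) u ^ 4" by (intro power_mono) auto
    then show "1/16 \<le> ?w u" by (simp add: w power4_eq_xxxx)
  qed (auto intro: int)
  also have "\<dots> \<le> integral {-2..2} ?w"
    using r' by (intro integral_subset_le int) (auto simp: w)
  finally show ?thesis .
qed

lemma jackson_moment:
  assumes n: "n \<ge> 2"
  shows "integral {-2..2} (\<lambda>u. (1 + \<bar>real n / 8 * u\<bar>) * poly (jackson_poly n) u) \<le> 4096 / real n"
proof -
  define T where "T = real n / 8"
  have T: "T > 0" using n by (simp add: T_def)
  have hi: "((\<lambda>u. 128 / (1 + (T * u)\<^sup>2)) has_integral (128 / T * arctan (T * 2) - 128 / T * arctan (T * (-2)))) {-2..2}"
  proof (rule fundamental_theorem_of_calculus)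
    fix u :: real
    have "((\<lambda>u. 128 / T * arctan (T * u)) has_real_derivative 128 / (1 + (T * u)\<^sup>2)) (at u within {-2..2})"
      by (rule derivative_eq_intros refl | use T in \<open>simp add: inverse_eq_divide\<close>)+
    then show "((\<lambda>u. 128 / T * arctan (T * u)) has_vector_derivative 128 / (1 + (T * u)\<^sup>2)) (at u within {-2..2})"
      by (rule has_real_derivative_iff_has_vector_derivative[THEN iffD1])
  qed simp
  have "integral {-2..2} (\<lambda>u. (1 + \<bar>real n / 8 * u\<bar>) * poly (jackson_poly n) u)
     \<le> integral {-2..2} (\<lambda>u. 128 / (1 + (T * u)\<^sup>2))"
  proof (rule integral_le)
    show "(\<lambda>u. (1 + \<bar>real n / 8 * u\<bar>) * poly (jackson_poly n) u) integrable_on {-2..2}"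
      by (rule integrable_continuous_real) (auto intro!: continuous_intros)
    show "(\<lambda>u. 128 / (1 + (T * u)\<^sup>2)) integrable_on {-2..2}" using hi by blast
    fix u :: real assume "u \<in> {-2..2}"
    then show "(1 + \<bar>real n / 8 * u\<bar>) * poly (jackson_poly n) u \<le> 128 / (1 + (T * u)\<^sup>2)"
      unfolding T_def using kernel_decay[OF sinc_poly_bounds(1,2)[OF n, of u]] 
      by (simp add: jackson_poly_def abs_le_iff)
  qed
  also have "\<dots> = 256 / T * arctan (T * 2)" using integral_unique[OF hi] by (simp add: arctan_minus)
  also have "\<dots> \<le> 256 / T * 2"
  proof (intro mult_left_mono)
    show "arctan (T * 2) \<le> 2" using arctan_ubound[of "T*2"] pi_less_4 by linarith
  qed (use T in auto)
  also have "\<dots> = 4096 / real n" by (simp add: T_def)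
  finally show ?thesis .
qed

definition moment :: "(real \<Rightarrow> complex) \<Rightarrow> nat \<Rightarrow> complex" where
  "moment h k = integral {-1..1} (\<lambda>x. of_real (x ^ k) * h x)"

text \<open>
Expanding \<open>(x - t)\<^sup>j\<close> by the binomial theorem separates the variables, so the double integral only sees
the moments of \<open>h\<close>; the binomial coefficients of one row add up to \<open>2\<^sup>j\<close>.
\<close>

lemma bilinear_moment_bound:
  fixes h :: "real \<Rightarrow> complex" and p :: "real poly"
  assumes h: "continuous_on {-1..1} h"
    and B: "\<And>k. k \<le> degree p \<Longrightarrow> norm (moment h k) \<le> B"
  shows "norm (integral {-1..1} (\<lambda>x. cnj (h x) * integral {-1..1} (\<lambda>t. of_real (poly p (x - t)) * h t)))
     \<le> B\<^sup>2 * (\<Sum>j\<le>degree p. \<bar>coeff p j\<bar> * 2 ^ j)"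
proof -
  let ?D = "degree p"
  define c :: "nat \<Rightarrow> nat \<Rightarrow> complex" where "c j i = of_real (coeff p j * real (j choose i) * (-1) ^ (j - i))" for j i
  have P: "of_real (poly p (x - t)) = (\<Sum>j\<le>?D. \<Sum>i\<le>j. c j i * (of_real (x ^ i) * of_real (t ^ (j - i))))" for x t
  proof -
    have "poly p (x - t) = (\<Sum>j\<le>?D. coeff p j * (x + - t) ^ j)" by (simp add: poly_altdef)
    also have "\<dots> = (\<Sum>j\<le>?D. \<Sum>i\<le>j. coeff p j * real (j choose i) * (-1) ^ (j - i) * (x ^ i * t ^ (j - i)))"
      unfolding binomial_ring sum_distrib_left
      by (intro sum.cong refl) (simp add: power_minus[of t] mult_ac)
    finally show ?thesis by (simp add: c_def)
  qed
  have ch: "continuous_on {-1..1} (\<lambda>x. cnj (h x))" using h by (intro continuous_intros)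
  have inti: "(\<lambda>t. of_real (t ^ k) * h t) integrable_on {-1..1}" for k
    by (rule integrable_continuous_real) (intro continuous_intros h)
  have intc: "(\<lambda>x. of_real (x ^ k) * cnj (h x)) integrable_on {-1..1}" for k
    by (rule integrable_continuous_real) (intro continuous_intros ch)
  have inner: "integral {-1..1} (\<lambda>t. of_real (poly p (x - t)) * h t)
     = (\<Sum>j\<le>?D. \<Sum>i\<le>j. c j i * of_real (x ^ i) * moment h (j - i))" for x
  proof -
    have "integral {-1..1} (\<lambda>t. of_real (poly p (x - t)) * h t)
       = integral {-1..1} (\<lambda>t. \<Sum>j\<le>?D. \<Sum>i\<le>j. (c j i * of_real (x ^ i)) * (of_real (t ^ (j - i)) * h t))"
      unfolding P by (simp add: sum_distrib_left sum_distrib_right mult_ac)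
    also have "\<dots> = (\<Sum>j\<le>?D. \<Sum>i\<le>j. c j i * of_real (x ^ i) * moment h (j - i))"
      unfolding moment_def
      by (subst integral_sum; (intro finite_atMost integrable_sum integrable_on_mult_right inti)?)
         (intro sum.cong refl, subst integral_sum; (intro finite_atMost integrable_on_mult_right inti)?; simp)
    finally show ?thesis .
  qed
  have mc: "integral {-1..1} (\<lambda>x. of_real (x ^ i) * cnj (h x)) = cnj (moment h i)" for i
    unfolding moment_def by (simp add: integral_cnj)
  have "integral {-1..1} (\<lambda>x. cnj (h x) * integral {-1..1} (\<lambda>t. of_real (poly p (x - t)) * h t))
     = integral {-1..1} (\<lambda>x. \<Sum>j\<le>?D. \<Sum>i\<le>j. (c j i * moment h (j - i)) * (of_real (x ^ i) * cnj (h x)))"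
    unfolding inner by (simp add: sum_distrib_left sum_distrib_right mult_ac)
  also have "\<dots> = (\<Sum>j\<le>?D. \<Sum>i\<le>j. (c j i * moment h (j - i)) * cnj (moment h i))"
    unfolding mc[symmetric]
    by (subst integral_sum; (intro finite_atMost integrable_sum integrable_on_mult_right intc)?)
       (intro sum.cong refl, subst integral_sum; (intro finite_atMost integrable_on_mult_right intc)?; simp)
  finally have eq: "integral {-1..1} (\<lambda>x. cnj (h x) * integral {-1..1} (\<lambda>t. of_real (poly p (x - t)) * h t))
     = (\<Sum>j\<le>?D. \<Sum>i\<le>j. (c j i * moment h (j - i)) * cnj (moment h i))" .
  have B0: "B \<ge> 0" using B[of 0] norm_ge_zero order_trans by blast
  have "norm (\<Sum>j\<le>?D. \<Sum>i\<le>j. (c j i * moment h (j - i)) * cnj (moment h i))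
     \<le> (\<Sum>j\<le>?D. \<Sum>i\<le>j. \<bar>coeff p j\<bar> * real (j choose i) * (B * B))"
  proof (intro sum_norm_le)
    fix j i assume "j \<in> {..?D}" "i \<in> {..j}"
    then have "norm (moment h (j - i)) * norm (moment h i) \<le> B * B"
      by (intro mult_mono B B0) auto
    then have "\<bar>coeff p j\<bar> * real (j choose i) * (norm (moment h (j - i)) * norm (moment h i)) \<le> \<bar>coeff p j\<bar> * real (j choose i) * (B * B)"
      by (intro mult_left_mono) auto
    then show "norm ((c j i * moment h (j - i)) * cnj (moment h i)) \<le> \<bar>coeff p j\<bar> * real (j choose i) * (B * B)"
      by (simp add: c_def norm_mult norm_power abs_mult mult_ac)
  qed
  also have "\<dots> = (\<Sum>j\<le>?D. \<bar>coeff p j\<bar> * 2 ^ j * (B * B))"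
  proof (intro sum.cong refl)
    fix j
    have "(\<Sum>i\<le>j. real (j choose i)) = 2 ^ j"
      using choose_row_sum[of j] by (simp flip: of_nat_sum)
    then show "(\<Sum>i\<le>j. \<bar>coeff p j\<bar> * real (j choose i) * (B * B)) = \<bar>coeff p j\<bar> * 2 ^ j * (B * B)"
      by (simp flip: sum_distrib_left sum_distrib_right)
  qed
  finally show ?thesis unfolding eq by (simp add: sum_distrib_left mult_ac power2_eq_square)
qed


lemma powr_le_one_plus: "0 \<le> x \<Longrightarrow> 0 < a \<Longrightarrow> a \<le> 1 \<Longrightarrow> x powr a \<le> 1 + (x::real)"
proof (cases "x \<le> 1")
  case True
  assume "0 \<le> x" "0 < a" "a \<le> 1"
  then have "x powr a \<le> 1 powr a" using True by (intro powr_mono2) auto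
  then show ?thesis using \<open>0 \<le> x\<close> by simp
next
  case False
  assume "0 \<le> x" "0 < a" "a \<le> 1"
  then have "x powr a \<le> x powr 1" using False by (intro powr_mono) auto
  then show ?thesis using False by simp
qed

lemma holder_continuous:
  fixes h :: "'a::metric_space \<Rightarrow> 'b::metric_space"
  assumes "\<And>x y. dist (h x) (h y) \<le> M * dist x y powr \<alpha>" "\<alpha> > 0"
  shows "continuous_on UNIV h"

  unfolding continuous_on_def
proof
  fix x :: 'a
  show "(h \<longlongrightarrow> h x) (at x within UNIV)"
  proof (rule metric_tendsto_imp_tendsto)
    have d: "((\<lambda>y. dist y x) \<longlongrightarrow> dist x x) (at x)"
      by (rule tendsto_dist[OF tendsto_ident_at tendsto_const])
    have "((\<lambda>y. dist y x powr \<alpha>) \<longlongrightarrow> 0) (at x)"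
    proof (rule tendsto_zero_powrI)
      show "((\<lambda>y. dist y x) \<longlongrightarrow> 0) (at x)" using d by simp
      show "((\<lambda>y. \<alpha>) \<longlongrightarrow> \<alpha>) (at x)" by (rule tendsto_const)
      show "\<forall>\<^sub>F y in at x. 0 \<le> dist y x" by (rule always_eventually) simp
    qed (rule assms(2))
    then show "((\<lambda>y. M * dist y x powr \<alpha>) \<longlongrightarrow> 0) (at x within UNIV)"
      by (rule tendsto_mult_right_zero)
    show "\<forall>\<^sub>F y in at x within UNIV. dist (h y) (h x) \<le> dist (M * dist y x powr \<alpha>) 0"
      by (intro always_eventually allI) (rule order_trans[OF assms(1)], simp)
  qed
qed

text \<open>
Let \<open>w\<close> be the Jackson kernel and \<open>Z\<close> its integral over \<open>[-2,2]\<close>. As \<open>h\<close> vanishes outside \<open>[-1,1]\<close>, the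
convolution \<open>p = w * h\<close> satisfies \<open>|Z h - p| \<le> Z d\<close> on \<open>[-1,1]\<close> by the Hoelder condition. Hence
\<open>Z \<parallel>h\<parallel>\<^sup>2 = \<integral> cnj h (Z h - p) + \<integral> cnj h p\<close>; the first term is absorbed by the inequality
\<open>2 |h| d \<le> |h|\<^sup>2 + d\<^sup>2\<close>, and the second is the quadratic form in the moments.
The constant is \<open>2 \<cdot> 8 \<cdot> 4096\<close>: the factors come from \<open>1/Z \<le> 2n\<close>, from \<open>(n/8)\<^sup>-\<^sup>\<alpha> \<le> 8 n\<^sup>-\<^sup>\<alpha>\<close> and from the first
absolute moment of the kernel.
\<close>

lemma jackson_L2:
  fixes h :: "real \<Rightarrow> complex"
  assumes hol: "\<And>x y. norm (h x - h y) \<le> M * \<bar>x - y\<bar> powr \<alpha>"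
    and \<alpha>: "0 < \<alpha>" "\<alpha> \<le> 1"
    and supp: "\<And>x. \<bar>x\<bar> \<ge> 1 \<Longrightarrow> h x = 0"
    and n: "n \<ge> 2"
    and B: "\<And>k. k \<le> 4 * n \<Longrightarrow> norm (moment h k) \<le> B"
  defines "d \<equiv> 65536 * M * real n powr (- \<alpha>)"
  shows "integral {-1..1} (\<lambda>x. (norm (h x))\<^sup>2)
    \<le> 2 * d\<^sup>2 + 4 * real n * (B\<^sup>2 * (\<Sum>j\<le>degree (jackson_poly n). \<bar>coeff (jackson_poly n) j\<bar> * 2 ^ j))"
proof -
  define w where "w = poly (jackson_poly n)"
  define Z where "Z = integral {-2..2} w"
  define T where "T = real n / 8"
  define S where "S = B\<^sup>2 * (\<Sum>j\<le>degree (jackson_poly n). \<bar>coeff (jackson_poly n) j\<bar> * 2 ^ j)"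
  define p where "p x = integral {-1..1} (\<lambda>t. of_real (w (x - t)) * h t)" for x
  define V where "V = integral {-1..1} (\<lambda>x. cnj (h x) * p x)"
  have T: "T > 0" using n by (simp add: T_def)
  have M: "M \<ge> 0" using order_trans[OF norm_ge_zero hol[of 0 1]] by simp
  have n0: "real n > 0" using n by simp
  have Z: "Z \<ge> 1 / (2 * real n)" unfolding Z_def w_def using jackson_mass[OF n] .
  have Z0: "Z > 0" by (rule less_le_trans[OF _ Z]) (use n0 in simp)
  have w0: "w u \<ge> 0" for u unfolding w_def jackson_poly_def by simp
  have ch: "continuous_on UNIV h"
    by (rule holder_continuous[of h M \<alpha>]) (use hol \<alpha> in \<open>auto simp: dist_norm\<close>)
  note [continuous_intros] = continuous_on_compose2[OF ch _ subset_UNIV]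
  have cw: "continuous_on UNIV w" unfolding w_def by (intro continuous_intros)
  note [continuous_intros] = continuous_on_compose2[OF cw _ subset_UNIV]
  have V: "norm V \<le> S"
    unfolding V_def p_def w_def S_def
    by (rule bilinear_moment_bound)
       (use B degree_jackson_poly[of n] in \<open>auto intro!: continuous_intros\<close>)
  have cp: "continuous_on {-1..1} p"
  proof -
    have "continuous_on {-1..1} (\<lambda>x. integral (cbox (-1) 1) (\<lambda>t. of_real (w (x - t)) * h t))"
      by (rule integral_continuous_on_param) (auto intro!: continuous_intros simp: split_beta)
    then show ?thesis by (simp add: p_def)
  qed
  have peq: "p x = integral {-2..2} (\<lambda>u. of_real (w u) * h (x - u))" if x: "x \<in> {-1..1}" for x
  proof -
    let ?g = "\<lambda>t. of_real (w (x - t)) * h t"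
    \<comment> \<open>reflect, translate, and discard the part where \<open>h\<close> vanishes\<close>
    have refl: "integral {-2..2} (\<lambda>u. G (- u)) = integral {-2..2::real} G" for G :: "real \<Rightarrow> complex"
      using Henstock_Kurzweil_Integration.integral_reflect_real[of 2 "-2" G] by simp
    have "integral {-2..2} (\<lambda>u. of_real (w u) * h (x - u))
       = integral {-2..2} (\<lambda>v. of_real (w (-v)) * h (x + v))"
      by (subst refl[symmetric]) simp
    also have "\<dots> = integral {-2..2} (?g \<circ> (\<lambda>v. v + x))"
      by (simp add: o_def add.commute)
    also have "\<dots> = integral {-2+x..2+x} ?g"
      by (rule integral_shift) (intro continuous_intros)
    also have "\<dots> = integral {-1..1} ?g"
    proof (rule integral_unique, rule has_integral_on_superset)
      show "(?g has_integral integral {-1..1} ?g) {-1..1}"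
        by (intro integrable_integral integrable_continuous_real continuous_intros)
      show "t \<notin> {-1..1} \<Longrightarrow> ?g t = 0" for t using supp[of t] by auto
    qed (use x in auto)
    finally show ?thesis unfolding p_def by simp
  qed
  have close: "norm (of_real Z * h x - p x) \<le> Z * d" if x: "x \<in> {-1..1}" for x
  proof -
    have "of_real Z = integral {-2..2} (\<lambda>u. complex_of_real (w u))"
    proof -
      have "(w has_integral Z) {-2..2}" unfolding Z_def
        by (intro integrable_integral integrable_continuous_real continuous_intros)
      then show ?thesis by (metis has_integral_of_real integral_unique)
    qed
    then have "of_real Z * h x = integral {-2..2} (\<lambda>u. of_real (w u) * h x)" by simp
    then have "of_real Z * h x - p x = integral {-2..2} (\<lambda>u. of_real (w u) * h x - of_real (w u) * h (x - u))"
      unfolding peq[OF x]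
      by (subst integral_diff) (auto intro!: integrable_continuous_real continuous_intros)
    also have "norm \<dots> \<le> integral {-2..2} (\<lambda>u. M * T powr (-\<alpha>) * ((1 + \<bar>real n / 8 * u\<bar>) * poly (jackson_poly n) u))"
    proof (rule integral_norm_bound_integral)
      fix u :: real
      \<comment> \<open>trading the fractional power for a first moment keeps the constant uniform in \<open>\<alpha>\<close>\<close>
      have "\<bar>u\<bar> powr \<alpha> = T powr (-\<alpha>) * (T * \<bar>u\<bar>) powr \<alpha>"
        using T by (simp add: powr_mult powr_minus)
      also have "\<dots> \<le> T powr (-\<alpha>) * (1 + T * \<bar>u\<bar>)"
        using T \<alpha> by (intro mult_left_mono powr_le_one_plus) auto
      finally have u: "\<bar>u\<bar> powr \<alpha> \<le> T powr (-\<alpha>) * (1 + T * \<bar>u\<bar>)" .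
      have "norm (of_real (w u) * h x - of_real (w u) * h (x - u)) = w u * norm (h x - h (x - u))"
        using w0[of u] by (simp add: right_diff_distrib[symmetric] norm_mult)
      also have "\<dots> \<le> w u * (M * \<bar>u\<bar> powr \<alpha>)"
        using hol[of x "x - u"] w0[of u] by (intro mult_left_mono) auto
      also have "\<dots> \<le> w u * (M * (T powr (-\<alpha>) * (1 + T * \<bar>u\<bar>)))"
        using u M w0[of u] by (intro mult_left_mono) auto
      also have "\<dots> = M * T powr (-\<alpha>) * ((1 + \<bar>real n / 8 * u\<bar>) * poly (jackson_poly n) u)"
        using T by (simp add: w_def T_def abs_mult mult_ac)
      finally show "norm (of_real (w u) * h x - of_real (w u) * h (x - u)) \<le> \<dots>" .
    qed (auto intro!: integrable_continuous_real continuous_intros)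
    also have "\<dots> = M * T powr (-\<alpha>) * integral {-2..2} (\<lambda>u. (1 + \<bar>real n / 8 * u\<bar>) * poly (jackson_poly n) u)"
      by simp
    also have "\<dots> \<le> M * T powr (-\<alpha>) * (4096 / real n)"
      using M by (intro mult_left_mono jackson_moment[OF n]) auto
    also have "\<dots> \<le> M * (8 * real n powr (-\<alpha>)) * (4096 / real n)"
    proof -
      have "T powr (-\<alpha>) = 8 powr \<alpha> * real n powr (-\<alpha>)"
        by (simp add: T_def powr_divide powr_minus field_simps)
      also have "8 powr \<alpha> \<le> (8::real) powr 1" using \<alpha> by (intro powr_mono) auto
      finally have "T powr (-\<alpha>) \<le> 8 * real n powr (-\<alpha>)" by (simp add: mult_right_mono)
      then show ?thesis using M by (intro mult_right_mono mult_left_mono) auto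
    qed
    also have "\<dots> = 1 / (2 * real n) * d" using n0 by (simp add: d_def)
    also have "\<dots> \<le> Z * d" using Z M by (intro mult_right_mono) (auto simp: d_def)
    finally show ?thesis .
  qed
  have "Z * integral {-1..1} (\<lambda>x. (norm (h x))\<^sup>2) \<le> Z * integral {-1..1} (\<lambda>x. (norm (h x))\<^sup>2 / 2) + Z * d\<^sup>2 + norm V"
  proof -
    define E where "E = integral {-1..1} (\<lambda>x. cnj (h x) * (of_real Z * h x - p x))"
    have sq: "(complex_of_real (norm (h x)))\<^sup>2 = h x * cnj (h x)" for x
      by (metis complex_norm_square of_real_power)
    have "of_real (Z * integral {-1..1} (\<lambda>x. (norm (h x))\<^sup>2)) = integral {-1..1} (\<lambda>x. complex_of_real (Z * (norm (h x))\<^sup>2))"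
    proof -
      have "((\<lambda>x. Z * (norm (h x))\<^sup>2) has_integral (Z * integral {-1..1} (\<lambda>x. (norm (h x))\<^sup>2))) {-1..1}"
        by (intro has_integral_mult_right integrable_integral integrable_continuous_real continuous_intros)
      then show ?thesis by (metis has_integral_of_real integral_unique)
    qed
    also have "\<dots> = integral {-1..1} (\<lambda>x. cnj (h x) * (of_real Z * h x - p x) + cnj (h x) * p x)"
      by (simp add: right_diff_distrib sq mult_ac)
    also have "\<dots> = E + V"
      unfolding E_def V_def
      by (rule integral_add) (auto intro!: integrable_continuous_real continuous_intros cp)
    finally have "Z * integral {-1..1} (\<lambda>x. (norm (h x))\<^sup>2) = Re (E + V)" by (metis Re_complex_of_real)
    also have "\<dots> \<le> norm E + norm V" by (meson complex_Re_le_cmod norm_triangle_ineq order_trans)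
    also have "norm E \<le> integral {-1..1} (\<lambda>x. Z * ((norm (h x))\<^sup>2 / 2) + Z * (d\<^sup>2 / 2))"
      unfolding E_def
    proof (rule integral_norm_bound_integral)
      fix x :: real assume x: "x \<in> {-1..1}"
      have "norm (cnj (h x) * (of_real Z * h x - p x)) \<le> norm (h x) * (Z * d)"
        using close[OF x] by (simp add: norm_mult mult_left_mono)
      also have "\<dots> = Z * (norm (h x) * d)" by simp
      also have "\<dots> \<le> Z * ((norm (h x))\<^sup>2 / 2 + d\<^sup>2 / 2)"
        using zero_le_power2[of "norm (h x) - d"] Z0 by (intro mult_left_mono) (auto simp: power2_diff)
      finally show "norm (cnj (h x) * (of_real Z * h x - p x)) \<le> Z * ((norm (h x))\<^sup>2 / 2) + Z * (d\<^sup>2 / 2)"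
        by (simp add: distrib_left)
    qed (auto intro!: integrable_continuous_real continuous_intros cp)
    also have "\<dots> = Z * integral {-1..1} (\<lambda>x. (norm (h x))\<^sup>2 / 2) + Z * d\<^sup>2"
    proof (rule integral_unique)
      have "((\<lambda>x. (norm (h x))\<^sup>2 / 2) has_integral integral {-1..1} (\<lambda>x. (norm (h x))\<^sup>2 / 2)) {-1..1}"
        by (intro integrable_integral integrable_continuous_real continuous_intros) auto
      then have "((\<lambda>x. Z * ((norm (h x))\<^sup>2 / 2) + Z * (d\<^sup>2 / 2)) has_integral
          (Z * integral {-1..1} (\<lambda>x. (norm (h x))\<^sup>2 / 2) + 2 *\<^sub>R (Z * (d\<^sup>2 / 2)))) {-1..1}"
        by (intro has_integral_add has_integral_mult_right) (use has_integral_const_real[of "Z * (d\<^sup>2 / 2)" "-1" 1] in simp_all)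
      then show "((\<lambda>x. Z * ((norm (h x))\<^sup>2 / 2) + Z * (d\<^sup>2 / 2)) has_integral
          Z * integral {-1..1} (\<lambda>x. (norm (h x))\<^sup>2 / 2) + Z * d\<^sup>2) {-1..1}" by simp
    qed
    finally show ?thesis by simp
  qed
  then have "Z * integral {-1..1} (\<lambda>x. (norm (h x))\<^sup>2) \<le> 2 * Z * d\<^sup>2 + 2 * norm V"
    by simp
  then have "Z * integral {-1..1} (\<lambda>x. (norm (h x))\<^sup>2) \<le> Z * (2 * d\<^sup>2 + 2 * norm V / Z)"
    using Z0 by (simp add: distrib_left)
  then have "integral {-1..1} (\<lambda>x. (norm (h x))\<^sup>2) \<le> 2 * d\<^sup>2 + 2 * norm V / Z"
    using Z0 by simp
  also have "2 * norm V / Z \<le> 2 * norm V / (1 / (2 * real n))"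
    using Z Z0 n0 by (intro divide_left_mono) (auto intro!: divide_pos_pos)
  also have "\<dots> \<le> 4 * real n * S" using V n0 by simp
  finally show ?thesis unfolding S_def by simp
qed

section \<open>Jets of Gevrey functions and their integrals\<close>

text \<open>
A chain rule that asks for joint continuity of only one of the two partial derivatives.
\<close>

lemma vector_derivative_two_variables:
  fixes u ux uy :: "real \<Rightarrow> real \<Rightarrow> 'a::real_normed_vector"
  assumes ux: "((\<lambda>\<xi>. u \<xi> (b t)) has_vector_derivative ux') (at (a t))"
    and uy: "\<And>\<xi> \<eta>. ((\<lambda>\<eta>. u \<xi> \<eta>) has_vector_derivative uy \<xi> \<eta>) (at \<eta>)"
    and cy: "continuous_on UNIV (\<lambda>p. uy (fst p) (snd p))"
    and a: "(a has_real_derivative a') (at t)" and b: "(b has_real_derivative b') (at t)"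
  shows "((\<lambda>t. u (a t) (b t)) has_vector_derivative (a' *\<^sub>R ux' + b' *\<^sub>R uy (a t) (b t))) (at t)"
proof -
  have "((\<lambda>(\<xi>, \<eta>). u \<xi> \<eta>) has_derivative
      (\<lambda>(tx, ty). tx *\<^sub>R ux' + blinfun_apply (blinfun_scaleR_left (uy (a t) (b t))) ty))
      (at (a t, b t) within UNIV \<times> UNIV)"
  proof (rule has_derivative_partialsI)
    show "((\<lambda>\<xi>. u \<xi> (b t)) has_derivative (\<lambda>tx. tx *\<^sub>R ux')) (at (a t) within UNIV)"
      using ux by (simp add: has_vector_derivative_def)
    show "((\<lambda>\<eta>. u \<xi> \<eta>) has_derivative blinfun_apply (blinfun_scaleR_left (uy \<xi> \<eta>))) (at \<eta> within UNIV)" for \<xi> \<eta>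
      using uy[of \<xi> \<eta>] by (simp add: has_vector_derivative_def)
    have "continuous_on UNIV (\<lambda>p. blinfun_scaleR_left (uy (fst p) (snd p)) :: real \<Rightarrow>\<^sub>L 'a)"
      by (rule bounded_linear.continuous_on[OF bounded_linear_blinfun_scaleR_left cy])
    then show "continuous (at (a t, b t) within UNIV \<times> UNIV) (\<lambda>(\<xi>, \<eta>). blinfun_scaleR_left (uy \<xi> \<eta>) :: real \<Rightarrow>\<^sub>L 'a)"
      by (simp add: continuous_on_eq_continuous_at case_prod_beta')
  qed auto
  then have D: "((\<lambda>p. u (fst p) (snd p)) has_derivative
      (\<lambda>p. fst p *\<^sub>R ux' + snd p *\<^sub>R uy (a t) (b t))) (at (a t, b t))"
    by (simp add: case_prod_beta')
  have "((\<lambda>t. (a t, b t)) has_derivative (\<lambda>s. (a' * s, b' * s))) (at t)"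
    using a b unfolding has_field_derivative_def by (rule has_derivative_Pair)
  from has_derivative_compose[OF this D]
  show ?thesis unfolding has_vector_derivative_def
    by (simp add: scaleR_add_right mult.commute)
qed

definition jointly_continuous :: "(real \<Rightarrow> real \<Rightarrow> complex) \<Rightarrow> bool" where
  "jointly_continuous u \<longleftrightarrow> continuous_on UNIV (\<lambda>p. u (fst p) (snd p))"

lemma jointly_continuousD:
  assumes "jointly_continuous u" "continuous_on S a" "continuous_on S b"
  shows "continuous_on S (\<lambda>x. u (a x) (b x))"
  using continuous_on_compose2[OF assms(1)[unfolded jointly_continuous_def] continuous_on_Pair[OF assms(2,3)]]
  by simp

text \<open>
The signed integral of \<open>u(\<xi>, t)\<close> over \<open>t\<close> from \<open>\<eta>\<close> to \<open>\<gamma>\<close>, pulled back to \<open>[0,1]\<close>. In this form it is defined and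
differentiable for \<open>\<eta>\<close> on both sides of \<open>\<gamma>\<close>.
\<close>

definition seg_int :: "real \<Rightarrow> (real \<Rightarrow> real \<Rightarrow> complex) \<Rightarrow> real \<Rightarrow> real \<Rightarrow> complex" where
  "seg_int \<gamma> u \<xi> \<eta> = of_real (\<gamma> - \<eta>) * integral {0..1} (\<lambda>s. u \<xi> (\<eta> + s * (\<gamma> - \<eta>)))"

lemma seg_int_continuous:
  assumes "jointly_continuous u" shows "jointly_continuous (seg_int \<gamma> u)"
proof -
  have "continuous_on UNIV (\<lambda>p. integral (cbox 0 1) (\<lambda>s. u (fst p) (snd p + s * (\<gamma> - snd p))))"
    by (rule integral_continuous_on_param)
       (auto intro!: continuous_intros jointly_continuousD[OF assms] simp: split_beta)
  then show ?thesis unfolding jointly_continuous_def seg_int_def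
    by (intro continuous_intros) (simp_all add: split_beta)
qed

lemma seg_int_deriv1:
  assumes "jointly_continuous u" "jointly_continuous u'"
    and "\<And>\<xi> \<eta>. ((\<lambda>\<xi>. u \<xi> \<eta>) has_vector_derivative u' \<xi> \<eta>) (at \<xi>)"
  shows "((\<lambda>\<xi>. seg_int \<gamma> u \<xi> \<eta>) has_vector_derivative seg_int \<gamma> u' \<xi> \<eta>) (at \<xi>)"
proof -
  have "((\<lambda>\<xi>. integral (cbox 0 1) (\<lambda>s. u \<xi> (\<eta> + s * (\<gamma> - \<eta>)))) has_vector_derivative
       integral (cbox 0 1) (\<lambda>s. u' \<xi> (\<eta> + s * (\<gamma> - \<eta>)))) (at \<xi> within UNIV)"
    by (rule leibniz_rule_vector_derivative)
       (auto intro!: continuous_intros integrable_continuous_real jointly_continuousD[OF assms(1)]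
         jointly_continuousD[OF assms(2)] assms(3) simp: split_beta)
  then show ?thesis unfolding seg_int_def
    by (intro has_vector_derivative_mult_right) simp
qed

lemma seg_int_deriv2:
  assumes "jointly_continuous u"
  shows "((\<lambda>\<eta>. seg_int \<gamma> u \<xi> \<eta>) has_vector_derivative - u \<xi> \<eta>) (at \<eta>)"
proof -
  have c: "continuous_on UNIV (u \<xi>)" by (intro jointly_continuousD[OF assms] continuous_intros)
  obtain W where W: "\<And>t. (W has_vector_derivative u \<xi> t) (at t)"
    using einterval_antiderivative[of "-\<infinity>" \<infinity> "u \<xi>"] c
    by (auto simp: continuous_on_eq_continuous_at)
  have "seg_int \<gamma> u \<xi> \<eta> = W \<gamma> - W \<eta>" for \<eta>
  proof -
    have "((\<lambda>s. (\<gamma> - \<eta>) *\<^sub>R u \<xi> (\<eta> + s * (\<gamma> - \<eta>))) has_integral W (\<eta> + 1 * (\<gamma> - \<eta>)) - W (\<eta> + 0 * (\<gamma> - \<eta>))) {0..1}"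
    proof (rule fundamental_theorem_of_calculus)
      fix s :: real
      have "((\<lambda>s. \<eta> + s * (\<gamma> - \<eta>)) has_vector_derivative (\<gamma> - \<eta>)) (at s within {0..1})"
        by (rule has_vector_derivative_at_within, rule has_real_derivative_iff_has_vector_derivative[THEN iffD1])
           (rule derivative_eq_intros refl | simp)+
      from vector_diff_chain_within[OF this has_vector_derivative_at_within[OF W]]
      show "((\<lambda>s. W (\<eta> + s * (\<gamma> - \<eta>))) has_vector_derivative (\<gamma> - \<eta>) *\<^sub>R u \<xi> (\<eta> + s * (\<gamma> - \<eta>))) (at s within {0..1})"
        by (simp add: o_def)
    qed simp
    then have "integral {0..1} (\<lambda>s. (\<gamma> - \<eta>) *\<^sub>R u \<xi> (\<eta> + s * (\<gamma> - \<eta>))) = W \<gamma> - W \<eta>"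
      by (simp add: integral_unique del: integral_cmul)
    then show ?thesis unfolding seg_int_def scaleR_conv_of_real[symmetric] integral_cmul .
  qed
  then have "seg_int \<gamma> u \<xi> = (\<lambda>\<eta>. W \<gamma> - W \<eta>)" by auto
  moreover have "((\<lambda>\<eta>. W \<gamma> - W \<eta>) has_vector_derivative 0 - u \<xi> \<eta>) (at \<eta>)"
    by (intro has_vector_derivative_diff has_vector_derivative_const W)
  ultimately show ?thesis by simp
qed

lemma seg_int_end [simp]: "seg_int \<gamma> u \<xi> \<gamma> = 0"
  by (simp add: seg_int_def)

lemma seg_int_bound:
  assumes "jointly_continuous u" "\<And>t. \<bar>t\<bar> \<le> 1 \<Longrightarrow> norm (u \<xi> t) \<le> b" "\<bar>\<gamma>\<bar> \<le> 1" "\<bar>\<eta>\<bar> \<le> 1"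
  shows "norm (seg_int \<gamma> u \<xi> \<eta>) \<le> 2 * b"
proof -
  have "norm (integral {0..1} (\<lambda>s. u \<xi> (\<eta> + s * (\<gamma> - \<eta>)))) \<le> b * (1 - 0)"
  proof (rule integral_bound)
    fix s :: real assume s: "s \<in> {0..1}"
    have "\<eta> + s * (\<gamma> - \<eta>) = (1 - s) * \<eta> + s * \<gamma>" by (simp add: algebra_simps)
    also have "\<bar>\<dots>\<bar> \<le> (1 - s) * 1 + s * 1"
      using s assms(3,4) by (intro order_trans[OF abs_triangle_ineq] add_mono) (auto simp: abs_mult mult_left_le)
    finally show "norm (u \<xi> (\<eta> + s * (\<gamma> - \<eta>))) \<le> b" by (intro assms(2)) simp
  qed (auto intro!: continuous_intros jointly_continuousD[OF assms(1)])
  moreover have "\<bar>\<gamma> - \<eta>\<bar> \<le> 2" using assms by linarith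
  ultimately show ?thesis unfolding seg_int_def norm_mult norm_of_real
    by (intro mult_mono) auto
qed

text \<open>
A function that is smooth in \<open>\<xi>\<close>, given by the sequence of all its \<open>\<xi>\<close>-derivatives. Only \<open>\<xi>\<close> is ever
differentiated repeatedly; in \<open>\<eta>\<close> one integrates.
\<close>

definition jet :: "(nat \<Rightarrow> real \<Rightarrow> real \<Rightarrow> complex) \<Rightarrow> bool" where
  "jet \<Phi> \<longleftrightarrow> (\<forall>j. jointly_continuous (\<Phi> j)) \<and>
     (\<forall>j \<xi> \<eta>. ((\<lambda>\<xi>. \<Phi> j \<xi> \<eta>) has_vector_derivative \<Phi> (Suc j) \<xi> \<eta>) (at \<xi>))"

lemma jetD: "jet \<Phi> \<Longrightarrow> jointly_continuous (\<Phi> j)"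
  "jet \<Phi> \<Longrightarrow> ((\<lambda>\<xi>. \<Phi> j \<xi> \<eta>) has_vector_derivative \<Phi> (Suc j) \<xi> \<eta>) (at \<xi>)"
  by (auto simp: jet_def)

lemma jet_seg_int: "jet \<Phi> \<Longrightarrow> jet (\<lambda>j. seg_int \<gamma> (\<Phi> j))"
  unfolding jet_def by (auto intro: seg_int_continuous seg_int_deriv1)

text \<open>
The jet of \<open>\<partial>\<^sub>\<xi> \<Phi> + \<beta> \<Phi>\<close>, by the Leibniz rule.
\<close>

definition jet_op :: "(nat \<Rightarrow> real \<Rightarrow> real \<Rightarrow> complex) \<Rightarrow> (nat \<Rightarrow> real \<Rightarrow> real \<Rightarrow> complex)
    \<Rightarrow> nat \<Rightarrow> real \<Rightarrow> real \<Rightarrow> complex" where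
  "jet_op \<beta> \<Phi> j \<xi> \<eta> = \<Phi> (Suc j) \<xi> \<eta> + (\<Sum>i\<le>j. of_nat (j choose i) * (\<beta> i \<xi> \<eta> * \<Phi> (j - i) \<xi> \<eta>))"

lemma leibniz_pascal:
  fixes b p :: "nat \<Rightarrow> complex"
  shows "(\<Sum>i\<le>j. of_nat (j choose i) * (b i * p (Suc (j - i)) + b (Suc i) * p (j - i)))
     = (\<Sum>i\<le>Suc j. of_nat (Suc j choose i) * (b i * p (Suc j - i)))"
proof -
  have "(\<Sum>i\<le>Suc j. of_nat (Suc j choose i) * (b i * p (Suc j - i)))
      = b 0 * p (Suc j) + (\<Sum>i\<le>j. of_nat (j choose i) * (b (Suc i) * p (j - i)))
        + (\<Sum>i\<le>j. of_nat (j choose Suc i) * (b (Suc i) * p (j - i)))"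
    by (subst sum.atMost_Suc_shift) (simp add: distrib_right sum.distrib)
  also have "\<dots> = (\<Sum>i\<le>j. of_nat (j choose i) * (b (Suc i) * p (j - i)))
      + (\<Sum>i\<le>Suc j. of_nat (j choose i) * (b i * p (Suc j - i)))"
    by (subst sum.atMost_Suc_shift) (simp add: add.commute add.left_commute)
  also have "(\<Sum>i\<le>Suc j. of_nat (j choose i) * (b i * p (Suc j - i))) = (\<Sum>i\<le>j. of_nat (j choose i) * (b i * p (Suc (j - i))))"
    by (simp add: Suc_diff_le)
  finally show ?thesis by (simp add: sum.distrib distrib_left add.commute)
qed

lemma jet_jet_op:
  assumes "jet \<beta>" "jet \<Phi>" shows "jet (jet_op \<beta> \<Phi>)"
  unfolding jet_def
proof (intro conjI allI)
  fix j
  show "jointly_continuous (jet_op \<beta> \<Phi> j)"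
    unfolding jointly_continuous_def jet_op_def
    by (intro continuous_intros jointly_continuousD[OF jetD(1)] assms)
  fix \<xi> \<eta>
  have "((\<lambda>\<xi>. jet_op \<beta> \<Phi> j \<xi> \<eta>) has_vector_derivative
     \<Phi> (Suc (Suc j)) \<xi> \<eta> + (\<Sum>i\<le>j. of_nat (j choose i) *
       (\<beta> i \<xi> \<eta> * \<Phi> (Suc (j - i)) \<xi> \<eta> + \<beta> (Suc i) \<xi> \<eta> * \<Phi> (j - i) \<xi> \<eta>))) (at \<xi>)"
    unfolding jet_op_def
    by (intro has_vector_derivative_add has_vector_derivative_sum has_vector_derivative_mult_right
        has_vector_derivative_mult jetD(2) assms)
  then show "((\<lambda>\<xi>. jet_op \<beta> \<Phi> j \<xi> \<eta>) has_vector_derivative jet_op \<beta> \<Phi> (Suc j) \<xi> \<eta>) (at \<xi>)"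
    unfolding jet_op_def leibniz_pascal[of j "\<lambda>i. \<beta> i \<xi> \<eta>" "\<lambda>i. \<Phi> i \<xi> \<eta>"] .
qed

text \<open>
Gevrey bounds of order \<open>\<sigma>\<close> on the box \<open>|\<xi>| \<le> \<epsilon>\<close>, \<open>|\<eta>| \<le> 1\<close>. The shift \<open>r\<close> counts the derivatives already
spent, so that iterated operators stay within the same family of bounds.
\<close>

definition gevrey_jet_bound :: "real \<Rightarrow> real \<Rightarrow> real \<Rightarrow> nat \<Rightarrow> real \<Rightarrow> (nat \<Rightarrow> real \<Rightarrow> real \<Rightarrow> complex) \<Rightarrow> bool" where
  "gevrey_jet_bound \<sigma> \<epsilon> K r D \<Phi> \<longleftrightarrow> (\<forall>j \<xi> \<eta>. \<bar>\<xi>\<bar> \<le> \<epsilon> \<and> \<bar>\<eta>\<bar> \<le> 1 \<longrightarrow>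
     norm (\<Phi> j \<xi> \<eta>) \<le> D * K ^ j * fact (j + r) powr \<sigma>)"

lemma fact_mult_fact_le: "fact i * fact k \<le> (fact (i + k) :: real)"
proof -
  have "fact i * fact k \<le> (fact (i + k) :: nat)"
    using dvd_imp_le[OF fact_fact_dvd_fact[of i k]] by simp
  then have "real (fact i * fact k) \<le> real (fact (i + k))" by (rule of_nat_mono)
  then show ?thesis by simp
qed

lemma choose_fact_le:
  assumes "i \<le> j" shows "real (j choose i) * (fact i * fact (j - i + r)) \<le> fact (j + r)"
proof -
  have 1: "real (j choose i) * fact i * fact (j - i) = fact j"
    using binomial_fact_lemma[OF assms] by (metis (mono_tags) mult.commute mult.left_commute of_nat_fact of_nat_mult)
  have p: "fact (n + r) = fact n * pochhammer (real n + 1) r" for n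
    by (simp add: pochhammer_fact pochhammer_product'[of 1 n r, simplified] add.commute)
  have "real (j choose i) * (fact i * fact (j - i + r)) = fact j * pochhammer (real (j - i) + 1) r"
    unfolding p 1[symmetric] by simp
  also have "\<dots> \<le> fact j * pochhammer (real j + 1) r"
    unfolding pochhammer_prod by (intro mult_left_mono prod_mono) auto
  also have "\<dots> = fact (j + r)" by (simp add: p)
  finally show ?thesis .
qed

text \<open>
One copy of \<open>i! (j - i + r)!\<close> absorbs the binomial coefficient; the remaining power \<open>\<sigma> - 1\<close> is handled by
\<open>i! k! \<le> (i + k)!\<close>. Thus the terms of the Leibniz sum are uniformly bounded, with no factor \<open>2\<^sup>j\<close>.
\<close>

lemma choose_fact_powr_le:
  assumes "i \<le> j" "\<sigma> \<ge> 1"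
  shows "real (j choose i) * ((fact i) powr \<sigma> * (fact (j - i + r)) powr \<sigma>) \<le> (fact (j + r) :: real) powr \<sigma>"
proof -
  let ?x = "fact i * fact (j - i + r) :: real"
  have x: "?x > 0" by simp
  have "(fact i) powr \<sigma> * (fact (j - i + r)) powr \<sigma> = ?x powr (1 + (\<sigma> - 1))"
    by (simp add: powr_mult)
  also have "\<dots> = ?x * ?x powr (\<sigma> - 1)" unfolding powr_add using x by simp
  finally have "real (j choose i) * ((fact i) powr \<sigma> * (fact (j - i + r)) powr \<sigma>)
     = (real (j choose i) * ?x) * ?x powr (\<sigma> - 1)" by simp
  also have "\<dots> \<le> fact (j + r) * fact (j + r) powr (\<sigma> - 1)"
  proof (intro mult_mono powr_mono2)
    show "real (j choose i) * ?x \<le> fact (j + r)" by (rule choose_fact_le[OF assms(1)])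
    show "?x \<le> fact (j + r)" using fact_mult_fact_le[of i "j - i + r"] assms(1) by simp
  qed (use assms in auto)
  also have "\<dots> = fact (j + r) powr (1 + (\<sigma> - 1))" unfolding powr_add by simp
  finally show ?thesis by simp
qed

text \<open>
The derivative shifts the index by one. The Leibniz sum has \<open>j + 1\<close> terms of the size of the original
bound, and the factor \<open>j + 1\<close> is again absorbed by raising \<open>r\<close> by one, as \<open>\<sigma> \<ge> 1\<close>.
\<close>

lemma gevrey_jet_bound_jet_op:
  assumes \<beta>: "gevrey_jet_bound \<sigma> \<epsilon> K 0 K \<beta>" and \<Phi>: "gevrey_jet_bound \<sigma> \<epsilon> K r D \<Phi>" and \<sigma>: "\<sigma> \<ge> 1" and K: "K \<ge> 0" and D: "D \<ge> 0"
  shows "gevrey_jet_bound \<sigma> \<epsilon> K (Suc r) (2 * K * D) (jet_op \<beta> \<Phi>)"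
  unfolding gevrey_jet_bound_def
proof (intro allI impI)
  fix j \<xi> \<eta> assume x: "\<bar>\<xi>\<bar> \<le> \<epsilon> \<and> \<bar>\<eta>\<bar> \<le> (1::real)"
  have 1: "norm (\<Phi> (Suc j) \<xi> \<eta>) \<le> K * D * K ^ j * fact (j + Suc r) powr \<sigma>"
    using \<Phi>[unfolded gevrey_jet_bound_def, rule_format, OF x, of "Suc j"] by (simp add: mult_ac)
  have "norm (\<Sum>i\<le>j. of_nat (j choose i) * (\<beta> i \<xi> \<eta> * \<Phi> (j - i) \<xi> \<eta>))
     \<le> (\<Sum>i\<le>j. K * D * K ^ j * fact (j + r) powr \<sigma>)"
  proof (rule sum_norm_le)
    fix i assume "i \<in> {..j}" then have i: "i \<le> j" by simp
    have "norm (of_nat (j choose i) * (\<beta> i \<xi> \<eta> * \<Phi> (j - i) \<xi> \<eta>))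
        \<le> real (j choose i) * ((K * K ^ i * fact i powr \<sigma>) * (D * K ^ (j - i) * fact (j - i + r) powr \<sigma>))"
      unfolding norm_mult norm_of_nat
      using \<beta>[unfolded gevrey_jet_bound_def, rule_format, OF x, of i] \<Phi>[unfolded gevrey_jet_bound_def, rule_format, OF x, of "j - i"] K D
      by (intro mult_left_mono mult_mono) auto
    also have "\<dots> = K * D * (K ^ i * K ^ (j - i)) * (real (j choose i) * (fact i powr \<sigma> * fact (j - i + r) powr \<sigma>))"
      by (simp add: mult_ac)
    also have "K ^ i * K ^ (j - i) = K ^ j" using i by (simp flip: power_add)
    also have "K * D * K ^ j * (real (j choose i) * (fact i powr \<sigma> * fact (j - i + r) powr \<sigma>)) \<le> K * D * K ^ j * fact (j + r) powr \<sigma>"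
      using K D by (intro mult_left_mono choose_fact_powr_le i \<sigma>) auto
    finally show "norm (of_nat (j choose i) * (\<beta> i \<xi> \<eta> * \<Phi> (j - i) \<xi> \<eta>)) \<le> K * D * K ^ j * fact (j + r) powr \<sigma>" .
  qed
  also have "\<dots> = K * D * K ^ j * (real (Suc j) * fact (j + r) powr \<sigma>)" by simp
  also have "\<dots> \<le> K * D * K ^ j * fact (j + Suc r) powr \<sigma>"
  proof (intro mult_left_mono)
    have "real (Suc j) \<le> real (j + Suc r) powr 1" by simp
    also have "\<dots> \<le> real (j + Suc r) powr \<sigma>" using \<sigma> by (intro powr_mono) auto
    finally have "real (Suc j) * fact (j + r) powr \<sigma> \<le> real (j + Suc r) powr \<sigma> * fact (j + r) powr \<sigma>"
      by (intro mult_right_mono) auto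
    also have "\<dots> = fact (j + Suc r) powr \<sigma>" by (simp add: powr_mult)
    finally show "real (Suc j) * fact (j + r) powr \<sigma> \<le> fact (j + Suc r) powr \<sigma>" .
  qed (use K D in auto)
  finally show "norm (jet_op \<beta> \<Phi> j \<xi> \<eta>) \<le> 2 * K * D * K ^ j * fact (j + Suc r) powr \<sigma>"
    unfolding jet_op_def using 1 norm_triangle_le[of "\<Phi> (Suc j) \<xi> \<eta>"] by fastforce
qed

lemma gevrey_jet_bound_seg_int:
  assumes "jet \<Phi>" "gevrey_jet_bound \<sigma> \<epsilon> K r D \<Phi>" "\<bar>\<gamma>\<bar> \<le> 1"
  shows "gevrey_jet_bound \<sigma> \<epsilon> K r (2 * D) (\<lambda>j. seg_int \<gamma> (\<Phi> j))"
  unfolding gevrey_jet_bound_def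
proof (intro allI impI)
  fix j \<xi> \<eta> assume x: "\<bar>\<xi>\<bar> \<le> \<epsilon> \<and> \<bar>\<eta>\<bar> \<le> (1::real)"
  have "norm (seg_int \<gamma> (\<Phi> j) \<xi> \<eta>) \<le> 2 * (D * K ^ j * fact (j + r) powr \<sigma>)"
    using assms x by (intro seg_int_bound jetD(1)) (auto simp: gevrey_jet_bound_def)
  then show "norm (seg_int \<gamma> (\<Phi> j) \<xi> \<eta>) \<le> 2 * D * K ^ j * fact (j + r) powr \<sigma>"
    by (simp add: mult_ac)
qed

section \<open>Transport along the pencil of lines through a point\<close>

lemma seg_int_eq_integral:
  assumes "jointly_continuous u" "c \<le> z"
  shows "seg_int c u \<xi> z = - integral {c..z} (u \<xi>)"
proof -
  have "(u \<xi> has_integral (- seg_int c u \<xi> z) - (- seg_int c u \<xi> c)) {c..z}"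
  proof (rule fundamental_theorem_of_calculus)
    fix t
    have "((\<lambda>t. - seg_int c u \<xi> t) has_vector_derivative - (- u \<xi> t)) (at t)"
      by (intro has_vector_derivative_minus seg_int_deriv2 assms)
    then show "((\<lambda>t. - seg_int c u \<xi> t) has_vector_derivative u \<xi> t) (at t within {c..z})"
      by (simp add: has_vector_derivative_at_within)
  qed (rule assms)
  then show ?thesis by (simp add: integral_unique)
qed

text \<open>
Integration of the total derivative of \<open>G\<close> over a half plane of lines. For fixed \<open>x\<close> put \<open>y = \<xi> x + \<eta>\<close> and let
\<open>Q(\<xi>)\<close> be the integral of \<open>F(y) G(\<xi>, y - \<xi> x)\<close> over \<open>y \<le> \<gamma> + \<xi> x\<close>. Its derivative consists of the boundary term
\<open>x F(\<gamma> + \<xi> x) G(\<xi>, \<gamma>)\<close> and of the integral of \<open>F DG\<close>, and \<open>Q\<close> vanishes at both ends \<open>\<xi> = \<plusminus>\<epsilon>\<close>. No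
derivative falls on \<open>F\<close>, so that it may be a merely continuous function such as a slice of \<open>f\<close>.
\<close>

lemma transport_identity:
  fixes F :: "real \<Rightarrow> complex" and G DG :: "real \<Rightarrow> real \<Rightarrow> complex"
  assumes F: "continuous_on UNIV F"
    and vanish: "\<And>\<xi> \<eta>. \<bar>\<xi>\<bar> \<le> \<epsilon> \<Longrightarrow> \<eta> < - \<gamma> \<Longrightarrow> F (\<xi> * x + \<eta>) = 0"
    and G: "jointly_continuous G" "jointly_continuous DG"
    and deriv: "\<And>\<xi> y. ((\<lambda>\<xi>. G \<xi> (y - \<xi> * x)) has_vector_derivative DG \<xi> (y - \<xi> * x)) (at \<xi>)"
    and ends: "\<And>\<eta>. G \<epsilon> \<eta> = 0" "\<And>\<eta>. G (- \<epsilon>) \<eta> = 0"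
    and \<epsilon>: "0 < \<epsilon>" and \<gamma>: "0 < \<gamma>"
  shows "integral {-\<epsilon>..\<epsilon>} (\<lambda>\<xi>. integral {-\<gamma>..\<gamma>} (\<lambda>\<eta>. F (\<xi> * x + \<eta>) * DG \<xi> \<eta>))
    = - of_real x * integral {-\<epsilon>..\<epsilon>} (\<lambda>\<xi>. F (\<xi> * x + \<gamma>) * G \<xi> \<gamma>)"
proof -
  \<comment> \<open>a base point below which \<open>F\<close> vanishes on all lines with \<open>|\<xi>| \<le> \<epsilon>\<close>\<close>
  define c where "c = - \<gamma> - \<epsilon> * \<bar>x\<bar>"
  define u where "u \<xi> y = F y * G \<xi> (y - \<xi> * x)" for \<xi> y
  define u' where "u' \<xi> y = F y * DG \<xi> (y - \<xi> * x)" for \<xi> y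
  note [continuous_intros] = continuous_on_compose2[OF F _ subset_UNIV]
    jointly_continuousD[OF G(1)] jointly_continuousD[OF G(2)]
  have u: "jointly_continuous u" "jointly_continuous u'"
    unfolding jointly_continuous_def u_def u'_def by (intro continuous_intros)+
  have du: "((\<lambda>\<xi>. u \<xi> y) has_vector_derivative u' \<xi> y) (at \<xi>)" for \<xi> y
    unfolding u_def u'_def by (intro has_vector_derivative_mult_right deriv)
  define Q where "Q \<xi> = seg_int c u \<xi> (\<gamma> + \<xi> * x)" for \<xi>
  have dQ: "(Q has_vector_derivative (1 *\<^sub>R seg_int c u' \<xi> (\<gamma> + \<xi> * x) + x *\<^sub>R - u \<xi> (\<gamma> + \<xi> * x))) (at \<xi>)" for \<xi>
    unfolding Q_def
  proof (rule vector_derivative_two_variables)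
    show "((\<lambda>\<xi>. seg_int c u \<xi> (\<gamma> + \<xi>' * x)) has_vector_derivative seg_int c u' \<xi> (\<gamma> + \<xi>' * x)) (at \<xi>)" for \<xi>'
      by (intro seg_int_deriv1 u du)
    show "((\<lambda>\<eta>. seg_int c u \<xi> \<eta>) has_vector_derivative - u \<xi> \<eta>) (at \<eta>)" for \<xi> \<eta>
      by (intro seg_int_deriv2 u)
    show "continuous_on UNIV (\<lambda>p. - u (fst p) (snd p))"
      using u(1) unfolding jointly_continuous_def by (rule continuous_on_minus)
    show "((\<lambda>\<xi>. \<xi>) has_real_derivative 1) (at \<xi>)" by simp
    show "((\<lambda>\<xi>. \<gamma> + \<xi> * x) has_real_derivative x) (at \<xi>)"
      by (auto intro!: derivative_eq_intros)
  qed
  have Q0: "Q \<epsilon> = 0" "Q (- \<epsilon>) = 0"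
    unfolding Q_def seg_int_def u_def by (simp_all add: ends)
  have shift: "seg_int c u' \<xi> (\<gamma> + \<xi> * x) = - integral {-\<gamma>..\<gamma>} (\<lambda>\<eta>. F (\<xi> * x + \<eta>) * DG \<xi> \<eta>)"
    if \<xi>: "\<xi> \<in> {-\<epsilon>..\<epsilon>}" for \<xi>
  proof -
    let ?g = "\<lambda>\<eta>. F (\<xi> * x + \<eta>) * DG \<xi> \<eta>"
    have b: "\<bar>\<xi> * x\<bar> \<le> \<epsilon> * \<bar>x\<bar>" unfolding abs_mult using \<xi> by (intro mult_right_mono) auto
    have "seg_int c u' \<xi> (\<gamma> + \<xi> * x) = - integral {c..\<gamma> + \<xi> * x} (u' \<xi>)"
      using b \<gamma> by (intro seg_int_eq_integral u) (simp add: c_def abs_le_iff)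
    also have "integral {c..\<gamma> + \<xi> * x} (u' \<xi>) = integral {(c - \<xi> * x) + \<xi> * x..\<gamma> + \<xi> * x} (u' \<xi>)" by simp
    also have "\<dots> = integral {c - \<xi> * x..\<gamma>} (u' \<xi> \<circ> (\<lambda>\<eta>. \<eta> + \<xi> * x))"
      by (rule integral_shift[symmetric]) (intro continuous_intros jointly_continuousD[OF u(2)])
    also have "u' \<xi> \<circ> (\<lambda>\<eta>. \<eta> + \<xi> * x) = ?g" by (auto simp: u'_def add.commute)
    also have "integral {c - \<xi> * x..\<gamma>} ?g = integral {-\<gamma>..\<gamma>} ?g"
    proof -
      have "integral {c - \<xi> * x..-\<gamma>} ?g + integral {-\<gamma>..\<gamma>} ?g = integral {c - \<xi> * x..\<gamma>} ?g"
        by (rule Henstock_Kurzweil_Integration.integral_combine)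
           (use b \<gamma> in \<open>auto simp: c_def abs_le_iff intro!: integrable_continuous_real continuous_intros\<close>)
      moreover have "integral {c - \<xi> * x..-\<gamma>} ?g = integral {c - \<xi> * x..-\<gamma>} (\<lambda>_. 0)"
        by (rule integral_spike[of "{-\<gamma>}"]) (use vanish[of \<xi>] \<xi> in auto)
      ultimately show ?thesis by simp
    qed
    finally show ?thesis .
  qed
  have "((\<lambda>\<xi>. 1 *\<^sub>R seg_int c u' \<xi> (\<gamma> + \<xi> * x) + x *\<^sub>R - u \<xi> (\<gamma> + \<xi> * x)) has_integral Q \<epsilon> - Q (- \<epsilon>)) {-\<epsilon>..\<epsilon>}"
    by (rule fundamental_theorem_of_calculus) (use \<epsilon> in \<open>auto intro!: has_vector_derivative_at_within[OF dQ[simplified]]\<close>)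
  then have "integral {-\<epsilon>..\<epsilon>} (\<lambda>\<xi>. seg_int c u' \<xi> (\<gamma> + \<xi> * x) - x *\<^sub>R u \<xi> (\<gamma> + \<xi> * x)) = 0"
    by (simp add: Q0 integral_unique)
  also have "integral {-\<epsilon>..\<epsilon>} (\<lambda>\<xi>. seg_int c u' \<xi> (\<gamma> + \<xi> * x) - x *\<^sub>R u \<xi> (\<gamma> + \<xi> * x))
     = integral {-\<epsilon>..\<epsilon>} (\<lambda>\<xi>. seg_int c u' \<xi> (\<gamma> + \<xi> * x)) - x *\<^sub>R integral {-\<epsilon>..\<epsilon>} (\<lambda>\<xi>. u \<xi> (\<gamma> + \<xi> * x))"
    by (subst integral_diff, intro integrable_continuous_real continuous_intros jointly_continuousD[OF seg_int_continuous] u,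
        intro integrable_continuous_real continuous_intros jointly_continuousD[OF u(1)]) simp
  also have "integral {-\<epsilon>..\<epsilon>} (\<lambda>\<xi>. seg_int c u' \<xi> (\<gamma> + \<xi> * x))
     = integral {-\<epsilon>..\<epsilon>} (\<lambda>\<xi>. - integral {-\<gamma>..\<gamma>} (\<lambda>\<eta>. F (\<xi> * x + \<eta>) * DG \<xi> \<eta>))"
    by (rule integral_cong) (rule shift)
  finally show ?thesis
    by (simp add: u_def add.commute scaleR_conv_of_real algebra_simps eq_neg_iff_add_eq_0 neg_eq_iff_add_eq_0)
qed

text \<open>
The assumption \<open>m_deriv\<close> is the differential equation for the weight, read along the pencil of lines through
the point \<open>(x, y)\<close>. By the inequalities \<open>\<epsilon>\<gamma>\<close>, lines with \<open>|\<xi>| \<le> \<epsilon>\<close> and \<open>\<eta> \<le> \<gamma>\<close> meet the region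
above the parabola only if \<open>\<eta> \<ge> -\<gamma>\<close>, and then only at abscissas in \<open>[-1,1]\<close>.
\<close>

locale transported_weight =
  fixes m :: "real \<times> real \<times> real \<Rightarrow> real" and a b :: "nat \<Rightarrow> real \<Rightarrow> real \<Rightarrow> complex"
    and f :: "real \<times> real \<Rightarrow> complex" and \<epsilon> \<gamma> :: real
  assumes m_cont: "continuous_on UNIV m"
    and m_deriv: "\<And>x \<xi> y. ((\<lambda>\<xi>. complex_of_real (m (x, \<xi>, y - \<xi> * x))) has_vector_derivative
      (of_real x * a 0 \<xi> (y - \<xi> * x) + b 0 \<xi> (y - \<xi> * x)) * of_real (m (x, \<xi>, y - \<xi> * x))) (at \<xi>)"
    and a: "jet a" and b: "jet b"
    and f_cont: "continuous_on UNIV f"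
    and f_supp: "\<And>x y. y < x\<^sup>2 \<Longrightarrow> f (x, y) = 0"
    and \<epsilon>: "0 < \<epsilon>" and \<gamma>: "0 < \<gamma>" and \<epsilon>\<gamma>: "\<epsilon>\<^sup>2 / 4 \<le> \<gamma>" "\<epsilon> + \<gamma> \<le> 1"
begin

text \<open>
The integrating factor: its logarithm has \<open>\<eta>\<close>-derivative \<open>a\<close> and vanishes at \<open>\<eta> = \<gamma>\<close>.
\<close>

definition gauge :: "real \<Rightarrow> real \<Rightarrow> complex" where
  "gauge \<xi> \<eta> = exp (- seg_int \<gamma> (a 0) \<xi> \<eta>)"

text \<open>
The jet of \<open>b + \<partial>\<^sub>\<xi> ln gauge\<close>, which takes the place of \<open>b\<close> once \<open>a\<close> has been removed.
\<close>

definition drift :: "nat \<Rightarrow> real \<Rightarrow> real \<Rightarrow> complex" where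
  "drift j \<xi> \<eta> = b j \<xi> \<eta> - seg_int \<gamma> (a (Suc j)) \<xi> \<eta>"

text \<open>
The contribution of the abscissa \<open>x\<close> to the pairing of a test function with the gauged Radon transform on
the half plane \<open>\<eta> \<le> \<gamma>\<close>.
\<close>

definition pairing :: "real \<Rightarrow> (real \<Rightarrow> real \<Rightarrow> complex) \<Rightarrow> complex" where
  "pairing x \<Theta> = integral {-\<epsilon>..\<epsilon>} (\<lambda>\<xi>. integral {-\<gamma>..\<gamma>} (\<lambda>\<eta>.
     f (x, \<xi> * x + \<eta>) * (of_real (m (x, \<xi>, \<eta>)) * gauge \<xi> \<eta> * \<Theta> \<xi> \<eta>)))"

text \<open>
The contribution of the abscissa \<open>x\<close> to the boundary \<open>\<eta> = \<gamma>\<close>. For \<open>\<Psi>\<close> the rescaled bump this is the mean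
of \<open>f m\<close> over the lines of slope \<open>\<xi>\<close> through \<open>(0, \<gamma>)\<close>, evaluated at \<open>x\<close>.
\<close>

definition line_mean :: "real \<Rightarrow> (real \<Rightarrow> real \<Rightarrow> complex) \<Rightarrow> complex" where
  "line_mean x \<Psi> = integral {-\<epsilon>..\<epsilon>} (\<lambda>\<xi>. f (x, \<xi> * x + \<gamma>) * (of_real (m (x, \<xi>, \<gamma>)) * \<Psi> \<xi> \<gamma>))"

lemma jet_drift: "jet drift"
proof -
  have "jet (\<lambda>j. seg_int \<gamma> (a (Suc j)))"
    by (rule jet_seg_int) (use a in \<open>auto simp: jet_def\<close>)
  with b show ?thesis unfolding jet_def drift_def jointly_continuous_def
    by (auto intro!: continuous_on_diff has_vector_derivative_diff)
qed

lemma gauge_continuous: "jointly_continuous gauge"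
  using seg_int_continuous[OF jetD(1)[OF a], of \<gamma> 0]
  unfolding jointly_continuous_def gauge_def by (intro continuous_intros)

lemma gauge_end: "gauge \<xi> \<gamma> = 1"
  by (simp add: gauge_def)

lemma vanish:
  assumes "\<bar>\<xi>\<bar> \<le> \<epsilon>" "\<eta> < - \<gamma>" shows "f (x, \<xi> * x + \<eta>) = 0"
proof (rule f_supp)
  have "\<xi>\<^sup>2 \<le> \<epsilon>\<^sup>2" using assms(1) \<epsilon> by (metis abs_le_square_iff abs_of_pos)
  moreover have "0 \<le> (x - \<xi> / 2)\<^sup>2" by simp
  then have "\<xi> * x \<le> x\<^sup>2 + \<xi>\<^sup>2 / 4" by (simp add: power2_eq_square algebra_simps)
  ultimately show "\<xi> * x + \<eta> < x\<^sup>2" using assms(2) \<epsilon>\<gamma>(1) by linarith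
qed

lemma vanish_far:
  assumes "\<bar>\<xi>\<bar> \<le> \<epsilon>" "\<eta> \<le> \<gamma>" "\<bar>x\<bar> > 1" shows "f (x, \<xi> * x + \<eta>) = 0"
proof (rule f_supp)
  have "\<xi> * x \<le> \<bar>\<xi>\<bar> * \<bar>x\<bar>" by (metis abs_ge_self abs_mult)
  also have "\<dots> \<le> \<epsilon> * \<bar>x\<bar>" using assms by (intro mult_right_mono) auto
  finally have "\<xi> * x + \<eta> \<le> \<epsilon> * \<bar>x\<bar> + \<gamma> * 1" using assms by simp
  also have "\<dots> \<le> \<epsilon> * \<bar>x\<bar> + \<gamma> * \<bar>x\<bar>" using assms \<gamma> by (intro add_left_mono mult_left_mono) auto
  also have "\<dots> = (\<epsilon> + \<gamma>) * \<bar>x\<bar>" by (simp add: distrib_right)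
  also have "\<dots> \<le> 1 * \<bar>x\<bar>" using \<epsilon>\<gamma>(2) by (intro mult_right_mono) auto
  also have "\<dots> < \<bar>x\<bar> * \<bar>x\<bar>" using assms by (intro mult_strict_right_mono) auto
  finally show "\<xi> * x + \<eta> < x\<^sup>2" by (simp add: power2_eq_square)
qed

lemma fm_continuous:
  assumes "continuous_on S g1" "continuous_on S g2" "continuous_on S g3"
  shows "continuous_on S (\<lambda>p. f (g1 p, g2 p * g1 p + g3 p))"
    "continuous_on S (\<lambda>p. m (g1 p, g2 p, g3 p))"
  by (rule continuous_on_compose2[OF f_cont _ subset_UNIV] continuous_on_compose2[OF m_cont _ subset_UNIV];
      intro continuous_intros assms)+

text \<open>
The transport identity for \<open>G = m \<cdot> gauge \<cdot> \<Psi>\<close>. In the total derivative \<open>\<partial>\<^sub>\<xi> - x \<partial>\<^sub>\<eta>\<close> of this product the two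
occurrences of \<open>x a\<close>, from \<open>m\<close> and from the gauge, cancel.
\<close>

lemma pairing_identity:
  assumes \<Psi>: "jet \<Psi>" and ends: "\<And>\<eta>. \<Psi> 0 \<epsilon> \<eta> = 0" "\<And>\<eta>. \<Psi> 0 (- \<epsilon>) \<eta> = 0"
    and d2: "jointly_continuous \<Psi>'" "\<And>\<xi> \<eta>. ((\<lambda>\<eta>. \<Psi> 0 \<xi> \<eta>) has_vector_derivative \<Psi>' \<xi> \<eta>) (at \<eta>)"
  shows "pairing x (\<lambda>\<xi> \<eta>. jet_op drift \<Psi> 0 \<xi> \<eta> - of_real x * \<Psi>' \<xi> \<eta>) = - of_real x * line_mean x (\<Psi> 0)"
proof -
  define E where "E \<xi> \<eta> = of_real (m (x, \<xi>, \<eta>)) * gauge \<xi> \<eta>" for \<xi> \<eta>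
  define G where "G \<xi> \<eta> = E \<xi> \<eta> * \<Psi> 0 \<xi> \<eta>" for \<xi> \<eta>
  define DG where "DG \<xi> \<eta> = E \<xi> \<eta> * (jet_op drift \<Psi> 0 \<xi> \<eta> - of_real x * \<Psi>' \<xi> \<eta>)" for \<xi> \<eta>
  note ci = continuous_intros fm_continuous
     jointly_continuousD[OF gauge_continuous] jointly_continuousD[OF d2(1)]
     jointly_continuousD[OF jetD(1)[OF \<Psi>]] jointly_continuousD[OF jetD(1)[OF jet_jet_op[OF jet_drift \<Psi>]]]
  have G: "jointly_continuous G" and DG: "jointly_continuous DG"
    unfolding jointly_continuous_def G_def DG_def E_def by (intro ci)+
  have deriv: "((\<lambda>\<xi>. G \<xi> (y - \<xi> * x)) has_vector_derivative DG \<xi> (y - \<xi> * x)) (at \<xi>)" for \<xi> y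
  proof -
    let ?\<eta> = "y - \<xi> * x"
    have along: "((\<lambda>\<xi>. y - \<xi> * x) has_real_derivative - x) (at \<xi>)"
      by (auto intro!: derivative_eq_intros)
    have A: "((\<lambda>\<xi>. seg_int \<gamma> (a 0) \<xi> (y - \<xi> * x)) has_vector_derivative
        (1 *\<^sub>R seg_int \<gamma> (a (Suc 0)) \<xi> ?\<eta> + (-x) *\<^sub>R - a 0 \<xi> ?\<eta>)) (at \<xi>)"
    proof (rule vector_derivative_two_variables)
      show "((\<lambda>\<xi>. seg_int \<gamma> (a 0) \<xi> ?\<eta>) has_vector_derivative seg_int \<gamma> (a (Suc 0)) \<xi> ?\<eta>) (at \<xi>)"
        by (intro seg_int_deriv1 jetD a)
      show "((\<lambda>\<eta>. seg_int \<gamma> (a 0) \<xi> \<eta>) has_vector_derivative - a 0 \<xi> \<eta>) (at \<eta>)" for \<xi> \<eta>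
        by (intro seg_int_deriv2 jetD a)
      show "continuous_on UNIV (\<lambda>p. - a 0 (fst p) (snd p))"
        using jetD(1)[OF a] unfolding jointly_continuous_def by (intro continuous_on_minus)
    qed (use along in auto)
    have P: "((\<lambda>\<xi>. \<Psi> 0 \<xi> (y - \<xi> * x)) has_vector_derivative
        (1 *\<^sub>R \<Psi> (Suc 0) \<xi> ?\<eta> + (-x) *\<^sub>R \<Psi>' \<xi> ?\<eta>)) (at \<xi>)"
      by (rule vector_derivative_two_variables)
         (use along jetD(2)[OF \<Psi>] d2 in \<open>auto simp: jointly_continuous_def\<close>)
    have g: "((\<lambda>\<xi>. gauge \<xi> (y - \<xi> * x)) has_vector_derivative
        - (1 *\<^sub>R seg_int \<gamma> (a (Suc 0)) \<xi> ?\<eta> + (-x) *\<^sub>R - a 0 \<xi> ?\<eta>) * gauge \<xi> ?\<eta>) (at \<xi>)"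
      unfolding gauge_def
      using field_vector_diff_chain_at[OF has_vector_derivative_minus[OF A] DERIV_exp]
      by (simp add: o_def)
    from has_vector_derivative_mult[OF has_vector_derivative_mult[OF m_deriv[of x y \<xi>] g] P]
    have "((\<lambda>\<xi>. G \<xi> (y - \<xi> * x)) has_vector_derivative
       E \<xi> ?\<eta> * (1 *\<^sub>R \<Psi> (Suc 0) \<xi> ?\<eta> + (-x) *\<^sub>R \<Psi>' \<xi> ?\<eta>) +
       (of_real (m (x, \<xi>, ?\<eta>)) * (- (1 *\<^sub>R seg_int \<gamma> (a (Suc 0)) \<xi> ?\<eta> + (-x) *\<^sub>R - a 0 \<xi> ?\<eta>) * gauge \<xi> ?\<eta>)
        + (of_real x * a 0 \<xi> ?\<eta> + b 0 \<xi> ?\<eta>) * of_real (m (x, \<xi>, ?\<eta>)) * gauge \<xi> ?\<eta>) * \<Psi> 0 \<xi> ?\<eta>) (at \<xi>)"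
      unfolding G_def E_def .
    also have "E \<xi> ?\<eta> * (1 *\<^sub>R \<Psi> (Suc 0) \<xi> ?\<eta> + (-x) *\<^sub>R \<Psi>' \<xi> ?\<eta>) +
       (of_real (m (x, \<xi>, ?\<eta>)) * (- (1 *\<^sub>R seg_int \<gamma> (a (Suc 0)) \<xi> ?\<eta> + (-x) *\<^sub>R - a 0 \<xi> ?\<eta>) * gauge \<xi> ?\<eta>)
        + (of_real x * a 0 \<xi> ?\<eta> + b 0 \<xi> ?\<eta>) * of_real (m (x, \<xi>, ?\<eta>)) * gauge \<xi> ?\<eta>) * \<Psi> 0 \<xi> ?\<eta>
      = DG \<xi> ?\<eta>"
      unfolding DG_def E_def jet_op_def drift_def scaleR_conv_of_real by (simp add: algebra_simps)
    finally show ?thesis .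
  qed
  have "integral {-\<epsilon>..\<epsilon>} (\<lambda>\<xi>. integral {-\<gamma>..\<gamma>} (\<lambda>\<eta>. f (x, \<xi> * x + \<eta>) * DG \<xi> \<eta>))
    = - of_real x * integral {-\<epsilon>..\<epsilon>} (\<lambda>\<xi>. f (x, \<xi> * x + \<gamma>) * G \<xi> \<gamma>)"
  proof (rule transport_identity[where F = "\<lambda>y. f (x, y)"])
    show "continuous_on UNIV (\<lambda>y. f (x, y))"
      by (rule continuous_on_compose2[OF f_cont _ subset_UNIV]) (intro continuous_intros)
    show "G \<epsilon> \<eta> = 0" "G (- \<epsilon>) \<eta> = 0" for \<eta> by (simp_all add: G_def ends)
  qed (use vanish G DG deriv \<epsilon> \<gamma> in auto)
  then show ?thesis unfolding pairing_def line_mean_def DG_def G_def E_def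
    by (simp add: gauge_end mult.assoc)
qed

text \<open>
One round consists of integrating in \<open>\<eta>\<close>, which solves \<open>\<partial>\<^sub>\<eta> \<Psi> = -\<Phi>\<close> with \<open>\<Psi> = 0\<close> at \<open>\<eta> = \<gamma>\<close>, and applying \<open>\<partial>\<^sub>\<xi> + drift\<close>.
\<close>

primrec test_jet :: "(nat \<Rightarrow> real \<Rightarrow> real \<Rightarrow> complex) \<Rightarrow> nat \<Rightarrow> nat \<Rightarrow> real \<Rightarrow> real \<Rightarrow> complex" where
  "test_jet \<psi> 0 = jet_op drift \<psi>"
| "test_jet \<psi> (Suc k) = jet_op drift (\<lambda>j. seg_int \<gamma> (test_jet \<psi> k j))"

lemma test_jet_jet: "jet \<psi> \<Longrightarrow> jet (test_jet \<psi> k)"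
  by (induction k) (auto intro: jet_jet_op jet_drift jet_seg_int)

lemma test_jet_ends:
  assumes "\<And>j \<eta>. \<psi> j \<xi> \<eta> = 0" shows "test_jet \<psi> k j \<xi> \<eta> = 0"
proof (induction k arbitrary: j \<eta>)
  case 0 show ?case using assms by (simp add: jet_op_def)
next
  case (Suc k) then show ?case by (simp add: jet_op_def seg_int_def)
qed

text \<open>
A test function that does not depend on \<open>\<eta>\<close> yields the boundary term and one factor \<open>-x\<close>. For a later round
the boundary term vanishes and \<open>\<partial>\<^sub>\<eta> \<Psi>\<close> reproduces the previous test function with another factor \<open>-x\<close>.
\<close>

lemma pairing_test_jet:
  assumes \<psi>: "jet \<psi>" and ends: "\<And>j \<eta>. \<psi> j \<epsilon> \<eta> = 0" "\<And>j \<eta>. \<psi> j (- \<epsilon>) \<eta> = 0"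
    and const: "\<And>\<xi> \<eta> \<eta>'. \<psi> 0 \<xi> \<eta> = \<psi> 0 \<xi> \<eta>'"
  shows "pairing x (test_jet \<psi> k 0) = (- of_real x) ^ Suc k * line_mean x (\<psi> 0)"
proof (induction k)
  case 0
  have "((\<lambda>\<eta>. \<psi> 0 \<xi> \<eta>) has_vector_derivative 0) (at \<eta>)" for \<xi> \<eta>
  proof -
    have "(\<lambda>\<eta>'. \<psi> 0 \<xi> \<eta>') = (\<lambda>\<eta>'. \<psi> 0 \<xi> \<eta>)" using const by blast
    then show ?thesis by (metis has_vector_derivative_const)
  qed
  then have "pairing x (\<lambda>\<xi> \<eta>. jet_op drift \<psi> 0 \<xi> \<eta> - of_real x * (\<lambda>_ _. 0) \<xi> \<eta>) = - of_real x * line_mean x (\<psi> 0)"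
    by (intro pairing_identity \<psi> ends) (auto simp: jointly_continuous_def)
  then show ?case by simp
next
  case (Suc k)
  let ?T = "test_jet \<psi> k" and ?I = "\<lambda>j. seg_int \<gamma> (test_jet \<psi> k j)"
  note T = test_jet_jet[OF \<psi>, of k]
  have "pairing x (\<lambda>\<xi> \<eta>. jet_op drift ?I 0 \<xi> \<eta> - of_real x * (\<lambda>\<xi> \<eta>. - ?T 0 \<xi> \<eta>) \<xi> \<eta>) = - of_real x * line_mean x (?I 0)"
  proof (rule pairing_identity)
    show "jet ?I" by (rule jet_seg_int[OF T])
    show "?I 0 \<epsilon> \<eta> = 0" "?I 0 (- \<epsilon>) \<eta> = 0" for \<eta>
      using test_jet_ends[of \<psi> \<epsilon>, OF ends(1)] test_jet_ends[of \<psi> "- \<epsilon>", OF ends(2)] by (simp_all add: seg_int_def)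
    show "jointly_continuous (\<lambda>\<xi> \<eta>. - ?T 0 \<xi> \<eta>)"
      using jetD(1)[OF T] unfolding jointly_continuous_def by (intro continuous_on_minus)
    show "((\<lambda>\<eta>. ?I 0 \<xi> \<eta>) has_vector_derivative - ?T 0 \<xi> \<eta>) (at \<eta>)" for \<xi> \<eta>
      by (rule seg_int_deriv2[OF jetD(1)[OF T]])
  qed
  also have "line_mean x (?I 0) = 0" by (simp add: line_mean_def)
  finally have 0: "pairing x (\<lambda>\<xi> \<eta>. test_jet \<psi> (Suc k) 0 \<xi> \<eta> + of_real x * ?T 0 \<xi> \<eta>) = 0" by simp
  let ?w = "\<lambda>\<Theta> \<xi> \<eta>. f (x, \<xi> * x + \<eta>) * (of_real (m (x, \<xi>, \<eta>)) * gauge \<xi> \<eta> * \<Theta> \<xi> \<eta>)"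
  have in1: "(\<lambda>\<eta>. ?w (test_jet \<psi> i 0) \<xi> \<eta>) integrable_on {-\<gamma>..\<gamma>}" for \<xi> i
    by (rule integrable_continuous_real)
       (intro continuous_intros fm_continuous jointly_continuousD[OF gauge_continuous]
         jointly_continuousD[OF jetD(1)[OF test_jet_jet[OF \<psi>]]])
  have in2: "(\<lambda>\<xi>. integral {-\<gamma>..\<gamma>} (\<lambda>\<eta>. ?w (test_jet \<psi> i 0) \<xi> \<eta>)) integrable_on {-\<epsilon>..\<epsilon>}" for i
  proof (rule integrable_continuous_real)
    have "continuous_on {-\<epsilon>..\<epsilon>} (\<lambda>\<xi>. integral (cbox (-\<gamma>) \<gamma>) (\<lambda>\<eta>. ?w (test_jet \<psi> i 0) \<xi> \<eta>))"
      by (rule integral_continuous_on_param, unfold split_beta)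
         (intro continuous_intros fm_continuous jointly_continuousD[OF gauge_continuous]
         jointly_continuousD[OF jetD(1)[OF test_jet_jet[OF \<psi>]]])
    then show "continuous_on {-\<epsilon>..\<epsilon>} (\<lambda>\<xi>. integral {-\<gamma>..\<gamma>} (\<lambda>\<eta>. ?w (test_jet \<psi> i 0) \<xi> \<eta>))" by simp
  qed
  have "pairing x (\<lambda>\<xi> \<eta>. test_jet \<psi> (Suc k) 0 \<xi> \<eta> + of_real x * ?T 0 \<xi> \<eta>)
     = pairing x (test_jet \<psi> (Suc k) 0) + of_real x * pairing x (?T 0)"
  proof -
    have "pairing x (\<lambda>\<xi> \<eta>. test_jet \<psi> (Suc k) 0 \<xi> \<eta> + of_real x * ?T 0 \<xi> \<eta>)
      = integral {-\<epsilon>..\<epsilon>} (\<lambda>\<xi>. integral {-\<gamma>..\<gamma>} (\<lambda>\<eta>. ?w (test_jet \<psi> (Suc k) 0) \<xi> \<eta> + of_real x * ?w (?T 0) \<xi> \<eta>))"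
      unfolding pairing_def by (simp add: distrib_left mult_ac del: test_jet.simps)
    also have "\<dots> = integral {-\<epsilon>..\<epsilon>} (\<lambda>\<xi>. integral {-\<gamma>..\<gamma>} (\<lambda>\<eta>. ?w (test_jet \<psi> (Suc k) 0) \<xi> \<eta>)
         + of_real x * integral {-\<gamma>..\<gamma>} (\<lambda>\<eta>. ?w (?T 0) \<xi> \<eta>))"
      by (subst integral_add[OF in1 integrable_on_mult_right[OF in1]]) (simp del: test_jet.simps)
    also have "\<dots> = pairing x (test_jet \<psi> (Suc k) 0) + of_real x * pairing x (?T 0)"
      unfolding pairing_def
      by (subst integral_add[OF in2 integrable_on_mult_right[OF in2]]) (simp del: test_jet.simps)
    finally show ?thesis .
  qed
  with 0 have "pairing x (test_jet \<psi> (Suc k) 0) = - (of_real x * pairing x (?T 0))"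
    by (simp add: eq_neg_iff_add_eq_0 del: test_jet.simps)
  then show ?case unfolding Suc.IH by simp
qed

end

section \<open>Moments are controlled by the Radon data\<close>

lemma lborel_integral_eq_integral:
  fixes g :: "real \<Rightarrow> 'b::euclidean_space"
  assumes g: "continuous_on UNIV g" and 0: "\<And>x. \<bar>x\<bar> > A \<Longrightarrow> g x = 0"
  shows "(LINT x|lborel. g x) = integral {-A..A} g"
proof -
  have "(LINT x|lborel. g x) = (LINT x:{-A..A}|lborel. g x)"
    unfolding set_lebesgue_integral_def
    by (intro Bochner_Integration.integral_cong refl) (use 0 in \<open>force simp: indicator_def\<close>)
  also have "\<dots> = integral {-A..A} g"
    by (intro set_borel_integral_eq_integral(2) borel_integrable_compact[of "{-A..A}" g, folded set_integrable_def])
       (auto intro: continuous_on_subset[OF g])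
  finally show ?thesis .
qed

lemma set_nn_integral_eq_integral:
  fixes g :: "real \<Rightarrow> real"
  assumes "continuous_on {a..b} g" "\<And>x. g x \<ge> 0"
  shows "(\<integral>\<^sup>+x\<in>{a..b}. ennreal (g x) \<partial>lborel) = ennreal (integral {a..b} g)"
proof -
  have i: "set_integrable lborel {a..b} g"
    unfolding set_integrable_def by (rule borel_integrable_compact) (use assms in auto)
  have "(\<integral>\<^sup>+x\<in>{a..b}. ennreal (g x) \<partial>lborel) = (\<integral>\<^sup>+x. ennreal (indicator {a..b} x *\<^sub>R g x) \<partial>lborel)"
    by (intro nn_integral_cong) (auto simp: indicator_def)
  also have "\<dots> = ennreal (LINT x|lborel. indicator {a..b} x *\<^sub>R g x)"
    using i unfolding set_integrable_def
    by (intro nn_integral_eq_integral) (auto simp: assms(2))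
  also have "\<dots> = ennreal (integral {a..b} g)"
    using set_borel_integral_eq_integral(2)[OF i] unfolding set_lebesgue_integral_def by simp
  finally show ?thesis .
qed

lemma weighted_radon_measurable:
  assumes f: "continuous_on UNIV f" and m: "continuous_on UNIV m"
  shows "weighted_radon m f \<in> borel_measurable borel"
proof -
  have "(\<lambda>p. f (snd p, fst (fst p) * snd p + snd (fst p)) * complex_of_real (m (snd p, fst (fst p), snd (fst p))))
      \<in> borel_measurable borel"
    by (intro borel_measurable_continuous_onI continuous_intros
       continuous_on_compose2[OF f _ subset_UNIV] continuous_on_compose2[OF m _ subset_UNIV])
  then have mm: "(\<lambda>p. f (snd p, fst (fst p) * snd p + snd (fst p)) * complex_of_real (m (snd p, fst (fst p), snd (fst p))))
      \<in> borel_measurable (borel \<Otimes>\<^sub>M lborel)"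
    by (subst measurable_cong_sets[of _ "borel \<Otimes>\<^sub>M borel" borel borel])
       (auto intro!: sets_pair_measure_cong simp del: fst_conv snd_conv, simp add: borel_prod)
  have "(\<lambda>p. LINT x|lborel. f (x, fst p * x + snd p) * complex_of_real (m (x, fst p, snd p))) \<in> borel_measurable borel"
    by (rule lborel.borel_measurable_lebesgue_integral) (use mm in \<open>simp add: split_beta'\<close>)
  then show ?thesis unfolding weighted_radon_def split_beta' .
qed

context transported_weight
begin

definition radon :: "real \<Rightarrow> real \<Rightarrow> complex" where
  "radon \<xi> \<eta> = integral {-1..1} (\<lambda>x. f (x, \<xi> * x + \<eta>) * of_real (m (x, \<xi>, \<eta>)))"

lemma radon_continuous: "jointly_continuous radon"
proof -
  have "continuous_on UNIV (\<lambda>p. integral (cbox (-1) 1) (\<lambda>x. f (x, fst p * x + snd p) * of_real (m (x, fst p, snd p))))"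
    by (rule integral_continuous_on_param, unfold split_beta) (intro continuous_intros fm_continuous)
  then show ?thesis by (simp add: jointly_continuous_def radon_def)
qed

lemma weighted_radon_eq:
  assumes "\<bar>\<xi>\<bar> \<le> \<epsilon>" "\<eta> \<le> \<gamma>" shows "weighted_radon m f (\<xi>, \<eta>) = radon \<xi> \<eta>"
  unfolding weighted_radon_def radon_def prod.case
  by (rule lborel_integral_eq_integral)
     (auto intro!: continuous_intros fm_continuous simp: vanish_far[OF assms])

lemma integral_swap_triple:
  fixes H :: "real \<Rightarrow> real \<Rightarrow> real \<Rightarrow> complex"
  assumes H: "continuous_on UNIV (\<lambda>p. H (fst p) (fst (snd p)) (snd (snd p)))"
  shows "integral {-1..1} (\<lambda>x. integral {-\<epsilon>..\<epsilon>} (\<lambda>\<xi>. integral {-\<gamma>..\<gamma>} (H x \<xi>)))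
    = integral {-\<epsilon>..\<epsilon>} (\<lambda>\<xi>. integral {-\<gamma>..\<gamma>} (\<lambda>\<eta>. integral {-1..1} (\<lambda>x. H x \<xi> \<eta>)))"
proof -
  have H': "continuous_on S (\<lambda>p. H (g1 p) (g2 p) (g3 p))"
    if "continuous_on S g1" "continuous_on S g2" "continuous_on S g3" for S and g1 g2 g3 :: "real \<times> real \<Rightarrow> real"
    using continuous_on_compose2[OF H, of S "\<lambda>p. (g1 p, g2 p, g3 p)"] that by (simp add: continuous_on_Pair)
  have H'': "continuous_on S (\<lambda>p. H (fst (fst p)) (snd (fst p)) (snd p))" for S
    using continuous_on_compose2[OF H, of S "\<lambda>p. (fst (fst p), snd (fst p), snd p)"]
    by (simp add: continuous_on_Pair continuous_on_fst continuous_on_snd continuous_on_id)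
  have c: "continuous_on (cbox (-1, -\<epsilon>) (1, \<epsilon>)) (\<lambda>(x, \<xi>). integral (cbox (-\<gamma>) \<gamma>) (H x \<xi>))"
  proof -
    have "continuous_on (cbox (-1, -\<epsilon>) (1, \<epsilon>)) (\<lambda>p. integral (cbox (-\<gamma>) \<gamma>) (H (fst p) (snd p)))"
      by (rule integral_continuous_on_param) (simp add: split_beta' H'')
    then show ?thesis by (simp add: split_beta')
  qed
  have "integral (cbox (-1) 1) (\<lambda>x. integral (cbox (-\<epsilon>) \<epsilon>) (\<lambda>\<xi>. integral (cbox (-\<gamma>) \<gamma>) (H x \<xi>)))
    = integral (cbox (-\<epsilon>) \<epsilon>) (\<lambda>\<xi>. integral (cbox (-1) 1) (\<lambda>x. integral (cbox (-\<gamma>) \<gamma>) (H x \<xi>)))"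
    by (rule integral_swap_continuous[OF c])
  also have "\<dots> = integral (cbox (-\<epsilon>) \<epsilon>) (\<lambda>\<xi>. integral (cbox (-\<gamma>) \<gamma>) (\<lambda>\<eta>. integral (cbox (-1) 1) (\<lambda>x. H x \<xi> \<eta>)))"
    by (intro integral_cong integral_swap_continuous) (unfold split_beta', intro H' continuous_intros)
  finally show ?thesis by simp
qed

lemma pairing_fubini:
  assumes \<Theta>: "jointly_continuous \<Theta>"
  shows "integral {-1..1} (\<lambda>x. pairing x \<Theta>)
    = integral {-\<epsilon>..\<epsilon>} (\<lambda>\<xi>. integral {-\<gamma>..\<gamma>} (\<lambda>\<eta>. gauge \<xi> \<eta> * \<Theta> \<xi> \<eta> * radon \<xi> \<eta>))"
proof -
  have "integral {-1..1} (\<lambda>x. pairing x \<Theta>)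
    = integral {-\<epsilon>..\<epsilon>} (\<lambda>\<xi>. integral {-\<gamma>..\<gamma>} (\<lambda>\<eta>. integral {-1..1}
        (\<lambda>x. f (x, \<xi> * x + \<eta>) * (of_real (m (x, \<xi>, \<eta>)) * gauge \<xi> \<eta> * \<Theta> \<xi> \<eta>))))"
    unfolding pairing_def
    by (rule integral_swap_triple) (intro continuous_intros fm_continuous jointly_continuousD[OF gauge_continuous] jointly_continuousD[OF \<Theta>])
  also have "(\<lambda>\<xi> \<eta>. integral {-1..1} (\<lambda>x. f (x, \<xi> * x + \<eta>) * (of_real (m (x, \<xi>, \<eta>)) * gauge \<xi> \<eta> * \<Theta> \<xi> \<eta>)))
     = (\<lambda>\<xi> \<eta>. gauge \<xi> \<eta> * \<Theta> \<xi> \<eta> * radon \<xi> \<eta>)"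
    unfolding radon_def by (simp add: mult_ac flip: integral_mult_right)
  finally show ?thesis .
qed

definition data_mass :: real where
  "data_mass = integral {-\<epsilon>..\<epsilon>} (\<lambda>\<xi>. integral {-\<gamma>..\<gamma>} (\<lambda>\<eta>. norm (radon \<xi> \<eta>)))"

definition slice_mass :: real where
  "slice_mass = integral {-\<epsilon>..\<epsilon>} (\<lambda>\<xi>. norm (radon \<xi> \<gamma>))"

lemma continuous_on_inner_integral:
  fixes u :: "real \<Rightarrow> real \<Rightarrow> 'b::banach"
  assumes "continuous_on UNIV (\<lambda>p. u (fst p) (snd p))"
  shows "continuous_on S (\<lambda>\<xi>. integral {c..d} (u \<xi>))"
proof -
  have "continuous_on S (\<lambda>\<xi>. integral (cbox c d) (u \<xi>))"
    by (rule integral_continuous_on_param) (auto intro: continuous_on_subset[OF assms] simp: split_beta')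
  then show ?thesis by simp
qed

lemma pairing_integral_bound:
  assumes \<Theta>: "jointly_continuous \<Theta>"
    and b: "\<And>\<xi> \<eta>. \<bar>\<xi>\<bar> \<le> \<epsilon> \<Longrightarrow> \<bar>\<eta>\<bar> \<le> \<gamma> \<Longrightarrow> norm (gauge \<xi> \<eta> * \<Theta> \<xi> \<eta>) \<le> B"
  shows "norm (integral {-1..1} (\<lambda>x. pairing x \<Theta>)) \<le> B * data_mass"
proof -
  note ci = continuous_intros jointly_continuousD[OF gauge_continuous] jointly_continuousD[OF \<Theta>]
    jointly_continuousD[OF radon_continuous]
  have c: "continuous_on UNIV (\<lambda>p. norm (radon (fst p) (snd p)))" by (intro ci)
  have "norm (integral {-1..1} (\<lambda>x. pairing x \<Theta>)) \<le> integral {-\<epsilon>..\<epsilon>} (\<lambda>\<xi>. B * integral {-\<gamma>..\<gamma>} (\<lambda>\<eta>. norm (radon \<xi> \<eta>)))"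
    unfolding pairing_fubini[OF \<Theta>]
  proof (rule integral_norm_bound_integral)
    show "(\<lambda>\<xi>. integral {-\<gamma>..\<gamma>} (\<lambda>\<eta>. gauge \<xi> \<eta> * \<Theta> \<xi> \<eta> * radon \<xi> \<eta>)) integrable_on {-\<epsilon>..\<epsilon>}"
      by (intro integrable_continuous_real continuous_on_inner_integral) (intro ci)
    show "(\<lambda>\<xi>. B * integral {-\<gamma>..\<gamma>} (\<lambda>\<eta>. norm (radon \<xi> \<eta>))) integrable_on {-\<epsilon>..\<epsilon>}"
      by (intro integrable_continuous_real continuous_on_mult continuous_on_const continuous_on_inner_integral c)
    fix \<xi> assume \<xi>: "\<xi> \<in> {-\<epsilon>..\<epsilon>}"
    have "norm (integral {-\<gamma>..\<gamma>} (\<lambda>\<eta>. gauge \<xi> \<eta> * \<Theta> \<xi> \<eta> * radon \<xi> \<eta>))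
        \<le> integral {-\<gamma>..\<gamma>} (\<lambda>\<eta>. B * norm (radon \<xi> \<eta>))"
    proof (rule integral_norm_bound_integral)
      fix \<eta> assume "\<eta> \<in> {-\<gamma>..\<gamma>}"
      then show "norm (gauge \<xi> \<eta> * \<Theta> \<xi> \<eta> * radon \<xi> \<eta>) \<le> B * norm (radon \<xi> \<eta>)"
        using b[of \<xi> \<eta>] \<xi> by (subst norm_mult) (intro mult_right_mono, auto)
    qed (intro integrable_continuous_real ci)+
    then show "norm (integral {-\<gamma>..\<gamma>} (\<lambda>\<eta>. gauge \<xi> \<eta> * \<Theta> \<xi> \<eta> * radon \<xi> \<eta>)) \<le> B * integral {-\<gamma>..\<gamma>} (\<lambda>\<eta>. norm (radon \<xi> \<eta>))"
      by simp
  qed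
  then show ?thesis by (simp add: data_mass_def)
qed

text \<open>
Moments are integrals of pairings, and Fubini's theorem converts those into integrals against \<open>R[f]\<close>.
\<close>

lemma moment_Suc_bound:
  assumes \<psi>: "jet \<psi>" and ends: "\<And>j \<eta>. \<psi> j \<epsilon> \<eta> = 0" "\<And>j \<eta>. \<psi> j (- \<epsilon>) \<eta> = 0"
    and const: "\<And>\<xi> \<eta> \<eta>'. \<psi> 0 \<xi> \<eta> = \<psi> 0 \<xi> \<eta>'"
    and b: "\<And>\<xi> \<eta>. \<bar>\<xi>\<bar> \<le> \<epsilon> \<Longrightarrow> \<bar>\<eta>\<bar> \<le> \<gamma> \<Longrightarrow> norm (gauge \<xi> \<eta> * test_jet \<psi> k 0 \<xi> \<eta>) \<le> B"
  shows "norm (moment (\<lambda>x. line_mean x (\<psi> 0)) (Suc k)) \<le> B * data_mass"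
proof -
  have e: "of_real (x ^ Suc k) * line_mean x (\<psi> 0) = (-1) ^ Suc k * pairing x (test_jet \<psi> k 0)" for x
    unfolding pairing_test_jet[OF assms(1-4)] power_minus[of "of_real x"]
    by (simp add: mult.assoc[symmetric] power_mult_distrib[symmetric])
  have "moment (\<lambda>x. line_mean x (\<psi> 0)) (Suc k) = (-1) ^ Suc k * integral {-1..1} (\<lambda>x. pairing x (test_jet \<psi> k 0))"
    unfolding moment_def e by simp
  then have "norm (moment (\<lambda>x. line_mean x (\<psi> 0)) (Suc k)) = norm (integral {-1..1} (\<lambda>x. pairing x (test_jet \<psi> k 0)))"
    by (simp add: norm_mult norm_power)
  also have "\<dots> \<le> B * data_mass"
    by (rule pairing_integral_bound[OF jetD(1)[OF test_jet_jet[OF \<psi>]] b])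
  finally show ?thesis .
qed

lemma moment_0_bound:
  assumes \<Psi>: "jointly_continuous \<Psi>" and b: "\<And>\<xi>. \<bar>\<xi>\<bar> \<le> \<epsilon> \<Longrightarrow> norm (\<Psi> \<xi> \<gamma>) \<le> B"
  shows "norm (moment (\<lambda>x. line_mean x \<Psi>) 0) \<le> B * slice_mass"
proof -
  let ?g = "\<lambda>x \<xi>. f (x, \<xi> * x + \<gamma>) * (of_real (m (x, \<xi>, \<gamma>)) * \<Psi> \<xi> \<gamma>)"
  note ci = continuous_intros fm_continuous jointly_continuousD[OF \<Psi>] jointly_continuousD[OF radon_continuous]
  have "moment (\<lambda>x. line_mean x \<Psi>) 0 = integral (cbox (-1) 1) (\<lambda>x. integral (cbox (-\<epsilon>) \<epsilon>) (?g x))"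
    by (simp add: moment_def line_mean_def)
  also have "\<dots> = integral (cbox (-\<epsilon>) \<epsilon>) (\<lambda>\<xi>. integral (cbox (-1) 1) (\<lambda>x. ?g x \<xi>))"
    by (rule integral_swap_continuous) (unfold split_beta', intro ci)
  also have "(\<lambda>\<xi>. integral (cbox (-1) 1) (\<lambda>x. ?g x \<xi>)) = (\<lambda>\<xi>. \<Psi> \<xi> \<gamma> * radon \<xi> \<gamma>)"
    unfolding radon_def by (simp add: mult_ac flip: integral_mult_right)
  also have "norm (integral (cbox (-\<epsilon>) \<epsilon>) (\<lambda>\<xi>. \<Psi> \<xi> \<gamma> * radon \<xi> \<gamma>)) \<le> integral {-\<epsilon>..\<epsilon>} (\<lambda>\<xi>. B * norm (radon \<xi> \<gamma>))"
    unfolding cbox_interval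
  proof (rule integral_norm_bound_integral)
    fix \<xi> assume "\<xi> \<in> {-\<epsilon>..\<epsilon>}"
    then show "norm (\<Psi> \<xi> \<gamma> * radon \<xi> \<gamma>) \<le> B * norm (radon \<xi> \<gamma>)"
      using b[of \<xi>] by (subst norm_mult) (intro mult_right_mono, auto)
  qed (intro integrable_continuous_real ci)+
  finally show ?thesis by (simp add: slice_mass_def)
qed

lemma slice_mass_eq: "L1_norm_on {-\<epsilon>..\<epsilon>} (\<lambda>\<xi>. weighted_radon m f (\<xi>, \<gamma>)) = ennreal slice_mass"
proof -
  have "L1_norm_on {-\<epsilon>..\<epsilon>} (\<lambda>\<xi>. weighted_radon m f (\<xi>, \<gamma>)) = (\<integral>\<^sup>+\<xi>\<in>{-\<epsilon>..\<epsilon>}. ennreal (norm (radon \<xi> \<gamma>)) \<partial>lborel)"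
    unfolding L1_norm_on_def by (intro nn_integral_cong) (auto simp: indicator_def weighted_radon_eq)
  also have "\<dots> = ennreal slice_mass"
    unfolding slice_mass_def
    by (rule set_nn_integral_eq_integral) (intro continuous_intros jointly_continuousD[OF radon_continuous], simp)
  finally show ?thesis .
qed

text \<open>
The open strip \<open>|\<eta>| < \<gamma>\<close> and its closure differ by two values of \<open>\<eta>\<close>, a null set.
\<close>

lemma data_mass_eq: "L1_norm_on (data_region \<epsilon> \<gamma>) (weighted_radon m f) = ennreal data_mass"
proof -
  let ?R = "weighted_radon m f"
  have [measurable]: "?R \<in> borel_measurable (borel \<Otimes>\<^sub>M borel)"
    using weighted_radon_measurable[OF f_cont m_cont] by (simp add: borel_prod)
  have "L1_norm_on (data_region \<epsilon> \<gamma>) ?R = (\<integral>\<^sup>+p. (case p of (\<xi>, \<eta>) \<Rightarrow>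
            ennreal (norm (?R (\<xi>, \<eta>))) * indicator {-\<epsilon>..\<epsilon>} \<xi> * indicator {-\<gamma><..<\<gamma>} \<eta>)
            \<partial>(lborel \<Otimes>\<^sub>M lborel))"
    unfolding L1_norm_on_def lborel_prod data_region_def
    by (intro nn_integral_cong) (auto simp: indicator_def)
  also have "\<dots> = (\<integral>\<^sup>+\<xi>. (\<integral>\<^sup>+\<eta>. ennreal (norm (?R (\<xi>, \<eta>))) * indicator {-\<epsilon>..\<epsilon>} \<xi>
            * indicator {-\<gamma><..<\<gamma>} \<eta> \<partial>lborel) \<partial>lborel)"
    by (subst lborel.nn_integral_fst [symmetric]) auto
  also have "\<dots> = (\<integral>\<^sup>+\<xi>\<in>{-\<epsilon>..\<epsilon>}. ennreal (integral {-\<gamma>..\<gamma>} (\<lambda>\<eta>. norm (radon \<xi> \<eta>))) \<partial>lborel)"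
  proof (intro nn_integral_cong)
    fix \<xi>
    show "(\<integral>\<^sup>+\<eta>. ennreal (norm (?R (\<xi>, \<eta>))) * indicator {-\<epsilon>..\<epsilon>} \<xi> * indicator {-\<gamma><..<\<gamma>} \<eta> \<partial>lborel)
       = ennreal (integral {-\<gamma>..\<gamma>} (\<lambda>\<eta>. norm (radon \<xi> \<eta>))) * indicator {-\<epsilon>..\<epsilon>} \<xi>"
    proof (cases "\<xi> \<in> {-\<epsilon>..\<epsilon>}")
      case True
      have "(\<integral>\<^sup>+\<eta>. ennreal (norm (?R (\<xi>, \<eta>))) * indicator {-\<epsilon>..\<epsilon>} \<xi> * indicator {-\<gamma><..<\<gamma>} \<eta> \<partial>lborel)
         = (\<integral>\<^sup>+\<eta>\<in>{-\<gamma>..\<gamma>}. ennreal (norm (radon \<xi> \<eta>)) \<partial>lborel)"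
      proof (rule nn_integral_cong_AE)
        show "AE \<eta> in lborel. ennreal (norm (?R (\<xi>, \<eta>))) * indicator {-\<epsilon>..\<epsilon>} \<xi> * indicator {-\<gamma><..<\<gamma>} \<eta>
          = ennreal (norm (radon \<xi> \<eta>)) * indicator {-\<gamma>..\<gamma>} \<eta>"
          using AE_lborel_singleton[of \<gamma>] AE_lborel_singleton[of "-\<gamma>"]
        proof eventually_elim
          case (elim \<eta>)
          then show ?case using True weighted_radon_eq[of \<xi> \<eta>] by (auto simp: indicator_def)
        qed
      qed
      also have "\<dots> = ennreal (integral {-\<gamma>..\<gamma>} (\<lambda>\<eta>. norm (radon \<xi> \<eta>)))"
        by (rule set_nn_integral_eq_integral) (intro continuous_intros jointly_continuousD[OF radon_continuous], simp)
      finally show ?thesis using True by simp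
    qed simp
  qed
  also have "\<dots> = ennreal data_mass"
    unfolding data_mass_def
  proof (rule set_nn_integral_eq_integral)
    show "continuous_on {-\<epsilon>..\<epsilon>} (\<lambda>\<xi>. integral {-\<gamma>..\<gamma>} (\<lambda>\<eta>. norm (radon \<xi> \<eta>)))"
      by (rule continuous_on_inner_integral) (intro continuous_intros jointly_continuousD[OF radon_continuous])
    show "integral {-\<gamma>..\<gamma>} (\<lambda>\<eta>. norm (radon \<xi> \<eta>)) \<ge> 0" for \<xi>
      by (rule integral_nonneg) (intro integrable_continuous_real continuous_intros jointly_continuousD[OF radon_continuous], simp)
  qed
  finally show ?thesis .
qed

end

section \<open>The mean as a compactly supported Hoelder function\<close>

text \<open>
The polynomial \<open>x\<^sup>2 - \<epsilon> x - \<gamma>\<close> has a single positive root, so the root is at most 1 iff the value \<open>1 - \<epsilon> - \<gamma>\<close>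
at 1 is nonnegative.
\<close>

lemma x_pos_le_one:
  assumes \<epsilon>: "0 < \<epsilon>" and \<gamma>: "0 < \<gamma>" and le: "x_pos \<epsilon> \<gamma> \<le> 1"
  shows "\<epsilon> + \<gamma> \<le> 1"
proof -
  define r where "r = (\<epsilon> + sqrt (\<epsilon>\<^sup>2 + 4 * \<gamma>)) / 2"
  have sq: "(sqrt (\<epsilon>\<^sup>2 + 4 * \<gamma>))\<^sup>2 = \<epsilon>\<^sup>2 + 4 * \<gamma>" using \<gamma> by simp
  have r: "r > 0" unfolding r_def using \<epsilon> \<gamma> by (simp add: add_pos_nonneg)
  have root: "r\<^sup>2 = \<epsilon> * r + \<gamma>"
    unfolding r_def using sq by (simp add: power2_eq_square field_simps)
  have uniq: "x = r" if "x > 0 \<and> x\<^sup>2 = \<epsilon> * x + \<gamma>" for x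
  proof -
    have "(x - r) * (x + r - \<epsilon>) = (x\<^sup>2 - \<epsilon> * x) - (r\<^sup>2 - \<epsilon> * r)"
      by (simp add: power2_eq_square algebra_simps)
    then have "(x - r) * (x + r - \<epsilon>) = 0" using that root by linarith
    moreover have "x * (x + r - \<epsilon>) > 0"
    proof -
      have "x * (x + r - \<epsilon>) = (x\<^sup>2 - \<epsilon> * x) + x * r" by (simp add: power2_eq_square algebra_simps)
      then have "x * (x + r - \<epsilon>) = \<gamma> + x * r" using that by linarith
      then show ?thesis using that r \<gamma> by (simp add: add_pos_pos)
    qed
    ultimately show ?thesis by auto
  qed
  have "x_pos \<epsilon> \<gamma> = r" unfolding x_pos_def
    by (rule the_equality, rule conjI[OF r root], rule uniq)
  with le have r1: "r \<le> 1" by simp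
  show ?thesis
  proof (rule ccontr)
    assume "\<not> \<epsilon> + \<gamma> \<le> 1"
    then have "(\<epsilon> + \<gamma>) * r > 1 * r" using r by (intro mult_strict_right_mono) auto
    then have "\<epsilon> * r + \<gamma> * r > r" by (simp add: distrib_right)
    moreover have "\<gamma> * r \<le> \<gamma>" using r1 \<gamma> by (simp add: mult_left_le)
    moreover have "r\<^sup>2 \<le> r" using r r1 by (simp add: power2_eq_square mult_left_le)
    ultimately show False using root by linarith
  qed
qed

lemma holder_seminorm_le:
  fixes f :: "'a::metric_space \<Rightarrow> 'b::real_normed_vector"
  assumes "holder_seminorm \<alpha> f \<le> ennreal C" "C \<ge> 0"
  shows "norm (f p - f q) \<le> C * dist p q powr \<alpha>"
proof (cases "p = q")
  case False
  have "ennreal (norm (f p - f q) / dist p q powr \<alpha>) \<le> holder_seminorm \<alpha> f"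
    unfolding holder_seminorm_def using False by (intro SUP_upper2[of "(p, q)"]) auto
  also have "\<dots> \<le> ennreal C" by (rule assms)
  finally have "norm (f p - f q) / dist p q powr \<alpha> \<le> C"
    using assms(2) by (simp add: ennreal_le_iff)
  then show ?thesis using False by (simp add: pos_divide_le_eq)
qed simp

context transported_weight
begin

text \<open>
Moving \<open>x\<close> to \<open>x'\<close> along a fixed line moves the point of the plane by at most \<open>2 |x - x'|\<close>, since \<open>|\<xi>| \<le> 1\<close>. The
size of \<open>f\<close> is controlled by comparison with a point below the parabola at distance at most 3.
\<close>

lemma line_mean_holder:
  fixes w :: "real \<Rightarrow> real"
  assumes w: "continuous_on UNIV w" "\<And>\<xi>. w \<xi> \<ge> 0" "integral {-\<epsilon>..\<epsilon>} w = 1"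
    and f_hol: "\<And>p q. norm (f p - f q) \<le> C * dist p q powr \<alpha>" and C: "C \<ge> 0" and \<alpha>: "0 < \<alpha>" "\<alpha> \<le> 1"
    and m_bound: "\<And>x \<xi>. \<bar>x\<bar> \<le> 1 \<Longrightarrow> \<bar>\<xi>\<bar> \<le> 1 \<Longrightarrow> \<bar>m (x, \<xi>, \<gamma>)\<bar> \<le> m1"
    and m_lip: "\<And>x x' \<xi>. \<bar>x\<bar> \<le> 1 \<Longrightarrow> \<bar>x'\<bar> \<le> 1 \<Longrightarrow> \<bar>\<xi>\<bar> \<le> 1 \<Longrightarrow> \<bar>m (x, \<xi>, \<gamma>) - m (x', \<xi>, \<gamma>)\<bar> \<le> L * \<bar>x - x'\<bar>"
    and x: "\<bar>x\<bar> \<le> 1" and x': "\<bar>x'\<bar> \<le> 1"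
  shows "norm (line_mean x (\<lambda>\<xi> \<eta>. of_real (w \<xi>)) - line_mean x' (\<lambda>\<xi> \<eta>. of_real (w \<xi>)))
     \<le> C * (2 * m1 + 6 * L) * \<bar>x - x'\<bar> powr \<alpha>"
proof -
  note [continuous_intros] = continuous_on_compose2[OF w(1) _ subset_UNIV] fm_continuous
  define g where "g x \<xi> = f (x, \<xi> * x + \<gamma>) * (of_real (m (x, \<xi>, \<gamma>)) * of_real (w \<xi>))" for x \<xi>
  let ?K = "C * (2 * m1 + 6 * L) * \<bar>x - x'\<bar> powr \<alpha>"
  have L: "L \<ge> 0" using m_lip[of 0 1 0] by simp
  have m1: "m1 \<ge> 0" using m_bound[of 0 0] by simp
  have small: "\<bar>x - x'\<bar> \<le> 2 * \<bar>x - x'\<bar> powr \<alpha>"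
  proof (cases "x = x'")
    case False
    have "\<bar>x - x'\<bar> = \<bar>x - x'\<bar> powr (1 - \<alpha>) * \<bar>x - x'\<bar> powr \<alpha>"
      using False by (simp flip: powr_add)
    also have "\<dots> \<le> 2 * \<bar>x - x'\<bar> powr \<alpha>"
    proof (intro mult_right_mono)
      have "\<bar>x - x'\<bar> powr (1 - \<alpha>) \<le> 2 powr (1 - \<alpha>)"
        using x x' \<alpha> by (intro powr_mono2) auto
      also have "\<dots> \<le> 2 powr 1" using \<alpha> by (intro powr_mono) auto
      finally show "\<bar>x - x'\<bar> powr (1 - \<alpha>) \<le> 2" by simp
    qed auto
    finally show ?thesis .
  qed simp
  have gb: "norm (g x \<xi> - g x' \<xi>) \<le> ?K * w \<xi>" if \<xi>: "\<xi> \<in> {-\<epsilon>..\<epsilon>}" for \<xi>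
  proof -
    have \<xi>1: "\<bar>\<xi>\<bar> \<le> 1" using \<xi> \<epsilon>\<gamma>(2) \<gamma> by auto
    define y where "y = \<xi> * x + \<gamma>"
    define y' where "y' = \<xi> * x' + \<gamma>"
    have "dist (x, y) (x', y') \<le> dist x x' + dist y y'"
      unfolding dist_prod_def using sqrt_sum_squares_le_sum[of "dist x x'" "dist y y'"] by simp
    also have "dist y y' = \<bar>\<xi>\<bar> * \<bar>x - x'\<bar>"
      by (simp add: y_def y'_def dist_real_def flip: abs_mult right_diff_distrib)
    also have "\<dots> \<le> 1 * \<bar>x - x'\<bar>" using \<xi>1 by (intro mult_right_mono) auto
    finally have d: "dist (x, y) (x', y') \<le> 2 * \<bar>x - x'\<bar>" by (simp add: dist_real_def)
    have "norm (f (x, y) - f (x', y')) \<le> C * dist (x, y) (x', y') powr \<alpha>" by (rule f_hol)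
    also have "\<dots> \<le> C * (2 * \<bar>x - x'\<bar>) powr \<alpha>"
      using d \<alpha> C by (intro mult_left_mono powr_mono2) auto
    also have "\<dots> = C * (2 powr \<alpha> * \<bar>x - x'\<bar> powr \<alpha>)" by (simp add: powr_mult)
    also have "\<dots> \<le> C * (2 * \<bar>x - x'\<bar> powr \<alpha>)"
    proof (intro mult_left_mono mult_right_mono C)
      have "2 powr \<alpha> \<le> (2::real) powr 1" using \<alpha> by (intro powr_mono) auto
      then show "2 powr \<alpha> \<le> (2::real)" by simp
    qed auto
    finally have f1: "norm (f (x, y) - f (x', y')) \<le> C * (2 * \<bar>x - x'\<bar> powr \<alpha>)" .
    have "f (x', -1) = 0" by (rule f_supp) (smt (verit) zero_le_power2)
    then have "norm (f (x', y')) \<le> C * dist (x', y') (x', -1) powr \<alpha>"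
      using f_hol[of "(x', y')" "(x', -1)"] by simp
    also have "\<dots> \<le> C * 3 powr \<alpha>"
    proof (intro mult_left_mono powr_mono2 C)
      have "\<bar>\<xi> * x'\<bar> \<le> 1 * 1" unfolding abs_mult using \<xi>1 x' by (intro mult_mono) auto
      then show "dist (x', y') (x', -1) \<le> 3"
        using \<epsilon>\<gamma>(2) \<gamma> \<epsilon> by (simp add: dist_Pair_Pair dist_real_def y'_def)
    qed (use \<alpha> in auto)
    also have "\<dots> \<le> C * 3 powr 1" using \<alpha> C by (intro mult_left_mono powr_mono) auto
    finally have f2: "norm (f (x', y')) \<le> 3 * C" by simp
    have "norm (g x \<xi> - g x' \<xi>) = norm ((f (x, y) - f (x', y')) * of_real (m (x, \<xi>, \<gamma>))
        + f (x', y') * of_real (m (x, \<xi>, \<gamma>) - m (x', \<xi>, \<gamma>))) * w \<xi>"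
    proof -
      have "g x \<xi> - g x' \<xi> = ((f (x, y) - f (x', y')) * of_real (m (x, \<xi>, \<gamma>))
        + f (x', y') * of_real (m (x, \<xi>, \<gamma>) - m (x', \<xi>, \<gamma>))) * of_real (w \<xi>)"
        unfolding g_def y_def y'_def by (simp add: algebra_simps)
      then show ?thesis using w(2)[of \<xi>] by (simp add: norm_mult)
    qed
    also have "\<dots> \<le> ?K * w \<xi>"
    proof (intro mult_right_mono w(2))
      have "norm ((f (x, y) - f (x', y')) * of_real (m (x, \<xi>, \<gamma>))) \<le> (C * (2 * \<bar>x - x'\<bar> powr \<alpha>)) * m1"
        unfolding norm_mult norm_of_real using f1 m_bound[OF x \<xi>1] C by (intro mult_mono) auto
      moreover have "norm (f (x', y') * of_real (m (x, \<xi>, \<gamma>) - m (x', \<xi>, \<gamma>))) \<le> (3 * C) * (L * (2 * \<bar>x - x'\<bar> powr \<alpha>))"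
        unfolding norm_mult norm_of_real
        using f2 order_trans[OF m_lip[OF x x' \<xi>1] mult_left_mono[OF small L]] C by (intro mult_mono) auto
      ultimately show "norm ((f (x, y) - f (x', y')) * of_real (m (x, \<xi>, \<gamma>))
        + f (x', y') * of_real (m (x, \<xi>, \<gamma>) - m (x', \<xi>, \<gamma>))) \<le> ?K"
        by (intro norm_triangle_le) (simp add: algebra_simps)
    qed
    finally show ?thesis .
  qed
  have "line_mean x (\<lambda>\<xi> \<eta>. of_real (w \<xi>)) - line_mean x' (\<lambda>\<xi> \<eta>. of_real (w \<xi>)) = integral {-\<epsilon>..\<epsilon>} (\<lambda>\<xi>. g x \<xi> - g x' \<xi>)"
    unfolding line_mean_def g_def
    by (subst integral_diff) (intro integrable_continuous_real continuous_intros, intro integrable_continuous_real continuous_intros, rule refl)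
  also have "norm \<dots> \<le> integral {-\<epsilon>..\<epsilon>} (\<lambda>\<xi>. ?K * w \<xi>)"
    by (rule integral_norm_bound_integral)
       (unfold g_def, (intro integrable_continuous_real continuous_intros)+, use gb g_def in simp)
  also have "\<dots> = ?K" using w(3) by simp
  finally show ?thesis .
qed

text \<open>
At \<open>|x| = 1\<close> the line can reach the parabola only if \<open>|\<xi>| = \<epsilon>\<close>, where the test function vanishes.
\<close>

lemma line_mean_outside:
  assumes "\<Psi> \<epsilon> \<gamma> = 0" "\<Psi> (- \<epsilon>) \<gamma> = 0" "\<bar>x\<bar> \<ge> 1"
  shows "line_mean x \<Psi> = 0"
proof -
  have "f (x, \<xi> * x + \<gamma>) * (of_real (m (x, \<xi>, \<gamma>)) * \<Psi> \<xi> \<gamma>) = 0" if \<xi>: "\<xi> \<in> {-\<epsilon>..\<epsilon>}" for \<xi>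
  proof (cases "\<bar>x\<bar> > 1 \<or> \<bar>\<xi>\<bar> = \<epsilon>")
    case True
    then show ?thesis using vanish_far[of \<xi> \<gamma> x] \<xi> assms(1,2) by (auto simp: abs_if split: if_splits)
  next
    case False
    then have x: "\<bar>x\<bar> = 1" and \<xi>': "\<bar>\<xi>\<bar> < \<epsilon>" using assms(3) \<xi> by auto
    have "\<xi> * x \<le> \<bar>\<xi>\<bar> * \<bar>x\<bar>" by (metis abs_ge_self abs_mult)
    then have "\<xi> * x + \<gamma> < 1" using x \<xi>' \<epsilon>\<gamma>(2) by simp
    moreover have "x\<^sup>2 = 1" using x by (metis power2_abs one_power2)
    ultimately show ?thesis by (simp add: f_supp)
  qed
  then have "line_mean x \<Psi> = integral {-\<epsilon>..\<epsilon>} (\<lambda>\<xi>. 0)"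
    unfolding line_mean_def by (rule integral_cong)
  then show ?thesis by simp
qed

lemma line_mean_holder_global:
  assumes "\<And>x x'. \<bar>x\<bar> \<le> 1 \<Longrightarrow> \<bar>x'\<bar> \<le> 1 \<Longrightarrow> norm (line_mean x \<Psi> - line_mean x' \<Psi>) \<le> M * \<bar>x - x'\<bar> powr \<alpha>"
    and "\<Psi> \<epsilon> \<gamma> = 0" "\<Psi> (- \<epsilon>) \<gamma> = 0" and "M \<ge> 0" "\<alpha> \<ge> 0"
  shows "norm (line_mean x \<Psi> - line_mean x' \<Psi>) \<le> M * \<bar>x - x'\<bar> powr \<alpha>"
proof -
  define cl :: "real \<Rightarrow> real" where "cl x = max (-1) (min 1 x)" for x
  have cl: "line_mean x \<Psi> = line_mean (cl x) \<Psi>" for x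
  proof (cases "\<bar>x\<bar> \<le> 1")
    case True then have "cl x = x" by (auto simp: cl_def)
    then show ?thesis by simp
  next
    case False then have "\<bar>cl x\<bar> \<ge> 1" "\<bar>x\<bar> \<ge> 1" by (auto simp: cl_def)
    then show ?thesis using line_mean_outside[of \<Psi>] assms(2,3) by metis
  qed
  have "norm (line_mean x \<Psi> - line_mean x' \<Psi>) \<le> M * \<bar>cl x - cl x'\<bar> powr \<alpha>"
    unfolding cl[of x] cl[of x'] by (rule assms(1)) (auto simp: cl_def)
  also have "\<dots> \<le> M * \<bar>x - x'\<bar> powr \<alpha>"
    using assms(4,5) by (intro mult_left_mono powr_mono2) (auto simp: cl_def)
  finally show ?thesis .
qed

text \<open>
The substitution \<open>y = \<gamma> + x \<xi>\<close>; it turns the argument of \<open>\<phi>\<close> into \<open>-\<xi>/\<epsilon>\<close> for positive \<open>x\<close>, where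
the symmetry of \<open>\<phi>\<close> enters, and into \<open>\<xi>/\<epsilon>\<close> for negative \<open>x\<close>.
\<close>

lemma mean_eq_line_mean:
  assumes \<phi>: "continuous_on UNIV \<phi>" "\<And>t. \<phi> (- t) = \<phi> t" "\<And>t. \<bar>t\<bar> > 1 \<Longrightarrow> \<phi> t = 0" and x: "x \<noteq> 0"
  shows "mean \<phi> m \<epsilon> \<gamma> f x = line_mean x (\<lambda>\<xi> \<eta>. of_real (\<phi> (\<xi> / \<epsilon>) / \<epsilon>))"
proof -
  note [continuous_intros] = continuous_on_compose2[OF \<phi>(1) _ subset_UNIV] fm_continuous
  let ?g = "\<lambda>y. f (x, y) * of_real (modified_weight m \<gamma> (x, y)) * of_real (rescaled \<phi> (\<epsilon> * \<bar>x\<bar>) (\<gamma> - y))"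
  let ?h = "\<lambda>\<xi>. f (x, \<xi> * x + \<gamma>) * (of_real (m (x, \<xi>, \<gamma>)) * of_real (\<phi> (\<xi> / \<epsilon>) / \<epsilon>))"
  have sub: "\<bar>x\<bar> *\<^sub>R ?g (\<gamma> + x * \<xi>) = ?h \<xi>" for \<xi>
  proof -
    have "\<phi> (- (x * \<xi> / (\<epsilon> * \<bar>x\<bar>))) = \<phi> (\<xi> / \<epsilon>)"
      using x \<phi>(2)[of "\<xi> / \<epsilon>"] by (cases "x > 0") (auto simp: abs_if \<phi>(2))
    then show ?thesis
      using x \<epsilon> by (simp add: modified_weight_def rescaled_def scaleR_conv_of_real field_simps)
  qed
  have "mean \<phi> m \<epsilon> \<gamma> f x = (LINT y|lborel. ?g y)" using x by (simp add: mean_def)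
  also have "\<dots> = \<bar>x\<bar> *\<^sub>R (LINT \<xi>|lborel. ?g (\<gamma> + x * \<xi>))" by (rule lborel_integral_real_affine[OF x])
  also have "\<dots> = (LINT \<xi>|lborel. ?h \<xi>)" unfolding sub[symmetric] by simp
  also have "\<dots> = integral {-\<epsilon>..\<epsilon>} ?h"
  proof (rule lborel_integral_eq_integral)
    show "continuous_on UNIV ?h" using \<epsilon> by (intro continuous_intros) auto
    show "\<bar>\<xi>\<bar> > \<epsilon> \<Longrightarrow> ?h \<xi> = 0" for \<xi> using \<phi>(3)[of "\<xi> / \<epsilon>"] \<epsilon> by (simp add: abs_divide)
  qed
  finally show ?thesis unfolding line_mean_def .
qed

end

lemma integral_rescaled:
  assumes \<phi>: "continuous_on UNIV \<phi>" "\<And>t. \<bar>t\<bar> > 1 \<Longrightarrow> \<phi> t = (0::real)" and \<epsilon>: "\<epsilon> > 0"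
  shows "integral {-\<epsilon>..\<epsilon>} (\<lambda>\<xi>. \<phi> (\<xi> / \<epsilon>) / \<epsilon>) = (LINT t|lborel. \<phi> t)"
proof -
  have "(LINT t|lborel. \<phi> t) = \<bar>1 / \<epsilon>\<bar> *\<^sub>R (LINT \<xi>|lborel. \<phi> (0 + 1 / \<epsilon> * \<xi>))"
    by (rule lborel_integral_real_affine) (use \<epsilon> in simp)
  also have "\<dots> = (LINT \<xi>|lborel. \<phi> (\<xi> / \<epsilon>) / \<epsilon>)" using \<epsilon> by simp
  also have "\<dots> = integral {-\<epsilon>..\<epsilon>} (\<lambda>\<xi>. \<phi> (\<xi> / \<epsilon>) / \<epsilon>)"
  proof (rule lborel_integral_eq_integral)
    show "continuous_on UNIV (\<lambda>\<xi>. \<phi> (\<xi> / \<epsilon>) / \<epsilon>)"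
      using \<epsilon> by (intro continuous_intros continuous_on_compose2[OF \<phi>(1)]) auto
  qed (use \<phi>(2) \<epsilon> in \<open>simp add: abs_divide\<close>)
  finally show ?thesis by simp
qed

section \<open>Gevrey bounds for the test functions\<close>

lemma has_derivative_along:
  assumes "(g has_derivative D) (at p)"
  shows "((\<lambda>t::real. g (p + t *\<^sub>R v)) has_vector_derivative D v) (at 0)"
proof -
  interpret D: bounded_linear D using assms by (rule has_derivative_bounded_linear)
  have "((\<lambda>t::real. p + t *\<^sub>R v) has_derivative (\<lambda>t. t *\<^sub>R v)) (at 0)"
    by (auto intro!: derivative_eq_intros)
  from has_derivative_compose[OF this, of g D] assms
  show ?thesis by (simp add: has_vector_derivative_def D.scaleR)
qed

lemma partial_deriv_eq:
  assumes "(g has_derivative D) (at p)"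
  shows "partial_deriv i g p = D i"
  unfolding partial_deriv_def by (rule vector_derivative_at[OF has_derivative_along[OF assms]])

lemma smooth_on_iter_derivative:
  assumes "smooth_on UNIV g" "set ds \<subseteq> Basis"
  obtains D where "(iter_partial ds g has_derivative D) (at p)"
  using assms unfolding smooth_on_def differentiable_on_def differentiable_def by (metis UNIV_I in_lists_conv_set subsetD)

lemma smooth_on_iter_continuous:
  assumes "smooth_on UNIV g" "set ds \<subseteq> Basis"
  shows "continuous_on UNIV (iter_partial ds g)"
  using assms unfolding smooth_on_def
  by (intro differentiable_imp_continuous_on) (auto simp: in_lists_conv_set)

lemma iter_partial_line:
  assumes g: "smooth_on UNIV g" and "set ds \<subseteq> Basis"
  shows "((\<lambda>t. iter_partial ds g (p + t *\<^sub>R i)) has_vector_derivative iter_partial (i # ds) g (p + s *\<^sub>R i)) (at s)"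
proof -
  obtain D where D: "(iter_partial ds g has_derivative D) (at (p + s *\<^sub>R i))"
    using smooth_on_iter_derivative[OF assms] .
  have "((\<lambda>t. iter_partial ds g ((p + s *\<^sub>R i) + (t - s) *\<^sub>R i)) has_vector_derivative 1 *\<^sub>R iter_partial (i # ds) g (p + s *\<^sub>R i)) (at s)"
  proof -
    have "((\<lambda>t. t - s) has_vector_derivative 1) (at s)"
      by (auto intro!: derivative_eq_intros)
    moreover have "((\<lambda>t. iter_partial ds g ((p + s *\<^sub>R i) + t *\<^sub>R i)) has_vector_derivative
        iter_partial (i # ds) g (p + s *\<^sub>R i)) (at (s - s))"
      using has_derivative_along[OF D, of i] partial_deriv_eq[OF D, of i] by simp
    ultimately show ?thesis by (rule vector_diff_chain_at[unfolded o_def])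
  qed
  then show ?thesis by (simp add: algebra_simps)
qed

lemma gevrey_jet:
  fixes g :: "real \<times> real \<Rightarrow> complex"
  assumes g: "gevrey \<sigma> UNIV g"
  obtains J C where "jet J" "\<And>\<xi> \<eta>. J 0 \<xi> \<eta> = g (\<xi>, \<eta>)" "C \<ge> 1"
    "\<And>j \<xi> \<eta>. \<bar>\<xi>\<bar> \<le> 1 \<Longrightarrow> \<bar>\<eta>\<bar> \<le> 1 \<Longrightarrow> norm (J j \<xi> \<eta>) \<le> C ^ Suc j * fact j powr \<sigma>"
proof -
  define ds where "ds j = replicate j (1::real, 0::real)" for j
  define J where "J j \<xi> \<eta> = iter_partial (ds j) g (\<xi>, \<eta>)" for j \<xi> \<eta>
  have s: "smooth_on UNIV g" using g by (simp add: gevrey_def)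
  have B: "set (ds j) \<subseteq> Basis" for j by (auto simp: ds_def Basis_prod_def)
  have Bl: "ds j \<in> lists Basis" for j unfolding in_lists_conv_set using B by blast
  have len: "length (ds j) = j" for j by (simp add: ds_def)
  have mf: "multi_fact (ds j) = fact j" for j
  proof -
    have "count_list (ds j) (1, 0) = j \<and> count_list (ds j) (0, 1) = 0"
      unfolding ds_def by (induction j) auto
    moreover have Bs: "(Basis :: (real \<times> real) set) = {(1, 0), (0, 1)}" by (auto simp: Basis_prod_def)
    ultimately show ?thesis unfolding multi_fact_def Bs by simp
  qed
  have "compact (cball 0 1 \<times> cball 0 1 :: (real \<times> real) set)" by (intro compact_Times compact_cball)
  then obtain C where C: "C > 0" "\<And>j p. p \<in> cball 0 1 \<times> cball 0 1 \<Longrightarrow>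
      norm (iter_partial (ds j) g p) \<le> C ^ (length (ds j) + 1) * multi_fact (ds j) powr \<sigma>"
    using g Bl unfolding gevrey_def by (metis subset_UNIV)
  show ?thesis
  proof
    show "jet J" unfolding jet_def
    proof (intro conjI allI)
      show "jointly_continuous (J j)" for j
        using smooth_on_iter_continuous[OF s B] by (simp add: jointly_continuous_def J_def)
      show "((\<lambda>\<xi>. J j \<xi> \<eta>) has_vector_derivative J (Suc j) \<xi> \<eta>) (at \<xi>)" for j \<xi> \<eta>
        using iter_partial_line[OF s B[of j], of "(0, \<eta>)" "(1, 0)" \<xi>] by (simp add: J_def ds_def)
    qed
    show "J 0 \<xi> \<eta> = g (\<xi>, \<eta>)" for \<xi> \<eta> by (simp add: J_def ds_def)
    show "max C 1 \<ge> 1" by simp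
    fix j and \<xi> \<eta> :: real assume "\<bar>\<xi>\<bar> \<le> 1" "\<bar>\<eta>\<bar> \<le> 1"
    then have "norm (J j \<xi> \<eta>) \<le> C ^ Suc j * fact j powr \<sigma>"
      using C(2)[of "(\<xi>, \<eta>)" j] unfolding J_def mf by (simp add: len)
    also have "\<dots> \<le> max C 1 ^ Suc j * fact j powr \<sigma>"
      using C(1) by (intro mult_right_mono power_mono) auto
    finally show "norm (J j \<xi> \<eta>) \<le> max C 1 ^ Suc j * fact j powr \<sigma>" .
  qed
qed

text \<open>
Rescaling multiplies the \<open>j\<close>-th derivative by \<open>\<epsilon>\<close> to the power \<open>-(j + 1)\<close>, which is absorbed into \<open>K\<close>.
\<close>

lemma gevrey_bump_jet:
  fixes \<phi> :: "real \<Rightarrow> real"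
  assumes \<phi>: "gevrey \<sigma> UNIV \<phi>" and supp: "supp_on UNIV \<phi> \<subseteq> {-1..1}" and \<epsilon>: "0 < \<epsilon>" "\<epsilon> \<le> 1"
  obtains \<psi> K D where "jet \<psi>" "\<And>\<xi> \<eta>. \<psi> 0 \<xi> \<eta> = of_real (\<phi> (\<xi> / \<epsilon>) / \<epsilon>)"
    "\<And>j \<eta>. \<psi> j \<epsilon> \<eta> = 0" "\<And>j \<eta>. \<psi> j (- \<epsilon>) \<eta> = 0" "K \<ge> 1" "D \<ge> 1"
    "gevrey_jet_bound \<sigma> \<epsilon> K 0 D \<psi>"
proof -
  define P where "P j = iter_partial (replicate j (1::real)) \<phi>" for j
  have s: "smooth_on UNIV \<phi>" using \<phi> by (simp add: gevrey_def)
  have B: "set (replicate j (1::real)) \<subseteq> Basis" for j by auto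
  have Pc: "continuous_on UNIV (P j)" for j unfolding P_def by (rule smooth_on_iter_continuous[OF s B])
  have Pd: "(P j has_vector_derivative P (Suc j) t) (at t)" for j t
    using iter_partial_line[OF s B[of j], of 0 1 t] by (simp add: P_def)
  obtain C where C: "C > 0" "\<And>j t. t \<in> cball 0 1 \<Longrightarrow>
      norm (P j t) \<le> C ^ (length (replicate j (1::real)) + 1) * multi_fact (replicate j (1::real)) powr \<sigma>"
    using \<phi> compact_cball unfolding gevrey_def P_def by (metis subset_UNIV B in_lists_conv_set subsetD)
  have mf: "multi_fact (replicate j (1::real)) = fact j" for j
  proof -
    have "count_list (replicate j (1::real)) 1 = j" by (induction j) auto
    then show ?thesis by (simp add: multi_fact_def)
  qed
  have P0: "P j t = 0" if "\<bar>t\<bar> > 1" for j t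
    using that
  proof (induction j arbitrary: t)
    case 0
    have "t \<notin> {x \<in> UNIV. \<phi> x \<noteq> 0}"
      using supp closure_subset[of "{x \<in> UNIV. \<phi> x \<noteq> 0}"] 0 unfolding supp_on_def by force
    then show ?case by (simp add: P_def)
  next
    case (Suc j)
    have "open {t::real. \<bar>t\<bar> > 1}" by (intro open_Collect_less continuous_intros)
    then have "((\<lambda>_. 0) has_vector_derivative P (Suc j) t) (at t)"
      using has_vector_derivative_transform_within_open[OF Pd[of j t], of "{t. \<bar>t\<bar> > 1}" "\<lambda>_. 0"] Suc by auto
    then show ?case using vector_derivative_unique_at has_vector_derivative_const by metis
  qed
  have P1: "P j 1 = 0" "P j (- 1) = 0" for j
  proof -
    have c: "closed {t. P j t = 0}" using Pc[of j] by (intro closed_Collect_eq continuous_on_const)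
    have "{1<..} \<subseteq> {t. P j t = 0}" "{..<-1} \<subseteq> {t. P j t = 0}" using P0 by auto
    from closure_minimal[OF this(1) c] closure_minimal[OF this(2) c]
    show "P j 1 = 0" "P j (- 1) = 0" by auto
  qed
  define \<psi> where "\<psi> j \<xi> \<eta> = complex_of_real (P j (\<xi> / \<epsilon>) / \<epsilon> ^ Suc j)" for j :: nat and \<xi> \<eta> :: real
  define K where "K = max C 1 / \<epsilon>"
  have K: "K \<ge> 1" "C / \<epsilon> \<le> K" using \<epsilon> by (auto simp: K_def field_simps)
  show ?thesis
  proof
    show "jet \<psi>" unfolding jet_def
    proof (intro conjI allI)
      show "jointly_continuous (\<psi> j)" for j unfolding jointly_continuous_def \<psi>_def
        using \<epsilon> by (intro continuous_intros continuous_on_compose2[OF Pc]) auto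
      fix j \<xi> \<eta>
      have "((\<lambda>\<xi>. P j (\<xi> / \<epsilon>)) has_real_derivative P (Suc j) (\<xi> / \<epsilon>) * (1 / \<epsilon>)) (at \<xi>)"
        using Pd[of j "\<xi> / \<epsilon>"] unfolding has_real_derivative_iff_has_vector_derivative[symmetric]
        by (rule DERIV_chain2) (use \<epsilon> in \<open>auto intro!: derivative_eq_intros\<close>)
      from DERIV_cdivide[OF this, of "\<epsilon> ^ Suc j"]
      have "((\<lambda>\<xi>. P j (\<xi> / \<epsilon>) / \<epsilon> ^ Suc j) has_vector_derivative P (Suc j) (\<xi> / \<epsilon>) / \<epsilon> ^ Suc (Suc j)) (at \<xi>)"
        unfolding has_real_derivative_iff_has_vector_derivative[symmetric] by simp
      then show "((\<lambda>\<xi>. \<psi> j \<xi> \<eta>) has_vector_derivative \<psi> (Suc j) \<xi> \<eta>) (at \<xi>)"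
        unfolding \<psi>_def by (rule bounded_linear.has_vector_derivative[OF bounded_linear_of_real])
    qed
    show "\<psi> 0 \<xi> \<eta> = of_real (\<phi> (\<xi> / \<epsilon>) / \<epsilon>)" for \<xi> \<eta> by (simp add: \<psi>_def P_def)
    show "\<psi> j \<epsilon> \<eta> = 0" "\<psi> j (- \<epsilon>) \<eta> = 0" for j \<eta> using \<epsilon> P1 by (simp_all add: \<psi>_def)
    show "K \<ge> 1" "K \<ge> 1" by fact+
    show "gevrey_jet_bound \<sigma> \<epsilon> K 0 K \<psi>" unfolding gevrey_jet_bound_def
    proof (intro allI impI)
      fix j \<xi> and \<eta> :: real assume "\<bar>\<xi>\<bar> \<le> \<epsilon> \<and> \<bar>\<eta>\<bar> \<le> 1"
      then have "\<xi> / \<epsilon> \<in> cball 0 1" using \<epsilon> by (simp add: abs_divide)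
      then have "\<bar>P j (\<xi> / \<epsilon>)\<bar> \<le> C ^ Suc j * fact j powr \<sigma>"
        using C(2)[of "\<xi> / \<epsilon>" j] by (simp add: mf)
      then have "\<bar>P j (\<xi> / \<epsilon>)\<bar> / \<epsilon> ^ Suc j \<le> C ^ Suc j * fact j powr \<sigma> / \<epsilon> ^ Suc j"
        using \<epsilon> by (intro divide_right_mono) auto
      then have "norm (\<psi> j \<xi> \<eta>) \<le> (C / \<epsilon>) ^ Suc j * fact j powr \<sigma>"
        using \<epsilon> by (simp add: \<psi>_def power_divide abs_mult norm_divide norm_mult norm_power)
      also have "\<dots> \<le> K ^ Suc j * fact j powr \<sigma>"
        using K C(1) \<epsilon> by (intro mult_right_mono power_mono) auto
      finally show "norm (\<psi> j \<xi> \<eta>) \<le> K * K ^ j * fact (j + 0) powr \<sigma>" by simp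
    qed
  qed
qed

lemma gevrey_jet_bound_mono: "gevrey_jet_bound \<sigma> \<epsilon> K r D \<Phi> \<Longrightarrow> K \<le> K' \<Longrightarrow> D \<le> D' \<Longrightarrow> K \<ge> 0 \<Longrightarrow> D \<ge> 0 \<Longrightarrow> gevrey_jet_bound \<sigma> \<epsilon> K' r D' \<Phi>"
  unfolding gevrey_jet_bound_def
  by (intro allI impI) (erule allE, erule allE, erule allE, erule (1) impE, erule order_trans,
     intro mult_mono power_mono mult_nonneg_nonneg zero_le_power, auto)

context transported_weight
begin

text \<open>
The drift contains \<open>\<partial>\<^sub>\<xi> a\<close>, hence the factorial of \<open>j + 1\<close>; the excess \<open>(j + 1)\<^sup>\<sigma> \<le> (2\<^sup>\<sigma>)\<^sup>j\<close> is geometric.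
\<close>

lemma gevrey_jet_bound_drift:
  assumes a_b: "\<And>j \<xi> \<eta>. \<bar>\<xi>\<bar> \<le> 1 \<Longrightarrow> \<bar>\<eta>\<bar> \<le> 1 \<Longrightarrow> norm (a j \<xi> \<eta>) \<le> C ^ Suc j * fact j powr \<sigma>"
    and b_b: "\<And>j \<xi> \<eta>. \<bar>\<xi>\<bar> \<le> 1 \<Longrightarrow> \<bar>\<eta>\<bar> \<le> 1 \<Longrightarrow> norm (b j \<xi> \<eta>) \<le> C ^ Suc j * fact j powr \<sigma>"
    and C: "C \<ge> 1" and \<sigma>: "\<sigma> \<ge> 1"
  defines "K \<equiv> C * (1 + 2 * C) * 2 powr \<sigma>"
  shows "gevrey_jet_bound \<sigma> \<epsilon> K 0 K drift"
  unfolding gevrey_jet_bound_def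
proof (intro allI impI)
  fix j \<xi> \<eta> assume x: "\<bar>\<xi>\<bar> \<le> \<epsilon> \<and> \<bar>\<eta>\<bar> \<le> (1::real)"
  then have \<xi>: "\<bar>\<xi>\<bar> \<le> 1" using \<epsilon>\<gamma>(2) \<gamma> by simp
  have Sj: "real (Suc j) powr \<sigma> \<le> (2 powr \<sigma>) ^ j"
  proof -
    have "Suc j \<le> 2 ^ j" by (induction j) auto
    then have "real (Suc j) \<le> 2 ^ j" by (metis of_nat_le_iff of_nat_numeral of_nat_power)
    then have "real (Suc j) powr \<sigma> \<le> (2 ^ j) powr \<sigma>" using \<sigma> by (intro powr_mono2) auto
    also have "\<dots> = (2 powr \<sigma>) ^ j" by (simp add: powr_power powr_powr powr_realpow[symmetric] mult.commute)
    finally show ?thesis .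
  qed
  have "norm (seg_int \<gamma> (a (Suc j)) \<xi> \<eta>) \<le> 2 * (C ^ Suc (Suc j) * fact (Suc j) powr \<sigma>)"
    using x \<xi> \<epsilon>\<gamma>(2) \<epsilon> \<gamma> by (intro seg_int_bound jetD(1) a a_b) auto
  also have "fact (Suc j) powr \<sigma> = real (Suc j) powr \<sigma> * fact j powr \<sigma>" by (simp add: powr_mult)
  also have "2 * (C ^ Suc (Suc j) * (real (Suc j) powr \<sigma> * fact j powr \<sigma>)) \<le> 2 * (C ^ Suc (Suc j) * ((2 powr \<sigma>) ^ j * fact j powr \<sigma>))"
    using C Sj by (intro mult_left_mono mult_right_mono) auto
  finally have 1: "norm (seg_int \<gamma> (a (Suc j)) \<xi> \<eta>) \<le> C ^ Suc j * (2 * C * (2 powr \<sigma>) ^ j) * fact j powr \<sigma>"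
    by (simp add: mult_ac)
  have p2: "2 powr \<sigma> \<ge> 1" using \<sigma> by (simp add: ge_one_powr_ge_zero)
  have "norm (drift j \<xi> \<eta>) \<le> C ^ Suc j * fact j powr \<sigma> + C ^ Suc j * (2 * C * (2 powr \<sigma>) ^ j) * fact j powr \<sigma>"
    unfolding drift_def using 1 b_b[OF \<xi>, of \<eta> j] x by (intro order_trans[OF norm_triangle_ineq4] add_mono) auto
  also have "\<dots> = C ^ Suc j * (1 + 2 * C * (2 powr \<sigma>) ^ j) * fact j powr \<sigma>" by (simp add: algebra_simps)
  also have "\<dots> \<le> C ^ Suc j * ((1 + 2 * C) ^ Suc j * (2 powr \<sigma>) ^ Suc j) * fact j powr \<sigma>"
  proof (intro mult_right_mono mult_left_mono)
    have q: "(2 powr \<sigma>) ^ j \<ge> 1" using p2 by (rule one_le_power)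
    have "1 + 2 * C * (2 powr \<sigma>) ^ j \<le> (1 + 2 * C) * (2 powr \<sigma>) ^ j" using q by (simp add: distrib_right)
    also have "\<dots> \<le> (1 + 2 * C) ^ Suc j * (2 powr \<sigma>) ^ Suc j"
      using C p2 self_le_power[of "1 + 2 * C" "Suc j"] power_increasing[of j "Suc j" "2 powr \<sigma>"]
      by (intro mult_mono) auto
    finally show "1 + 2 * C * (2 powr \<sigma>) ^ j \<le> (1 + 2 * C) ^ Suc j * (2 powr \<sigma>) ^ Suc j" .
  qed (use C in auto)
  also have "\<dots> = K * K ^ j * fact (j + 0) powr \<sigma>"
    by (simp add: K_def power_mult_distrib mult_ac)
  finally show "norm (drift j \<xi> \<eta>) \<le> K * K ^ j * fact (j + 0) powr \<sigma>" .
qed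

lemma gevrey_jet_bound_test_jet:
  assumes "jet \<psi>" "gevrey_jet_bound \<sigma> \<epsilon> K 0 D \<psi>" "gevrey_jet_bound \<sigma> \<epsilon> K 0 K drift" "\<sigma> \<ge> 1" "K \<ge> 0" "D \<ge> 0"
  shows "gevrey_jet_bound \<sigma> \<epsilon> K (Suc k) (2 * K * D * (4 * K) ^ k) (test_jet \<psi> k)"
proof (induction k)
  case 0
  show ?case using gevrey_jet_bound_jet_op[OF assms(3,2,4-6)] by simp
next
  case (Suc k)
  have "\<bar>\<gamma>\<bar> \<le> 1" using \<epsilon>\<gamma>(2) \<epsilon> \<gamma> by simp
  from gevrey_jet_bound_seg_int[OF test_jet_jet[OF assms(1)] Suc this]
  have "gevrey_jet_bound \<sigma> \<epsilon> K (Suc (Suc k)) (2 * K * (2 * (2 * K * D * (4 * K) ^ k))) (test_jet \<psi> (Suc k))"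
    unfolding test_jet.simps by (rule gevrey_jet_bound_jet_op[OF assms(3) _ assms(4,5)]) (use assms(5,6) in simp)
  then show ?case by (simp add: mult_ac)
qed

lemma moment_bound:
  assumes \<psi>: "jet \<psi>" and ends: "\<And>j \<eta>. \<psi> j \<epsilon> \<eta> = 0" "\<And>j \<eta>. \<psi> j (- \<epsilon>) \<eta> = 0"
    and const: "\<And>\<xi> \<eta> \<eta>'. \<psi> 0 \<xi> \<eta> = \<psi> 0 \<xi> \<eta>'"
    and gevrey_jet_bound: "gevrey_jet_bound \<sigma> \<epsilon> K 0 D \<psi>" "gevrey_jet_bound \<sigma> \<epsilon> K 0 K drift" and \<sigma>: "\<sigma> \<ge> 1" and K: "K \<ge> 1" and D: "D \<ge> 1"
    and a_b: "\<And>\<xi> \<eta>. \<bar>\<xi>\<bar> \<le> 1 \<Longrightarrow> \<bar>\<eta>\<bar> \<le> 1 \<Longrightarrow> norm (a 0 \<xi> \<eta>) \<le> C" and C: "C \<ge> 0"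
    and mass: "slice_mass \<le> \<mu>" "data_mass \<le> \<mu>"
  shows "norm (moment (\<lambda>x. line_mean x (\<psi> 0)) k) \<le> exp (2 * C) * D * (4 * K) ^ k * fact k powr \<sigma> * \<mu>"
proof (cases k)
  case 0
  have \<mu>: "0 \<le> \<mu>"
    using mass(1) unfolding slice_mass_def
    by (rule order_trans[rotated]) (rule integral_nonneg,
      intro integrable_continuous_real continuous_intros jointly_continuousD[OF radon_continuous], simp)
  have "norm (moment (\<lambda>x. line_mean x (\<psi> 0)) 0) \<le> D * slice_mass"
  proof (rule moment_0_bound[OF jetD(1)[OF \<psi>]])
    show "norm (\<psi> 0 \<xi> \<gamma>) \<le> D" if "\<bar>\<xi>\<bar> \<le> \<epsilon>" for \<xi>
      using gevrey_jet_bound(1)[unfolded gevrey_jet_bound_def, rule_format, of \<xi> \<gamma> 0] that \<epsilon>\<gamma>(2) \<epsilon> \<gamma> by simp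
  qed
  also have "\<dots> \<le> D * \<mu>" using mass D by (intro mult_left_mono) auto
  also have "\<dots> = 1 * (D * \<mu>)" by simp
  also have "\<dots> \<le> exp (2 * C) * (D * \<mu>)" using C D \<mu> by (intro mult_right_mono) auto
  finally show ?thesis using 0 by (simp add: mult_ac)
next
  case (Suc k')
  have "norm (moment (\<lambda>x. line_mean x (\<psi> 0)) (Suc k')) \<le> (exp (2 * C) * (D * (4 * K) ^ Suc k' * fact (Suc k') powr \<sigma>)) * data_mass"
  proof (rule moment_Suc_bound[OF \<psi> ends const])
    fix \<xi> \<eta> assume \<xi>: "\<bar>\<xi>\<bar> \<le> \<epsilon>" and \<eta>: "\<bar>\<eta>\<bar> \<le> \<gamma>"
    then have 1: "\<bar>\<xi>\<bar> \<le> 1" "\<bar>\<eta>\<bar> \<le> 1" using \<epsilon>\<gamma>(2) \<epsilon> \<gamma> by auto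
    have "norm (seg_int \<gamma> (a 0) \<xi> \<eta>) \<le> 2 * C"
      using 1 \<epsilon>\<gamma>(2) \<epsilon> \<gamma> by (intro seg_int_bound jetD(1) a a_b) auto
    then have g: "norm (gauge \<xi> \<eta>) \<le> exp (2 * C)"
      unfolding gauge_def by (intro order_trans[OF norm_exp]) simp
    have "norm (test_jet \<psi> k' 0 \<xi> \<eta>) \<le> 2 * K * D * (4 * K) ^ k' * fact (Suc k') powr \<sigma>"
      using gevrey_jet_bound_test_jet[OF \<psi> gevrey_jet_bound \<sigma>, of k', unfolded gevrey_jet_bound_def, rule_format, of \<xi> \<eta> 0] K D \<xi> 1 by simp
    also have "\<dots> \<le> D * (4 * K) ^ Suc k' * fact (Suc k') powr \<sigma>"
      using K D by (intro mult_right_mono) (auto simp: mult_ac)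
    finally show "norm (gauge \<xi> \<eta> * test_jet \<psi> k' 0 \<xi> \<eta>) \<le> exp (2 * C) * (D * (4 * K) ^ Suc k' * fact (Suc k') powr \<sigma>)"
      unfolding norm_mult using g by (intro mult_mono) auto
  qed
  also have "\<dots> \<le> (exp (2 * C) * (D * (4 * K) ^ Suc k' * fact (Suc k') powr \<sigma>)) * \<mu>"
    using mass K D by (intro mult_left_mono) auto
  finally show ?thesis using Suc by (simp add: mult_ac)
qed

end

section \<open>Choosing the degree\<close>

lemma jackson_coeff_sum:
  assumes "n \<ge> 2"
  shows "(\<Sum>j\<le>degree (jackson_poly n). \<bar>coeff (jackson_poly n) j\<bar> * 2 ^ j) \<le> 24 * real n ^ 3 * real n ^ (4 * n) * 16 ^ n"
proof -
  let ?A = "real (2*n+1) * real (n+1) ^ 2 * real n ^ (4*n)"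
  have "(\<Sum>j\<le>degree (jackson_poly n). \<bar>coeff (jackson_poly n) j\<bar> * 2 ^ j) \<le> (\<Sum>j\<le>4 * n. ?A * 2 ^ j)"
  proof -
    have "(\<Sum>j\<le>degree (jackson_poly n). \<bar>coeff (jackson_poly n) j\<bar> * 2 ^ j) \<le> (\<Sum>j\<le>degree (jackson_poly n). ?A * 2 ^ j)"
      using assms by (intro sum_mono mult_right_mono coeff_jackson_poly_le) auto
    also have "\<dots> \<le> (\<Sum>j\<le>4 * n. ?A * 2 ^ j)"
      using degree_jackson_poly[of n] by (intro sum_mono2) auto
    finally show ?thesis .
  qed
  also have "\<dots> = ?A * (2 ^ Suc (4 * n) - 1)"
    by (simp only: sum_distrib_left[symmetric] lessThan_Suc_atMost[symmetric]) (simp add: geometric_sum)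
  also have "\<dots> \<le> ?A * (2 * 16 ^ n)" by (intro mult_left_mono) (auto simp: power_mult)
  also have "\<dots> \<le> (3 * real n * (2 * real n) ^ 2 * real n ^ (4 * n)) * (2 * 16 ^ n)"
    using assms by (intro mult_right_mono mult_mono power_mono) auto
  also have "\<dots> = 24 * real n ^ 3 * real n ^ (4 * n) * 16 ^ n"
    by (simp add: power2_eq_square power3_eq_cube)
  finally show ?thesis .
qed

text \<open>
All factors in front of the squared data, namely the squared moment bound, the kernel coefficients and the
polynomial losses in \<open>n\<close>, are crudely below \<open>256 K n\<close> to the power \<open>(8\<sigma> + 12) n\<close>: the square of \<open>(4n)!\<^sup>\<sigma>\<close>
gives \<open>8\<sigma>\<close>, the kernel coefficients give 4 and the polynomial factors at most 8.
\<close>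

lemma L2_from_moments:
  fixes h :: "real \<Rightarrow> complex"
  assumes hol: "\<And>x y. norm (h x - h y) \<le> M * \<bar>x - y\<bar> powr \<alpha>"
    and \<alpha>: "0 < \<alpha>" "\<alpha> \<le> 1"
    and supp: "\<And>x. \<bar>x\<bar> \<ge> 1 \<Longrightarrow> h x = 0"
    and n: "n \<ge> 2" and M: "M \<ge> 1" and K: "K \<ge> 1" and P: "P \<ge> 0" and \<sigma>: "\<sigma> \<ge> 1"
    and mom: "\<And>k. norm (moment h k) \<le> P * (4 * K) ^ k * fact k powr \<sigma>"
    and small: "P\<^sup>2 * (256 * K * real n) powr ((8 * \<sigma> + 12) * real n) \<le> 1"
  shows "integral {-1..1} (\<lambda>x. (norm (h x))\<^sup>2) \<le> (131072 * M * real n powr (- \<alpha>))\<^sup>2"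
proof -
  define d where "d = 65536 * M * real n powr (- \<alpha>)"
  define S where "S = (\<Sum>j\<le>degree (jackson_poly n). \<bar>coeff (jackson_poly n) j\<bar> * 2 ^ j)"
  define B where "B = P * (4 * K) ^ (4 * n) * (real (4 * n) ^ (4 * n)) powr \<sigma>"
  have n0: "real n \<ge> 2" using n by simp
  have B: "norm (moment h k) \<le> B" if k: "k \<le> 4 * n" for k
  proof -
    have "(fact k :: real) \<le> fact (4 * n)" using k by (rule fact_mono)
    also have "\<dots> \<le> real (4 * n) ^ (4 * n)" using fact_le_power[of "4 * n", where 'a = real] by simp
    finally have "fact k powr \<sigma> \<le> (real (4 * n) ^ (4 * n)) powr \<sigma>" using \<sigma> by (intro powr_mono2) auto
    then have "P * (4 * K) ^ k * fact k powr \<sigma> \<le> B"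
      unfolding B_def using P K k by (intro mult_mono power_increasing) auto
    with mom[of k] show ?thesis by linarith
  qed
  have J: "integral {-1..1} (\<lambda>x. (norm (h x))\<^sup>2) \<le> 2 * d\<^sup>2 + 4 * real n * (B\<^sup>2 * S)"
    unfolding d_def S_def by (rule jackson_L2[OF hol \<alpha> supp n B])
  have "(real n)\<^sup>2 * (4 * real n * (B\<^sup>2 * S)) \<le> (real n)\<^sup>2 * (4 * real n * (B\<^sup>2 * (24 * real n ^ 3 * real n ^ (4 * n) * 16 ^ n)))"
    unfolding S_def by (intro mult_left_mono jackson_coeff_sum[OF n]) auto
  also have "\<dots> = (96 * real n ^ 6) * (B\<^sup>2 * real n ^ (4 * n) * 16 ^ n)"
    by (simp add: power2_eq_square power3_eq_cube numeral_eq_Suc)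
  also have "\<dots> \<le> real n ^ (8 * n) * (B\<^sup>2 * real n ^ (4 * n) * 16 ^ n)"
  proof (intro mult_right_mono)
    have "96 * real n ^ 6 \<le> real n ^ 7 * real n ^ 6"
      using power_mono[of 2 "real n" 7] n0 by (intro mult_right_mono) auto
    also have "\<dots> = real n ^ 13" by (simp flip: power_add)
    also have "\<dots> \<le> real n ^ (8 * n)" using n n0 by (intro power_increasing) auto
    finally show "96 * real n ^ 6 \<le> real n ^ (8 * n)" .
  qed auto
  also have "\<dots> = P\<^sup>2 * (((real (4 * n) ^ (4 * n)) powr \<sigma>)\<^sup>2 * (((4 * K) ^ (4 * n))\<^sup>2 * 16 ^ n * (real n ^ (8 * n) * real n ^ (4 * n))))"
    by (simp add: B_def power_mult_distrib mult_ac)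
  also have "\<dots> \<le> P\<^sup>2 * (((256 * K * real n) ^ (8 * n)) powr \<sigma> * (256 * K * real n) ^ (12 * n))"
  proof (intro mult_left_mono mult_mono)
    have "((real (4 * n) ^ (4 * n)) powr \<sigma>)\<^sup>2 = (real (4 * n) ^ (4 * n) * real (4 * n) ^ (4 * n)) powr \<sigma>"
      by (simp add: power2_eq_square powr_mult)
    also have "\<dots> = (real (4 * n) ^ (8 * n)) powr \<sigma>"
    proof -
      have "4 * n + 4 * n = 8 * n" by simp
      then show ?thesis by (simp only: power_add[symmetric])
    qed
    also have "\<dots> \<le> ((256 * K * real n) ^ (8 * n)) powr \<sigma>"
      using K n0 \<sigma> mult_right_mono[of 4 "256 * K" "real n"] by (intro powr_mono2 power_mono) auto
    finally show "((real (4 * n) ^ (4 * n)) powr \<sigma>)\<^sup>2 \<le> ((256 * K * real n) ^ (8 * n)) powr \<sigma>" .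
    have "((4 * K) ^ (4 * n))\<^sup>2 * 16 ^ n = (4 * K) ^ (8 * n) * 16 ^ n"
      by (simp only: power_mult[symmetric]) (simp add: mult.commute)
    also have "\<dots> \<le> (256 * K) ^ (8 * n) * (256 * K) ^ n"
      using K by (intro mult_mono power_mono) auto
    also have "\<dots> \<le> (256 * K) ^ (8 * n) * (256 * K) ^ (4 * n)"
      using K by (intro mult_left_mono power_increasing) auto
    also have "\<dots> = (256 * K) ^ (12 * n)"
      by (simp only: power_add[symmetric] add_mult_distrib[symmetric]) simp
    finally have 1: "((4 * K) ^ (4 * n))\<^sup>2 * 16 ^ n \<le> (256 * K) ^ (12 * n)" .
    have 2: "real n ^ (8 * n) * real n ^ (4 * n) = real n ^ (12 * n)" by (simp flip: power_add)
    show "((4 * K) ^ (4 * n))\<^sup>2 * 16 ^ n * (real n ^ (8 * n) * real n ^ (4 * n)) \<le> (256 * K * real n) ^ (12 * n)"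
      unfolding 2 power_mult_distrib[of "256 * K" "real n"] using 1 by (intro mult_right_mono) auto
  qed (use K in auto)
  also have "((256 * K * real n) ^ (8 * n)) powr \<sigma> * (256 * K * real n) ^ (12 * n)
     = (256 * K * real n) powr ((8 * \<sigma> + 12) * real n)"
  proof -
    have pos: "256 * K * real n > 0" using K n0 by simp
    have "((256 * K * real n) ^ (8 * n)) powr \<sigma> = (256 * K * real n) powr (real (8 * n) * \<sigma>)"
      using pos by (simp only: powr_realpow[symmetric] powr_powr)
    moreover have "(256 * K * real n) ^ (12 * n) = (256 * K * real n) powr real (12 * n)"
      using pos by (simp only: powr_realpow)
    ultimately show ?thesis by (simp add: powr_add[symmetric] algebra_simps)
  qed
  also note small
  finally have E: "(real n)\<^sup>2 * (4 * real n * (B\<^sup>2 * S)) \<le> 1" .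
  have dn: "d * real n \<ge> 1"
  proof -
    have "real n powr (-1) \<le> real n powr (- \<alpha>)" using \<alpha> n0 by (intro powr_mono) auto
    then have "1 / real n \<le> real n powr (- \<alpha>)" using n0 by (simp add: powr_minus inverse_eq_divide)
    then have "1 * (1 / real n) \<le> (65536 * M) * real n powr (- \<alpha>)" using M by (intro mult_mono) auto
    then show ?thesis using n0 by (simp add: d_def field_simps)
  qed
  have "(real n)\<^sup>2 * (4 * real n * (B\<^sup>2 * S)) \<le> (d * real n)\<^sup>2" using E dn one_le_power[of "d * real n" 2] by linarith
  then have "4 * real n * (B\<^sup>2 * S) \<le> d\<^sup>2" using n0 by (simp add: power_mult_distrib mult.commute)
  with J have "integral {-1..1} (\<lambda>x. (norm (h x))\<^sup>2) \<le> 2 * d\<^sup>2 + d\<^sup>2" by linarith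
  also have "\<dots> \<le> (2 * d)\<^sup>2" by (simp add: power_mult_distrib)
  also have "2 * d = 131072 * M * real n powr (- \<alpha>)" by (simp add: d_def)
  finally show ?thesis .
qed

text \<open>
Take \<open>n\<close> to be the integer part of \<open>L / (t ln L)\<close>. For large \<open>L\<close> one has \<open>Q n \<le> L\<close>, so the power is at most
\<open>L\<close> to the power \<open>L / ln L\<close>, which equals \<open>exp L\<close>; this leaves the factor \<open>exp (-L)\<close> to beat the constant.
\<close>

lemma degree_choice:
  fixes t Q A :: real
  assumes t: "t > 0" and Q: "Q \<ge> 1"
  obtains L\<^sub>0 where "\<And>L. L \<ge> L\<^sub>0 \<Longrightarrow> ln L > 0 \<and> L > 0 \<and> (\<exists>n\<ge>2. (A * exp (- L))\<^sup>2 * (Q * real n) powr (t * real n) \<le> 1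
      \<and> 1 / real n \<le> 2 * t * ln L / L)"
proof -
  have "eventually (\<lambda>L. L \<ge> (exp 1 :: real)) at_top" by (rule eventually_ge_at_top)
  moreover have "eventually (\<lambda>L. ln L \<ge> Q / t) at_top"
    using ln_at_top by (simp add: filterlim_at_top)
  moreover have "eventually (\<lambda>L. L / ln L \<ge> 2 * t) at_top"
  proof -
    have "filterlim (\<lambda>L. L / ln L) at_top (at_top :: real filter)"
      by real_asymp
    then show ?thesis by (simp add: filterlim_at_top)
  qed
  moreover have "eventually (\<lambda>L. exp L \<ge> A\<^sup>2) at_top"
    using exp_at_top by (simp add: filterlim_at_top)
  ultimately have "eventually (\<lambda>L. ln L > 0 \<and> L > 0 \<and> (\<exists>n\<ge>2. (A * exp (- L))\<^sup>2 * (Q * real n) powr (t * real n) \<le> 1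
      \<and> 1 / real n \<le> 2 * t * ln L / L)) at_top"
  proof eventually_elim
    case (elim L)
    have L1: "L > 1" using elim(1) exp_gt_one[of 1] by linarith
    have l: "ln L > 0" using L1 by simp
    define y where "y = L / (t * ln L)"
    define n where "n = nat \<lfloor>y\<rfloor>"
    have y2: "y \<ge> 2" using elim(3) t l by (simp add: y_def field_simps)
    have n: "n \<ge> 2" "real n \<le> y" "y \<le> 2 * real n" unfolding n_def using y2 by linarith+
    have "t * real n \<le> L / ln L" using n(2) t l by (simp add: y_def field_simps)
    moreover have "Q * real n \<le> L"
    proof -
      have "Q * real n \<le> (t * ln L) * y" using elim(2) n t Q l by (intro mult_mono) (auto simp: field_simps)
      then show ?thesis using t l by (simp add: y_def)
    qed
    moreover have "Q * real n > 0" using Q n by simp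
    ultimately have "(Q * real n) powr (t * real n) \<le> L powr (L / ln L)"
      using L1 t n by (intro order_trans[OF powr_mono2 powr_mono]) auto
    also have "\<dots> = exp L" using L1 l by (simp add: powr_def)
    finally have "(A * exp (- L))\<^sup>2 * (Q * real n) powr (t * real n) \<le> (A * exp (- L))\<^sup>2 * exp L"
      by (intro mult_left_mono) auto
    also have "\<dots> = A\<^sup>2 / exp L"
      by (simp add: power_mult_distrib exp_minus power2_eq_square field_simps)
    also have "\<dots> \<le> 1" using elim(4) by simp
    finally have 1: "(A * exp (- L))\<^sup>2 * (Q * real n) powr (t * real n) \<le> 1" .
    have "1 / real n \<le> 2 / y" using n y2 by (simp add: field_simps)
    also have "\<dots> = 2 * t * ln L / L" by (simp add: y_def)
    finally show ?case using l L1 n(1) 1 by auto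
  qed
  then show ?thesis using that unfolding eventually_at_top_linorder by blast
qed

section \<open>The norm of the mean and the smoothness of the weight\<close>

context transported_weight
begin

lemma L2_mean:
  assumes mean: "\<And>x. x \<noteq> 0 \<Longrightarrow> mean \<phi> m \<epsilon> \<gamma> f x = h x" and h: "continuous_on UNIV h"
  shows "L2_norm_on {-1..1} (mean \<phi> m \<epsilon> \<gamma> f) = ennreal (sqrt (integral {-1..1} (\<lambda>x. (norm (h x))\<^sup>2)))"
proof -
  have "(\<integral>\<^sup>+x\<in>{-1..1}. ennreal ((norm (mean \<phi> m \<epsilon> \<gamma> f x))\<^sup>2) \<partial>lborel)
      = (\<integral>\<^sup>+x\<in>{-1..1}. ennreal ((norm (h x))\<^sup>2) \<partial>lborel)"
  proof (rule nn_integral_cong_AE)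
    show "AE x in lborel. ennreal ((norm (mean \<phi> m \<epsilon> \<gamma> f x))\<^sup>2) * indicator {-1..1} x
       = ennreal ((norm (h x))\<^sup>2) * indicator {-1..1} x"
      using AE_lborel_singleton[of 0] by eventually_elim (simp add: mean)
  qed
  also have "\<dots> = ennreal (integral {-1..1} (\<lambda>x. (norm (h x))\<^sup>2))"
    by (rule set_nn_integral_eq_integral) (intro continuous_intros continuous_on_subset[OF h], auto)
  finally have I: "(\<integral>\<^sup>+x\<in>{-1..1}. ennreal ((norm (mean \<phi> m \<epsilon> \<gamma> f x))\<^sup>2) \<partial>lborel)
     = ennreal (integral {-1..1} (\<lambda>x. (norm (h x))\<^sup>2))" .
  have "integral {-1..1} (\<lambda>x. (norm (h x))\<^sup>2) \<ge> 0"
    by (rule integral_nonneg) (intro integrable_continuous_real continuous_intros continuous_on_subset[OF h], auto)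
  then show ?thesis unfolding L2_norm_on_def I by simp
qed

end

lemma smooth_bounded_lipschitz:
  fixes m :: "real \<times> real \<times> real \<Rightarrow> real"
  assumes m: "smooth_on UNIV m"
  obtains m1 L :: real where "m1 \<ge> 0" "L \<ge> 0"
    "\<And>x \<xi> \<gamma>. \<bar>x\<bar> \<le> 1 \<Longrightarrow> \<bar>\<xi>\<bar> \<le> 1 \<Longrightarrow> \<bar>\<gamma>\<bar> \<le> 1 \<Longrightarrow> \<bar>m (x, \<xi>, \<gamma>)\<bar> \<le> m1"
    "\<And>x x' \<xi> \<gamma>. \<bar>x\<bar> \<le> 1 \<Longrightarrow> \<bar>x'\<bar> \<le> 1 \<Longrightarrow> \<bar>\<xi>\<bar> \<le> 1 \<Longrightarrow> \<bar>\<gamma>\<bar> \<le> 1 \<Longrightarrow>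
       \<bar>m (x, \<xi>, \<gamma>) - m (x', \<xi>, \<gamma>)\<bar> \<le> L * \<bar>x - x'\<bar>"
proof -
  let ?e = "(1, 0, 0) :: real \<times> real \<times> real"
  let ?box = "cball 0 1 \<times> cball 0 1 \<times> cball 0 1 :: (real \<times> real \<times> real) set"
  have box: "compact ?box" by (intro compact_Times compact_cball)
  have e: "set [?e] \<subseteq> Basis" by (simp add: Basis_prod_def zero_prod_def)
  have bd: "\<exists>B\<ge>0. \<forall>p\<in>?box. \<bar>g p\<bar> \<le> B" if g: "continuous_on UNIV g" for g :: "real \<times> real \<times> real \<Rightarrow> real"
  proof -
    have "bounded (g ` ?box)"
      by (intro compact_imp_bounded compact_continuous_image box continuous_on_subset[OF g]) auto
    then show ?thesis unfolding bounded_pos by (auto intro: less_imp_le)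
  qed
  obtain m1 where m1: "m1 \<ge> 0" "\<And>p. p \<in> ?box \<Longrightarrow> \<bar>m p\<bar> \<le> m1"
    using bd[OF smooth_on_iter_continuous[OF m, of "[]"]] by auto
  obtain L where L: "L \<ge> 0" "\<And>p. p \<in> ?box \<Longrightarrow> \<bar>iter_partial [?e] m p\<bar> \<le> L"
    using bd[OF smooth_on_iter_continuous[OF m e]] by blast
  show ?thesis
  proof (rule that[OF m1(1) L(1)])
    show "\<bar>m (x, \<xi>, \<gamma>)\<bar> \<le> m1" if "\<bar>x\<bar> \<le> 1" "\<bar>\<xi>\<bar> \<le> 1" "\<bar>\<gamma>\<bar> \<le> 1" for x \<xi> \<gamma>
      using that by (intro m1) auto
    fix x x' \<xi> \<gamma> :: real assume a: "\<bar>x\<bar> \<le> 1" "\<bar>x'\<bar> \<le> 1" "\<bar>\<xi>\<bar> \<le> 1" "\<bar>\<gamma>\<bar> \<le> 1"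
    have "norm (m (x, \<xi>, \<gamma>) - m (x', \<xi>, \<gamma>)) \<le> L * norm (x - x')"
    proof (rule field_differentiable_bound[of "cball 0 1" "\<lambda>x. m (x, \<xi>, \<gamma>)" "\<lambda>x. iter_partial [?e] m (x, \<xi>, \<gamma>)"])
      show "((\<lambda>x. m (x, \<xi>, \<gamma>)) has_real_derivative iter_partial [?e] m (z, \<xi>, \<gamma>)) (at z within cball 0 1)" for z
        using iter_partial_line[OF m, of "[]" "(0, \<xi>, \<gamma>)" ?e z]
        by (simp add: has_real_derivative_iff_has_vector_derivative has_vector_derivative_at_within)
      show "norm (iter_partial [?e] m (z, \<xi>, \<gamma>)) \<le> L" if "z \<in> cball 0 1" for z
        using L(2)[of "(z, \<xi>, \<gamma>)"] that a by simp
    qed (use a in auto)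
    then show "\<bar>m (x, \<xi>, \<gamma>) - m (x', \<xi>, \<gamma>)\<bar> \<le> L * \<bar>x - x'\<bar>" by simp
  qed
qed

text \<open>
Rotating a line about its point \<open>(x, y)\<close> is the motion \<open>\<xi> \<mapsto> (x, \<xi>, y - \<xi> x)\<close>, with velocity \<open>(0, 1, -x)\<close>.
\<close>

lemma weight_derivative:
  assumes m: "smooth_on UNIV m"
    and eq: "\<And>x \<xi> \<eta>. complex_of_real (partial_deriv (0, 1, 0) m (x, \<xi>, \<eta>) - x * partial_deriv (0, 0, 1) m (x, \<xi>, \<eta>))
                    = (of_real x * a (\<xi>, \<eta>) + b (\<xi>, \<eta>)) * of_real (m (x, \<xi>, \<eta>))"
  shows "((\<lambda>\<xi>. complex_of_real (m (x, \<xi>, y - \<xi> * x))) has_vector_derivative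
      (of_real x * a (\<xi>, y - \<xi> * x) + b (\<xi>, y - \<xi> * x)) * of_real (m (x, \<xi>, y - \<xi> * x))) (at \<xi>)"
proof -
  let ?p = "(x, \<xi>, y - \<xi> * x)"
  obtain D where D: "(m has_derivative D) (at ?p)"
    using smooth_on_iter_derivative[OF m, of "[]" ?p] by auto
  interpret D: bounded_linear D using D by (rule has_derivative_bounded_linear)
  have "((\<lambda>\<xi>. (x, \<xi>, y - \<xi> * x)) has_derivative (\<lambda>t. (0, t, - (t * x)))) (at \<xi>)"
    by (auto intro!: derivative_eq_intros)
  from has_derivative_compose[OF this D]
  have "((\<lambda>\<xi>. m (x, \<xi>, y - \<xi> * x)) has_derivative (\<lambda>t. D (0, t, - (t * x)))) (at \<xi>)" .
  also have "(\<lambda>t. D (0, t, - (t * x))) = (\<lambda>t. t *\<^sub>R (D (0, 1, 0) - x * D (0, 0, 1)))"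
  proof
    fix t
    have "(0, t, - (t * x)) = t *\<^sub>R ((0, 1, 0) - x *\<^sub>R (0, 0, 1) :: real \<times> real \<times> real)"
      by (simp add: zero_prod_def)
    then show "D (0, t, - (t * x)) = t *\<^sub>R (D (0, 1, 0) - x * D (0, 0, 1))"
      by (simp only: D.scaleR D.diff real_scaleR_def)
  qed
  finally have "((\<lambda>\<xi>. m (x, \<xi>, y - \<xi> * x)) has_vector_derivative (D (0, 1, 0) - x * D (0, 0, 1))) (at \<xi>)"
    by (simp add: has_vector_derivative_def)
  then have "((\<lambda>\<xi>. complex_of_real (m (x, \<xi>, y - \<xi> * x))) has_vector_derivative of_real (D (0, 1, 0) - x * D (0, 0, 1))) (at \<xi>)"
    by (rule bounded_linear.has_vector_derivative[OF bounded_linear_of_real])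
  then show ?thesis unfolding eq[symmetric] partial_deriv_eq[OF D] .
qed

section \<open>The stability estimate\<close>

theorem theorem4p10:
  fixes \<sigma> :: real
    and m :: "real \<times> real \<times> real \<Rightarrow> real"
    and \<phi> :: "real \<Rightarrow> real"
    and N :: "real \<Rightarrow> real \<Rightarrow> (real \<times> real \<Rightarrow> complex) \<Rightarrow> ennreal"
  assumes "\<sigma> > 1"
    and "smooth_on UNIV m"
    and "\<And>p. m p \<ge> 0"
    and "\<exists>a b :: real \<times> real \<Rightarrow> complex. gevrey \<sigma> UNIV a \<and> gevrey \<sigma> UNIV b \<and>
           (\<forall>x \<xi> \<eta>. of_real (partial_deriv (0, 1, 0) m (x, \<xi>, \<eta>)
                              - x * partial_deriv (0, 0, 1) m (x, \<xi>, \<eta>))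
                    = (of_real x * a (\<xi>, \<eta>) + b (\<xi>, \<eta>)) * of_real (m (x, \<xi>, \<eta>)))"
    and "gevrey0 \<sigma> UNIV \<phi>"
    and "\<And>t. \<phi> t \<ge> 0"
    and "\<And>t. \<phi> (- t) = \<phi> t"
    and "supp_on UNIV \<phi> \<subseteq> {-1..1}"
    and "(LINT t|lborel. \<phi> t) = 1"
    and "data_norm_family N"
  shows "\<exists>\<gamma>\<^sub>0>0. \<forall>C\<^sub>0>0. \<exists>M>0. \<exists>C>0. \<forall>\<alpha> \<epsilon> \<gamma>.
           0 < \<alpha> \<and> \<alpha> \<le> 1 \<and> 0 < \<epsilon> \<and> \<epsilon> < 1 \<and>
           0 < \<gamma> \<and> \<gamma> < \<gamma>\<^sub>0 \<and> \<gamma> \<ge> \<epsilon>\<^sup>2 / 4 \<and> x_pos \<epsilon> \<gamma> \<le> 1 \<longrightarrow>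
           (\<exists>\<delta>>0. \<forall>f :: real \<times> real \<Rightarrow> complex.
              holder_seminorm \<alpha> f \<le> ennreal C\<^sub>0 \<and>
              supp_on UNIV f \<subseteq> {(x, y). y \<ge> x\<^sup>2} \<and>
              N \<epsilon> \<gamma> (weighted_radon m f) < ennreal \<delta> \<longrightarrow>
              (let \<nu> = enn2real (N \<epsilon> \<gamma> (weighted_radon m f)) in
                 L2_norm_on {-1..1} (mean \<phi> m \<epsilon> \<gamma> f)
                 \<le> ennreal (if \<nu> = 0 then 0
                     else 4 * M * (ln (C / \<epsilon>) * ln (ln (M / \<nu>)) / ln (M / \<nu>)) powr \<alpha>)))"
proof -
  have \<sigma>: "\<sigma> \<ge> 1" using assms(1) by simp
  obtain ga gb :: "real \<times> real \<Rightarrow> complex" where ga: "gevrey \<sigma> UNIV ga" and gb: "gevrey \<sigma> UNIV gb"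
    and transport: "\<And>x \<xi> \<eta>. complex_of_real (partial_deriv (0, 1, 0) m (x, \<xi>, \<eta>) - x * partial_deriv (0, 0, 1) m (x, \<xi>, \<eta>))
                    = (of_real x * ga (\<xi>, \<eta>) + gb (\<xi>, \<eta>)) * of_real (m (x, \<xi>, \<eta>))"
    using assms(4) by blast
  obtain a Ca where a: "jet a" "\<And>\<xi> \<eta>. a 0 \<xi> \<eta> = ga (\<xi>, \<eta>)" "Ca \<ge> 1"
    "\<And>j \<xi> \<eta>. \<bar>\<xi>\<bar> \<le> 1 \<Longrightarrow> \<bar>\<eta>\<bar> \<le> 1 \<Longrightarrow> norm (a j \<xi> \<eta>) \<le> Ca ^ Suc j * fact j powr \<sigma>"
    using gevrey_jet[OF ga] by blast
  obtain b Cb where b: "jet b" "\<And>\<xi> \<eta>. b 0 \<xi> \<eta> = gb (\<xi>, \<eta>)" "Cb \<ge> 1"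
    "\<And>j \<xi> \<eta>. \<bar>\<xi>\<bar> \<le> 1 \<Longrightarrow> \<bar>\<eta>\<bar> \<le> 1 \<Longrightarrow> norm (b j \<xi> \<eta>) \<le> Cb ^ Suc j * fact j powr \<sigma>"
    using gevrey_jet[OF gb] by blast
  define Cab where "Cab = max Ca Cb"
  have Cab: "Cab \<ge> 1" using a(3) by (simp add: Cab_def)
  have raise: "c ^ Suc j * fact j powr \<sigma> \<le> Cab ^ Suc j * fact j powr \<sigma>" if "1 \<le> c" "c \<le> Cab" for c j
    using that by (intro mult_right_mono power_mono) auto
  have a_b: "norm (a j \<xi> \<eta>) \<le> Cab ^ Suc j * fact j powr \<sigma>"
    and b_b: "norm (b j \<xi> \<eta>) \<le> Cab ^ Suc j * fact j powr \<sigma>" if "\<bar>\<xi>\<bar> \<le> 1" "\<bar>\<eta>\<bar> \<le> 1" for j \<xi> \<eta>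
    using order_trans[OF a(4)[OF that] raise[OF a(3)]] order_trans[OF b(4)[OF that] raise[OF b(3)]]
    by (auto simp: Cab_def)
  define Kd where "Kd = Cab * (1 + 2 * Cab) * 2 powr \<sigma>"
  obtain m1 L where m1: "m1 \<ge> 0" "L \<ge> 0"
    "\<And>x \<xi> \<gamma>. \<bar>x\<bar> \<le> 1 \<Longrightarrow> \<bar>\<xi>\<bar> \<le> 1 \<Longrightarrow> \<bar>\<gamma>\<bar> \<le> 1 \<Longrightarrow> \<bar>m (x, \<xi>, \<gamma>)\<bar> \<le> m1"
    "\<And>x x' \<xi> \<gamma>. \<bar>x\<bar> \<le> 1 \<Longrightarrow> \<bar>x'\<bar> \<le> 1 \<Longrightarrow> \<bar>\<xi>\<bar> \<le> 1 \<Longrightarrow> \<bar>\<gamma>\<bar> \<le> 1 \<Longrightarrow>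
       \<bar>m (x, \<xi>, \<gamma>) - m (x', \<xi>, \<gamma>)\<bar> \<le> L * \<bar>x - x'\<bar>"
    using smooth_bounded_lipschitz[OF assms(2)] by blast
  have m_cont: "continuous_on UNIV m" using smooth_on_iter_continuous[OF assms(2), of "[]"] by simp
  have \<phi>_gev: "gevrey \<sigma> UNIV \<phi>" using assms(5) by (simp add: gevrey0_def)
  have \<phi>_cont: "continuous_on UNIV \<phi>"
    using \<phi>_gev smooth_on_iter_continuous[of \<phi> "[]"] by (simp add: gevrey_def)
  have \<phi>_supp: "\<phi> t = 0" if "\<bar>t\<bar> > 1" for t
  proof (rule ccontr)
    assume "\<phi> t \<noteq> 0"
    then have "t \<in> supp_on UNIV \<phi>"
      unfolding supp_on_def using closure_subset[of "{x \<in> UNIV. \<phi> x \<noteq> 0}"] by auto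
    then have "t \<in> {-1..1}" using assms(8) by blast
    with that show False by auto
  qed
  obtain c where c: "c > 0" "\<And>\<epsilon> \<gamma> g. \<epsilon> \<in> {0<..<1} \<Longrightarrow> \<gamma> \<in> {0<..<1} \<Longrightarrow> g \<in> borel_measurable borel \<Longrightarrow>
      ennreal c * max (L1_norm_on (data_region \<epsilon> \<gamma>) g) (L1_norm_on {-\<epsilon>..\<epsilon>} (\<lambda>\<xi>. g (\<xi>, \<gamma>))) \<le> N \<epsilon> \<gamma> g"
    using assms(10) unfolding data_norm_family_def by blast
  define t where "t = 8 * \<sigma> + 12"
  have t: "t > 0" using \<sigma> by (simp add: t_def)
  \<comment> \<open>\<open>\<gamma>\<^sub>0 = 1\<close> keeps \<open>\<gamma>\<close> in the range where the lower bound for the data norm holds\<close>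
  show ?thesis
  proof (rule exI[of _ 1], intro conjI allI impI)
    fix C\<^sub>0 :: real assume C\<^sub>0: "C\<^sub>0 > 0"
    \<comment> \<open>the summand 1 ensures \<open>H \<ge> 1\<close>, so that the main term of \<open>L2_from_moments\<close> dominates the moment term\<close>
    define H where "H = 1 + C\<^sub>0 * (2 * m1 + 6 * L)"
    have H: "H \<ge> 1" "C\<^sub>0 * (2 * m1 + 6 * L) \<le> H" using C\<^sub>0 m1 by (auto simp: H_def)
    define M where "M = 131072 * H"
    have M: "M > 0" using H by (simp add: M_def)
    show "\<exists>M>0. \<exists>C>0. \<forall>\<alpha> \<epsilon> \<gamma>.
           0 < \<alpha> \<and> \<alpha> \<le> 1 \<and> 0 < \<epsilon> \<and> \<epsilon> < 1 \<and>
           0 < \<gamma> \<and> \<gamma> < 1 \<and> \<gamma> \<ge> \<epsilon>\<^sup>2 / 4 \<and> x_pos \<epsilon> \<gamma> \<le> 1 \<longrightarrow>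
           (\<exists>\<delta>>0. \<forall>f :: real \<times> real \<Rightarrow> complex.
              holder_seminorm \<alpha> f \<le> ennreal C\<^sub>0 \<and>
              supp_on UNIV f \<subseteq> {(x, y). y \<ge> x\<^sup>2} \<and>
              N \<epsilon> \<gamma> (weighted_radon m f) < ennreal \<delta> \<longrightarrow>
              (let \<nu> = enn2real (N \<epsilon> \<gamma> (weighted_radon m f)) in
                 L2_norm_on {-1..1} (mean \<phi> m \<epsilon> \<gamma> f)
                 \<le> ennreal (if \<nu> = 0 then 0
                     else 4 * M * (ln (C / \<epsilon>) * ln (ln (M / \<nu>)) / ln (M / \<nu>)) powr \<alpha>)))"
    proof (rule exI[of _ M], intro conjI M, rule exI[of _ "exp (2 * t)"], intro conjI allI impI)
      fix \<alpha> \<epsilon> \<gamma> :: real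
      assume "0 < \<alpha> \<and> \<alpha> \<le> 1 \<and> 0 < \<epsilon> \<and> \<epsilon> < 1 \<and>
           0 < \<gamma> \<and> \<gamma> < 1 \<and> \<gamma> \<ge> \<epsilon>\<^sup>2 / 4 \<and> x_pos \<epsilon> \<gamma> \<le> 1"
      then have \<alpha>: "0 < \<alpha>" "\<alpha> \<le> 1" and \<epsilon>: "0 < \<epsilon>" "\<epsilon> < 1" and \<gamma>: "0 < \<gamma>" "\<gamma> < 1" "\<epsilon>\<^sup>2 / 4 \<le> \<gamma>" "x_pos \<epsilon> \<gamma> \<le> 1"
        by auto
      have \<epsilon>\<gamma>: "\<epsilon> + \<gamma> \<le> 1" using x_pos_le_one \<epsilon> \<gamma> by blast
      obtain \<psi> K\<^sub>\<phi> D where \<psi>: "jet \<psi>" "\<And>\<xi> \<eta>. \<psi> 0 \<xi> \<eta> = of_real (\<phi> (\<xi> / \<epsilon>) / \<epsilon>)"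
        "\<And>j \<eta>. \<psi> j \<epsilon> \<eta> = 0" "\<And>j \<eta>. \<psi> j (- \<epsilon>) \<eta> = 0" "K\<^sub>\<phi> \<ge> 1" "D \<ge> 1" "gevrey_jet_bound \<sigma> \<epsilon> K\<^sub>\<phi> 0 D \<psi>"
        using gevrey_bump_jet[OF \<phi>_gev assms(8) \<epsilon>(1)] \<epsilon>(2) by (metis less_imp_le)
      define K where "K = max K\<^sub>\<phi> Kd"
      have K: "K \<ge> 1" "K\<^sub>\<phi> \<le> K" "Kd \<le> K" using \<psi>(5) by (auto simp: K_def)
      have Kd: "Kd \<ge> 0" using Cab by (simp add: Kd_def)
      \<comment> \<open>everything from here on may depend on \<open>\<epsilon>\<close>, \<open>\<gamma>\<close> and \<open>\<alpha>\<close>, since it enters only the threshold \<open>\<delta>\<close>\<close>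
      define P where "P = exp (2 * Cab) * D / c"
      have P: "P > 0" using \<psi>(6) c(1) by (simp add: P_def)
      have "256 * K \<ge> 1" using K by simp
      then obtain L\<^sub>0 where L\<^sub>0: "\<And>\<Lambda>. \<Lambda> \<ge> L\<^sub>0 \<Longrightarrow> ln \<Lambda> > 0 \<and> \<Lambda> > 0 \<and>
          (\<exists>n\<ge>2. (P * M * exp (- \<Lambda>))\<^sup>2 * (256 * K * real n) powr (t * real n) \<le> 1 \<and> 1 / real n \<le> 2 * t * ln \<Lambda> / \<Lambda>)"
        using degree_choice[OF t, of "256 * K" "P * M"] by blast
      show "\<exists>\<delta>>0. \<forall>f :: real \<times> real \<Rightarrow> complex.
              holder_seminorm \<alpha> f \<le> ennreal C\<^sub>0 \<and>
              supp_on UNIV f \<subseteq> {(x, y). y \<ge> x\<^sup>2} \<and>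
              N \<epsilon> \<gamma> (weighted_radon m f) < ennreal \<delta> \<longrightarrow>
              (let \<nu> = enn2real (N \<epsilon> \<gamma> (weighted_radon m f)) in
                 L2_norm_on {-1..1} (mean \<phi> m \<epsilon> \<gamma> f)
                 \<le> ennreal (if \<nu> = 0 then 0
                     else 4 * M * (ln (exp (2 * t) / \<epsilon>) * ln (ln (M / \<nu>)) / ln (M / \<nu>)) powr \<alpha>))"
      proof (rule exI[of _ "M * exp (- L\<^sub>0)"], intro conjI allI impI)
        show "M * exp (- L\<^sub>0) > 0" using M by simp
        fix f :: "real \<times> real \<Rightarrow> complex"
        assume "holder_seminorm \<alpha> f \<le> ennreal C\<^sub>0 \<and> supp_on UNIV f \<subseteq> {(x, y). y \<ge> x\<^sup>2} \<and>
              N \<epsilon> \<gamma> (weighted_radon m f) < ennreal (M * exp (- L\<^sub>0))"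
        then have f_hol: "norm (f p - f q) \<le> C\<^sub>0 * dist p q powr \<alpha>"
          and supp: "supp_on UNIV f \<subseteq> {(x, y). y \<ge> x\<^sup>2}"
          and small: "N \<epsilon> \<gamma> (weighted_radon m f) < ennreal (M * exp (- L\<^sub>0))" for p q
          using holder_seminorm_le[of \<alpha> f C\<^sub>0] C\<^sub>0 by auto
        have f_cont: "continuous_on UNIV f"
          by (rule holder_continuous[of f C\<^sub>0 \<alpha>]) (use f_hol \<alpha> in \<open>auto simp: dist_norm[of "f _"]\<close>)
        have f_supp: "f (x, y) = 0" if "y < x\<^sup>2" for x y
        proof (rule ccontr)
          assume "f (x, y) \<noteq> 0"
          then have "(x, y) \<in> supp_on UNIV f"
            unfolding supp_on_def using closure_subset[of "{x \<in> UNIV. f x \<noteq> 0}"] by auto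
          with supp that show False by auto
        qed
        interpret transported_weight m a b f \<epsilon> \<gamma>
        proof
          show "((\<lambda>\<xi>. complex_of_real (m (x, \<xi>, y - \<xi> * x))) has_vector_derivative
             (of_real x * a 0 \<xi> (y - \<xi> * x) + b 0 \<xi> (y - \<xi> * x)) * of_real (m (x, \<xi>, y - \<xi> * x))) (at \<xi>)" for x \<xi> y
            unfolding a(2) b(2) by (rule weight_derivative[OF assms(2) transport])
        qed (use m_cont a b f_cont f_supp \<epsilon> \<gamma> \<epsilon>\<gamma> in auto)
        define \<nu> where "\<nu> = enn2real (N \<epsilon> \<gamma> (weighted_radon m f))"
        have N: "N \<epsilon> \<gamma> (weighted_radon m f) = ennreal \<nu>"
          unfolding \<nu>_def using small by (metis ennreal_enn2real ennreal_less_top order.strict_trans)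
        have \<nu>0: "\<nu> \<ge> 0" by (simp add: \<nu>_def)
        have \<nu>: "\<nu> < M * exp (- L\<^sub>0)" using small \<nu>0 unfolding N by (simp add: ennreal_less_iff)
        define h where "h x = line_mean x (\<psi> 0)" for x
        have \<psi>0: "\<psi> 0 = (\<lambda>\<xi> \<eta>. of_real (\<phi> (\<xi> / \<epsilon>) / \<epsilon>))" using \<psi>(2) by blast
        have ends: "\<psi> 0 \<epsilon> \<gamma> = 0" "\<psi> 0 (- \<epsilon>) \<gamma> = 0" by (simp_all add: \<psi>(3,4))
        have h_hol: "norm (h x - h x') \<le> H * \<bar>x - x'\<bar> powr \<alpha>" for x x'
          unfolding h_def
        proof (rule line_mean_holder_global)
          fix x x' :: real assume x: "\<bar>x\<bar> \<le> 1" "\<bar>x'\<bar> \<le> 1"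
          have "norm (line_mean x (\<psi> 0) - line_mean x' (\<psi> 0)) \<le> C\<^sub>0 * (2 * m1 + 6 * L) * \<bar>x - x'\<bar> powr \<alpha>"
            unfolding \<psi>0
          proof (rule line_mean_holder)
            show "continuous_on UNIV (\<lambda>\<xi>. \<phi> (\<xi> / \<epsilon>) / \<epsilon>)"
              using \<epsilon> by (intro continuous_intros continuous_on_compose2[OF \<phi>_cont]) auto
            show "integral {- \<epsilon>..\<epsilon>} (\<lambda>\<xi>. \<phi> (\<xi> / \<epsilon>) / \<epsilon>) = 1"
              using integral_rescaled[OF \<phi>_cont \<phi>_supp \<epsilon>(1)] assms(9) by simp
          qed (use assms(6) \<epsilon> f_hol C\<^sub>0 \<alpha> m1 \<gamma> \<open>\<gamma> < 1\<close> x in auto)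
          also have "\<dots> \<le> H * \<bar>x - x'\<bar> powr \<alpha>" using H by (intro mult_right_mono) auto
          finally show "norm (line_mean x (\<psi> 0) - line_mean x' (\<psi> 0)) \<le> H * \<bar>x - x'\<bar> powr \<alpha>" .
        qed (use ends H \<alpha> in auto)
        have h_supp: "h x = 0" if "\<bar>x\<bar> \<ge> 1" for x
          unfolding h_def by (rule line_mean_outside[of "\<psi> 0", OF ends that])
        have h_cont: "continuous_on UNIV h"
          by (rule holder_continuous[of h H \<alpha>]) (use h_hol \<alpha> in \<open>auto simp: dist_norm\<close>)
        have L2: "L2_norm_on {-1..1} (mean \<phi> m \<epsilon> \<gamma> f) = ennreal (sqrt (integral {-1..1} (\<lambda>x. (norm (h x))\<^sup>2)))"
        proof (rule L2_mean[OF _ h_cont])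
          fix x :: real assume "x \<noteq> 0"
          then show "mean \<phi> m \<epsilon> \<gamma> f x = h x"
            unfolding h_def \<psi>0 by (intro mean_eq_line_mean \<phi>_cont assms(7) \<phi>_supp)
        qed
        have masses: "slice_mass \<le> \<nu> / c" "data_mass \<le> \<nu> / c"
        proof -
          have "ennreal c * max (ennreal data_mass) (ennreal slice_mass) \<le> ennreal \<nu>"
            using c(2)[OF _ _ weighted_radon_measurable[OF f_cont m_cont], of \<epsilon> \<gamma>] \<epsilon> \<gamma> \<open>\<epsilon> < 1\<close> \<open>\<gamma> < 1\<close>
            unfolding data_mass_eq slice_mass_eq N by simp
          then have "ennreal c * ennreal data_mass \<le> ennreal \<nu>" "ennreal c * ennreal slice_mass \<le> ennreal \<nu>"
            by (meson max.cobounded1 max.cobounded2 mult_left_mono order_trans zero_le)+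
          then have "ennreal (c * data_mass) \<le> ennreal \<nu>" "ennreal (c * slice_mass) \<le> ennreal \<nu>"
            using c(1) by (simp_all add: ennreal_mult')
          then have "c * data_mass \<le> \<nu>" "c * slice_mass \<le> \<nu>"
            using \<nu>0 by (simp_all add: ennreal_le_iff)
          then show "slice_mass \<le> \<nu> / c" "data_mass \<le> \<nu> / c"
            using c(1) by (simp_all add: pos_le_divide_eq mult.commute)
        qed
        have mom: "norm (moment h k) \<le> P * \<nu> * (4 * K) ^ k * fact k powr \<sigma>" for k
        proof -
          have "gevrey_jet_bound \<sigma> \<epsilon> Kd 0 Kd drift"
            unfolding Kd_def by (rule gevrey_jet_bound_drift[OF a_b b_b Cab \<sigma>])
          then have dr: "gevrey_jet_bound \<sigma> \<epsilon> K 0 K drift" by (rule gevrey_jet_bound_mono) (use K Kd in auto)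
          have gp: "gevrey_jet_bound \<sigma> \<epsilon> K 0 D \<psi>" by (rule gevrey_jet_bound_mono[OF \<psi>(7)]) (use K \<psi> in auto)
          have "norm (moment (\<lambda>x. line_mean x (\<psi> 0)) k) \<le> exp (2 * Cab) * D * (4 * K) ^ k * fact k powr \<sigma> * (\<nu> / c)"
            by (rule moment_bound[OF \<psi>(1,3,4) _ gp dr \<sigma> K(1) \<psi>(6) _ _ masses])
               (use \<psi>(2) a_b[of _ _ 0] Cab in auto)
          then show ?thesis by (simp add: h_def[abs_def] P_def mult_ac)
        qed
        have key: "integral {-1..1} (\<lambda>x. (norm (h x))\<^sup>2) \<le> (M * real n powr (- \<alpha>))\<^sup>2"
          if n: "n \<ge> 2" and "(P * \<nu>)\<^sup>2 * (256 * K * real n) powr (t * real n) \<le> 1" for n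
          unfolding M_def
          by (rule L2_from_moments[OF h_hol \<alpha> h_supp n H(1) K(1) _ \<sigma> mom])
             (use that P \<nu>0 in \<open>auto simp: t_def\<close>)
        show "let \<nu> = enn2real (N \<epsilon> \<gamma> (weighted_radon m f)) in
                 L2_norm_on {-1..1} (mean \<phi> m \<epsilon> \<gamma> f)
                 \<le> ennreal (if \<nu> = 0 then 0
                     else 4 * M * (ln (exp (2 * t) / \<epsilon>) * ln (ln (M / \<nu>)) / ln (M / \<nu>)) powr \<alpha>)"
          unfolding Let_def \<nu>_def[symmetric] L2
        proof (rule ennreal_leI)
          show "sqrt (integral {-1..1} (\<lambda>x. (norm (h x))\<^sup>2)) \<le> (if \<nu> = 0 then 0
                     else 4 * M * (ln (exp (2 * t) / \<epsilon>) * ln (ln (M / \<nu>)) / ln (M / \<nu>)) powr \<alpha>)"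
          proof (cases "\<nu> = 0")
            \<comment> \<open>all moments vanish, and \<open>n\<close> may tend to infinity\<close>
            case True
            have "integral {-1..1} (\<lambda>x. (norm (h x))\<^sup>2) \<le> 0"
            proof (rule tendsto_lowerbound)
              show "((\<lambda>n. (M * real n powr (- \<alpha>))\<^sup>2) \<longlongrightarrow> 0) sequentially"
                using \<alpha> M by real_asymp
              show "\<forall>\<^sub>F n in sequentially. integral {-1..1} (\<lambda>x. (norm (h x))\<^sup>2) \<le> (M * real n powr (- \<alpha>))\<^sup>2"
                using eventually_ge_at_top[of 2] by eventually_elim (rule key, auto simp: True)
            qed simp
            then show ?thesis using True by simp
          next
            case False
            then have \<nu>1: "\<nu> > 0" using \<nu>0 by simp
            define \<Lambda> where "\<Lambda> = ln (M / \<nu>)"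
            have \<nu>eq: "\<nu> = M * exp (- \<Lambda>)" using M \<nu>1 by (simp add: \<Lambda>_def exp_minus)
            have "exp (- \<Lambda>) < exp (- L\<^sub>0)" using \<nu> M unfolding \<nu>eq by simp
            then have "\<Lambda> \<ge> L\<^sub>0" by simp
            from L\<^sub>0[OF this] obtain n where \<Lambda>: "ln \<Lambda> > 0" "\<Lambda> > 0" and n: "n \<ge> 2"
              and n1: "(P * M * exp (- \<Lambda>))\<^sup>2 * (256 * K * real n) powr (t * real n) \<le> 1"
              and n2: "1 / real n \<le> 2 * t * ln \<Lambda> / \<Lambda>" by blast
            have "sqrt (integral {-1..1} (\<lambda>x. (norm (h x))\<^sup>2)) \<le> M * real n powr (- \<alpha>)"
              using key[OF n] n1 M unfolding \<nu>eq by (intro real_le_lsqrt) (auto simp: mult.assoc)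
            also have "real n powr (- \<alpha>) = (1 / real n) powr \<alpha>"
              by (simp add: powr_minus powr_divide inverse_eq_divide)
            also have "M * (1 / real n) powr \<alpha> \<le> (4 * M) * (ln (exp (2 * t) / \<epsilon>) * ln \<Lambda> / \<Lambda>) powr \<alpha>"
            proof (intro mult_mono powr_mono2)
              have "ln (exp (2 * t) / \<epsilon>) = 2 * t - ln \<epsilon>" using \<epsilon> by (simp add: ln_div)
              moreover have "ln \<epsilon> < 0" using \<epsilon> \<open>\<epsilon> < 1\<close> by simp
              ultimately have "2 * t \<le> ln (exp (2 * t) / \<epsilon>)" by simp
              then have "2 * t * ln \<Lambda> / \<Lambda> \<le> ln (exp (2 * t) / \<epsilon>) * ln \<Lambda> / \<Lambda>"
                using \<Lambda> by (intro divide_right_mono mult_right_mono) auto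
              with n2 show "1 / real n \<le> ln (exp (2 * t) / \<epsilon>) * ln \<Lambda> / \<Lambda>" by linarith
            qed (use M \<alpha> in auto)
            finally show ?thesis using False by (simp add: \<Lambda>_def)
          qed
        qed
      qed
    qed simp
  qed simp
qed

end
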